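(* Consider a continuous piecewise linear differential system with three zones $${\bf x}'=\begin{cases}A_-{\bf x}+B_-, & {\bf x}\in R_-,\\ A_o{\bf x}+B_o, & {\bf x}\in R_o,\\ A_+{\bf x}+B_+, & {\bf x}\in R_+,\end{cases}$$ with ${\bf x}=(x,y)\in\mathbb{R}^2$, $A_i\in\mathcal{M}_2(\mathbb{R})$, $B_i\in\mathbb{R}^2$, $i\in\{-,o,+\}$, and let $X_i({\bf x})=A_i{\bf x}+B_i$. Assume that $X_o$ has a focus, and that, of the equilibria of $X_-$ and $X_+$, one is a center and the other is a focus whose stability is different from that of the focus of $X_o$. Assume moreover that the focus of $X_o$ is real and lies on the boundary of $R_o$. If the focus of $X_o$ belongs to $L_+$ (respectively $L_-$), and $X_+$ (respectively $X_-$) also has a focus at the same point of $L_+$ (respectively $L_-$), and these two foci together give rise to a center for the piecewise linear system, then at least two limit cycles can appear by small perturbations of the parameters of the system; that is, there are continuous piecewise linear systems of the same form (with the same $R_-,R_o,R_+$), with parameters $(A_i,B_i)_{i\in\{-,o,+\}}$ arbitrarily close to those of the given system, that have at least two limit cycles.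
   Context: The plane $\mathbb{R}^2$ is divided into three closed regions $R_-,R_o,R_+$ whose frontiers are given by two parallel straight lines $L_-$ and $L_+$, symmetric with respect to the origin, such that $(0,0)\in R_o$ and $R_-$, $R_+$ have as boundary $L_-$, $L_+$ respectively. The system is continuous, i.e. $X_-=X_o$ on $L_-$ and $X_o=X_+$ on $L_+$. An equilibrium ${\bf x}^*$ of the linear vector field $X_i$ (defined on all of $\mathbb{R}^2$) is called real if ${\bf x}^*\in R_i$ and virtual if ${\bf x}^*\notin R_i$; the equilibria of $X_-$, $X_o$, $X_+$ in the hypotheses may a priori be real or virtual. Two foci have different stability if one is attracting and the other is repelling. "Give rise to a center for the system" means that the common equilibrium point has a neighborhood that, apart from the point itself, is filled by periodic orbits of the piecewise linear system. A limit cycle is a periodic orbit of the system that is isolated in the set of all its periodic orbits. *)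

theory Defs
  imports "HOL-Analysis.Analysis"
begin

text \<open>A linear vector field \<open>A x + B\<close> on the plane is encoded by the pair \<open>(A, B)\<close>; a three-zone
  system by the triple \<open>(X\<^sub>-, X\<^sub>o, X\<^sub>+)\<close> of such pairs. The parameter space thereby carries the
  library's product metric.\<close>

type_synonym lin_field = "(real^2^2) \<times> (real^2)"
type_synonym pwl_params = "lin_field \<times> lin_field \<times> lin_field"

definition lin_vf :: "lin_field \<Rightarrow> real^2 \<Rightarrow> real^2" where
  "lin_vf X x = fst X *v x + snd X"

text \<open>For \<open>n \<noteq> 0\<close> and \<open>c > 0\<close> the lines \<open>n \<bullet> x = -c\<close> and \<open>n \<bullet> x = c\<close> are the general pair of
  distinct parallel lines that are symmetric to each other with respect to the origin.\<close>

definition L_minus :: "real^2 \<Rightarrow> real \<Rightarrow> (real^2) set" where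
  "L_minus n c = {x. n \<bullet> x = - c}"

definition L_plus :: "real^2 \<Rightarrow> real \<Rightarrow> (real^2) set" where
  "L_plus n c = {x. n \<bullet> x = c}"

definition R_minus :: "real^2 \<Rightarrow> real \<Rightarrow> (real^2) set" where
  "R_minus n c = {x. n \<bullet> x \<le> - c}"

definition R_zero :: "real^2 \<Rightarrow> real \<Rightarrow> (real^2) set" where
  "R_zero n c = {x. - c \<le> n \<bullet> x \<and> n \<bullet> x \<le> c}"

definition R_plus :: "real^2 \<Rightarrow> real \<Rightarrow> (real^2) set" where
  "R_plus n c = {x. c \<le> n \<bullet> x}"

definition pwl_continuous :: "real^2 \<Rightarrow> real \<Rightarrow> pwl_params \<Rightarrow> bool" where
  "pwl_continuous n c = (\<lambda>(Xm, Xo, Xp).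
     (\<forall>x\<in>L_minus n c. lin_vf Xm x = lin_vf Xo x) \<and>
     (\<forall>x\<in>L_plus n c. lin_vf Xo x = lin_vf Xp x))"

text \<open>The order of the case distinction is immaterial when \<open>pwl_continuous\<close> holds.\<close>

definition pwl_vf :: "real^2 \<Rightarrow> real \<Rightarrow> pwl_params \<Rightarrow> real^2 \<Rightarrow> real^2" where
  "pwl_vf n c = (\<lambda>(Xm, Xo, Xp) x.
     if x \<in> R_minus n c then lin_vf Xm x
     else if x \<in> R_zero n c then lin_vf Xo x
     else lin_vf Xp x)"

definition complex_eigenvalues :: "real^2^2 \<Rightarrow> complex set" where
  "complex_eigenvalues A =
     {l. \<exists>v :: complex^2. v \<noteq> 0 \<and> map_matrix complex_of_real A *v v = l *s v}"

definition lin_focus :: "lin_field \<Rightarrow> real^2 \<Rightarrow> bool" where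
  "lin_focus X p \<longleftrightarrow> lin_vf X p = 0 \<and>
     (\<forall>l\<in>complex_eigenvalues (fst X). Im l \<noteq> 0 \<and> Re l \<noteq> 0)"

definition lin_center :: "lin_field \<Rightarrow> real^2 \<Rightarrow> bool" where
  "lin_center X p \<longleftrightarrow> lin_vf X p = 0 \<and>
     (\<forall>l\<in>complex_eigenvalues (fst X). Im l \<noteq> 0 \<and> Re l = 0)"

definition attracting_focus :: "lin_field \<Rightarrow> real^2 \<Rightarrow> bool" where
  "attracting_focus X p \<longleftrightarrow> lin_focus X p \<and> (\<forall>l\<in>complex_eigenvalues (fst X). Re l < 0)"

definition repelling_focus :: "lin_field \<Rightarrow> real^2 \<Rightarrow> bool" where
  "repelling_focus X p \<longleftrightarrow> lin_focus X p \<and> (\<forall>l\<in>complex_eigenvalues (fst X). Re l > 0)"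

definition foci_different_stability ::
    "lin_field \<Rightarrow> real^2 \<Rightarrow> lin_field \<Rightarrow> real^2 \<Rightarrow> bool" where
  "foci_different_stability X p Y q \<longleftrightarrow>
     attracting_focus X p \<and> repelling_focus Y q \<or>
     repelling_focus X p \<and> attracting_focus Y q"

definition solution :: "(real^2 \<Rightarrow> real^2) \<Rightarrow> (real \<Rightarrow> real^2) \<Rightarrow> bool" where
  "solution F \<phi> \<longleftrightarrow> (\<forall>t. (\<phi> has_vector_derivative F (\<phi> t)) (at t))"

definition periodic_orbit :: "(real^2 \<Rightarrow> real^2) \<Rightarrow> (real^2) set \<Rightarrow> bool" where
  "periodic_orbit F \<Gamma> \<longleftrightarrow>
     (\<exists>\<phi> T. solution F \<phi> \<and> T > 0 \<and> (\<forall>t. \<phi> (t + T) = \<phi> t) \<and>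
            \<not> \<phi> constant_on UNIV \<and> \<Gamma> = range \<phi>)"

text \<open>Isolation among the periodic orbits: some neighbourhood of the orbit contains no other
  periodic orbit. This implies isolation with respect to the Hausdorff distance.\<close>

definition limit_cycle :: "(real^2 \<Rightarrow> real^2) \<Rightarrow> (real^2) set \<Rightarrow> bool" where
  "limit_cycle F \<Gamma> \<longleftrightarrow> periodic_orbit F \<Gamma> \<and>
     (\<exists>U. open U \<and> \<Gamma> \<subseteq> U \<and> (\<forall>\<Gamma>'. periodic_orbit F \<Gamma>' \<and> \<Gamma>' \<subseteq> U \<longrightarrow> \<Gamma>' = \<Gamma>))"

definition system_center :: "(real^2 \<Rightarrow> real^2) \<Rightarrow> real^2 \<Rightarrow> bool" where
  "system_center F p \<longleftrightarrow> F p = 0 \<and>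
     (\<exists>U. p \<in> interior U \<and> U - {p} = \<Union>{\<Gamma>. periodic_orbit F \<Gamma> \<and> \<Gamma> \<subseteq> U - {p}})"

end

theory Submission
  imports Defs
begin

text \<open>
  \<^bold>\<open>Normal form.\<close> In the coordinates \<open>x = n \<bullet> z - c\<close> and a suitable second linear coordinate \<open>y\<close>, a
  continuous three-zone system is a Lienard system \<open>x' = f x - y, y' = g x - a\<close> with continuous
  piecewise linear \<open>f\<close> and \<open>g\<close> (\<open>pwl_vf_lienard_form\<close>). The lines \<open>L\<^sub>+\<close> and \<open>L\<^sub>-\<close> become \<open>x = 0\<close> and
  \<open>x = - w\<close> with \<open>w = 2 c\<close>. The reflection \<open>n \<mapsto> - n\<close> and time reversal reduce the theorem to the case
  that the focus lies on \<open>L\<^sub>+\<close>, attracts in \<open>R\<^sub>o\<close> and repels in \<open>R\<^sub>+\<close>; then \<open>X\<^sub>-\<close> is the center, and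
  its trace is zero. A half-turn about a focus with trace \<open>T\<close> and determinant \<open>D\<close> multiplies the
  distance from it by \<open>exp (g \<pi>)\<close> with \<open>g = T / sqrt (4 D - T\<^sup>2)\<close>. So the two foci give a center
  only if \<open>g\<^sub>+ + g\<^sub>o = 0\<close> (\<open>half_turns_cancel\<close>).

  \<^bold>\<open>Perturbation.\<close> First the trace of \<open>X\<^sub>+\<close> is decreased a little, which makes \<open>g\<^sub>+ + g\<^sub>o\<close> negative. The
  orbits near the focus now spiral inwards. Large orbits still spiral outwards, because they spend
  time in \<open>R\<^sub>-\<close>, where the divergence is zero instead of negative. In between lies a limit cycle that
  visits all three zones. Then the equilibrium is pushed by a far smaller amount, measured by
  \<open>a > 0\<close>, from \<open>L\<^sub>+\<close> into \<open>R\<^sub>+\<close>, where it is a repelling focus. The first limit cycle persists, and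
  between the repelling focus and the orbits that spiral inwards a second one appears, which
  visits only \<open>R\<^sub>o\<close> and \<open>R\<^sub>+\<close>.

  \<^bold>\<open>Counting.\<close> An orbit leaves the half-line \<open>x = 0, y \<ge> 0\<close> at height \<open>v\<close>, passes through \<open>x < 0\<close>, meets
  \<open>x = 0\<close> at height \<open>- u\<close>, and returns through \<open>x > 0\<close>. For given \<open>V = v\<^sup>2\<close> let \<open>l V\<close> be the value of
  \<open>u\<^sup>2\<close> for the passage through \<open>x < 0\<close> that starts at height \<open>v\<close>, and \<open>r V\<close> the value of \<open>u\<^sup>2\<close> for
  the passage through \<open>x > 0\<close> that ends at height \<open>v\<close>. Periodic orbits are zeros of \<open>l - r\<close>. The
  squares are useful because the flux through the line \<open>x = 0\<close> between two heights is half the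
  difference of the squares: the derivative of \<open>l\<close> is the factor by which the flow changes areas along
  the passage, and the derivative of \<open>r\<close> is the reciprocal of such a factor. Both are exponentials
  of a passage time, in \<open>R\<^sub>o\<close> or in \<open>R\<^sub>+\<close>, weighted by the trace. Passage times are monotone in \<open>V\<close>. For orbits that do not reach
  \<open>R\<^sub>-\<close> this makes \<open>l - r\<close> strictly concave (\<open>small_limit_cycle\<close>). For orbits that do, the time
  spent in \<open>R\<^sub>o\<close> decreases and \<open>l\<close> is convex, while the derivative of \<open>r\<close> is almost constant when \<open>a\<close>
  is small (\<open>big_limit_cycle\<close>). In both ranges the signs of \<open>l - r\<close> at the ends yield
  exactly one zero, and a fixed point that is unique in an interval of the return map
  belongs to an isolated periodic orbit (\<open>limit_cycle_of_return_map\<close>).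
\<close>

section \<open>Arcs of orbits of a Lipschitz vector field\<close>

definition solution_upto :: "(real^2 \<Rightarrow> real^2) \<Rightarrow> real \<Rightarrow> (real \<Rightarrow> real^2) \<Rightarrow> bool" where
  "solution_upto F \<tau> \<phi> \<longleftrightarrow>
     (\<forall>t\<in>{0..\<tau>}. (\<phi> has_vector_derivative F (\<phi> t)) (at t within {0..\<tau>}))"

definition orbit_arc :: "(real^2 \<Rightarrow> real^2) \<Rightarrow> (real^2) set \<Rightarrow> real^2 \<Rightarrow> real^2 \<Rightarrow> bool" where
  "orbit_arc F Z P Q \<longleftrightarrow>
     (\<exists>\<tau> \<phi>. 0 < \<tau> \<and> solution_upto F \<tau> \<phi> \<and> \<phi> 0 = P \<and> \<phi> \<tau> = Q \<and> (\<forall>t\<in>{0<..<\<tau>}. \<phi> t \<in> Z))"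

lemma solution_upto_shift:
  assumes "solution F \<phi>"
  shows "solution_upto F \<tau> (\<lambda>t. \<phi> (s + t))"
  unfolding solution_upto_def
proof
  fix t assume "t \<in> {0..\<tau>}"
  have "(\<phi> has_vector_derivative F (\<phi> (s + t))) (at (s + t))"
    using assms by (simp add: solution_def)
  moreover have "((\<lambda>t. s + t) has_vector_derivative 1) (at t)"
    by (auto intro!: derivative_eq_intros)
  ultimately have "((\<phi> \<circ> (\<lambda>t. s + t)) has_vector_derivative 1 *\<^sub>R F (\<phi> (s + t))) (at t)"
    by (intro vector_diff_chain_at)
  then show "((\<lambda>t. \<phi> (s + t)) has_vector_derivative F (\<phi> (s + t))) (at t within {0..\<tau>})"
    by (auto simp: o_def intro: has_vector_derivative_at_within)
qed

lemma solution_reverse: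
  assumes "solution F \<phi>"
  shows "solution (\<lambda>x. - F x) (\<lambda>t. \<phi> (- t))"
  unfolding solution_def
proof
  fix t
  have "(\<phi> has_vector_derivative F (\<phi> (- t))) (at (- t))"
    using assms by (simp add: solution_def)
  moreover have "((\<lambda>t. - t) has_vector_derivative - 1) (at t)"
    by (auto intro!: derivative_eq_intros)
  ultimately have "((\<phi> \<circ> (\<lambda>t. - t)) has_vector_derivative (- 1) *\<^sub>R F (\<phi> (- t))) (at t)"
    by (intro vector_diff_chain_at)
  then show "((\<lambda>t. \<phi> (- t)) has_vector_derivative - F (\<phi> (- t))) (at t)"
    by (simp add: o_def)
qed

lemma solution_upto_reverse:
  assumes "solution_upto F \<tau> \<phi>"
  shows "solution_upto (\<lambda>x. - F x) \<tau> (\<lambda>t. \<phi> (\<tau> - t))"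
  unfolding solution_upto_def
proof
  fix t assume t: "t \<in> {0..\<tau>}"
  have im: "(\<lambda>t. \<tau> - t) ` {0..\<tau>} = {0..\<tau>}"
    by (auto simp: image_iff intro!: bexI[of _ "\<tau> - _"])
  have "(\<phi> has_vector_derivative F (\<phi> (\<tau> - t))) (at (\<tau> - t) within (\<lambda>t. \<tau> - t) ` {0..\<tau>})"
    using assms t unfolding im by (auto simp: solution_upto_def)
  moreover have "((\<lambda>t. \<tau> - t) has_vector_derivative - 1) (at t within {0..\<tau>})"
    by (auto intro!: derivative_eq_intros)
  ultimately have "((\<phi> \<circ> (\<lambda>t. \<tau> - t)) has_vector_derivative (- 1) *\<^sub>R F (\<phi> (\<tau> - t)))
      (at t within {0..\<tau>})"
    by (intro vector_diff_chain_within)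
  then show "((\<lambda>t. \<phi> (\<tau> - t)) has_vector_derivative - F (\<phi> (\<tau> - t))) (at t within {0..\<tau>})"
    by (simp add: o_def)
qed

lemma orbit_arc_reverse:
  assumes "orbit_arc F Z P Q"
  shows "orbit_arc (\<lambda>x. - F x) Z Q P"
proof -
  obtain \<tau> \<phi> where *: "0 < \<tau>" "solution_upto F \<tau> \<phi>" "\<phi> 0 = P" "\<phi> \<tau> = Q"
    "\<forall>t\<in>{0<..<\<tau>}. \<phi> t \<in> Z"
    using assms by (auto simp: orbit_arc_def)
  have "\<phi> (\<tau> - t) \<in> Z" if "t \<in> {0<..<\<tau>}" for t
    using that *(5) by auto
  then show ?thesis
    using * solution_upto_reverse[OF *(2)]
    by (auto simp: orbit_arc_def intro!: exI[of _ \<tau>] exI[of _ "\<lambda>t. \<phi> (\<tau> - t)"])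
qed

lemma orbit_arc_mono: "orbit_arc F Z P Q \<Longrightarrow> Z \<subseteq> Z' \<Longrightarrow> orbit_arc F Z' P Q"
  unfolding orbit_arc_def by blast

lemma solution_upto_append:
  assumes "0 < \<tau>" "0 < \<sigma>" "solution_upto F \<tau> \<phi>" "solution_upto F \<sigma> \<psi>" "\<phi> \<tau> = \<psi> 0"
  shows "solution_upto F (\<tau> + \<sigma>) (\<lambda>t. if t \<in> {0..\<tau>} then \<phi> t else \<psi> (t - \<tau>))"
  unfolding solution_upto_def
proof
  fix t assume t: "t \<in> {0..\<tau> + \<sigma>}"
  have un: "{0..\<tau> + \<sigma>} = {0..\<tau>} \<union> {\<tau>..\<tau> + \<sigma>}"
    using assms by auto
  have cl: "closure {0..\<tau>} \<inter> closure {\<tau>..\<tau> + \<sigma>} = {\<tau>}"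
    using assms by auto
  have 2: "((\<lambda>t. \<psi> (t - \<tau>)) has_vector_derivative F (\<psi> (t - \<tau>))) (at t within {\<tau>..\<tau> + \<sigma>})"
    if "t \<in> {\<tau>..\<tau> + \<sigma>}"
  proof -
    have im: "(\<lambda>t. t - \<tau>) ` {\<tau>..\<tau> + \<sigma>} = {0..\<sigma>}"
      by (auto simp: image_iff intro!: bexI[of _ "_ + \<tau>"])
    have "(\<psi> has_vector_derivative F (\<psi> (t - \<tau>))) (at (t - \<tau>) within (\<lambda>t. t - \<tau>) ` {\<tau>..\<tau> + \<sigma>})"
      using assms that unfolding im by (auto simp: solution_upto_def)
    moreover have "((\<lambda>t. t - \<tau>) has_vector_derivative 1) (at t within {\<tau>..\<tau> + \<sigma>})"
      by (auto intro!: derivative_eq_intros)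
    ultimately have "((\<psi> \<circ> (\<lambda>t. t - \<tau>)) has_vector_derivative 1 *\<^sub>R F (\<psi> (t - \<tau>)))
        (at t within {\<tau>..\<tau> + \<sigma>})"
      by (intro vector_diff_chain_within)
    then show ?thesis
      by (simp add: o_def)
  qed
  have "((\<lambda>t. if t \<in> {0..\<tau>} then \<phi> t else \<psi> (t - \<tau>)) has_vector_derivative
    (if t \<in> {0..\<tau>} then F (\<phi> t) else F (\<psi> (t - \<tau>)))) (at t within {0..\<tau> + \<sigma>})"
  proof (rule has_vector_derivative_If_within_closures[OF _ un])
    show "t \<in> {0..\<tau>} \<union> {\<tau>..\<tau> + \<sigma>}"
      using t un by auto
    show "(\<phi> has_vector_derivative F (\<phi> t))
      (at t within {0..\<tau>} \<union> (closure {0..\<tau>} \<inter> closure {\<tau>..\<tau> + \<sigma>}))"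
      if "t \<in> {0..\<tau>} \<union> (closure {0..\<tau>} \<inter> closure {\<tau>..\<tau> + \<sigma>})"
    proof -
      have "{0..\<tau>} \<union> (closure {0..\<tau>} \<inter> closure {\<tau>..\<tau> + \<sigma>}) = {0..\<tau>}"
        using assms unfolding cl by auto
      then show ?thesis
        using assms that by (simp add: solution_upto_def)
    qed
    show "((\<lambda>t. \<psi> (t - \<tau>)) has_vector_derivative F (\<psi> (t - \<tau>)))
      (at t within {\<tau>..\<tau> + \<sigma>} \<union> (closure {0..\<tau>} \<inter> closure {\<tau>..\<tau> + \<sigma>}))"
      if "t \<in> {\<tau>..\<tau> + \<sigma>} \<union> (closure {0..\<tau>} \<inter> closure {\<tau>..\<tau> + \<sigma>})"
    proof -
      have "{\<tau>..\<tau> + \<sigma>} \<union> (closure {0..\<tau>} \<inter> closure {\<tau>..\<tau> + \<sigma>}) = {\<tau>..\<tau> + \<sigma>}"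
        using assms unfolding cl by auto
      then show ?thesis
        using 2 that by simp
    qed
  qed (use assms in auto)
  then show "((\<lambda>t. if t \<in> {0..\<tau>} then \<phi> t else \<psi> (t - \<tau>)) has_vector_derivative
    F (if t \<in> {0..\<tau>} then \<phi> t else \<psi> (t - \<tau>))) (at t within {0..\<tau> + \<sigma>})"
    by (auto split: if_splits)
qed

lemma orbit_arc_append:
  assumes "orbit_arc F Z P Q" "orbit_arc F Z Q R" "Q \<in> Z"
  shows "orbit_arc F Z P R"
proof -
  obtain \<tau> \<phi> where 1: "0 < \<tau>" "solution_upto F \<tau> \<phi>" "\<phi> 0 = P" "\<phi> \<tau> = Q"
    "\<forall>t\<in>{0<..<\<tau>}. \<phi> t \<in> Z"
    using assms(1) by (auto simp: orbit_arc_def)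
  obtain \<sigma> \<psi> where 2: "0 < \<sigma>" "solution_upto F \<sigma> \<psi>" "\<psi> 0 = Q" "\<psi> \<sigma> = R"
    "\<forall>t\<in>{0<..<\<sigma>}. \<psi> t \<in> Z"
    using assms(2) by (auto simp: orbit_arc_def)
  let ?\<eta> = "\<lambda>t. if t \<in> {0..\<tau>} then \<phi> t else \<psi> (t - \<tau>)"
  have "?\<eta> t \<in> Z" if "t \<in> {0<..<\<tau> + \<sigma>}" for t
  proof (cases "t < \<tau>")
    case True then show ?thesis using that 1(5) by auto
  next
    case False then show ?thesis using that 1 2 assms(3) by (cases "t = \<tau>") auto
  qed
  then show ?thesis
    unfolding orbit_arc_def
    using 1 2 solution_upto_append[of \<tau> \<sigma> F \<phi> \<psi>]
    by (intro exI[of _ "\<tau> + \<sigma>"] exI[of _ ?\<eta>]) auto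
qed

lemma has_vector_derivative_join:
  assumes "(f has_vector_derivative d) (at x within S)" "(f has_vector_derivative d) (at x within T)"
  shows "(f has_vector_derivative d) (at x within S \<union> T)"
  using assms unfolding has_vector_derivative_def has_derivative_within
  by (auto simp: at_within_union intro: filterlim_sup)

lemma minus_period_floor:
  fixes \<tau> t :: real
  assumes "0 < \<tau>"
  shows "t - \<tau> * of_int \<lfloor>t / \<tau>\<rfloor> \<in> {0..<\<tau>}"
proof -
  have "of_int \<lfloor>t / \<tau>\<rfloor> \<le> t / \<tau>" "t / \<tau> < of_int \<lfloor>t / \<tau>\<rfloor> + 1"
    by linarith+
  then have "\<tau> * of_int \<lfloor>t / \<tau>\<rfloor> \<le> t" "t < \<tau> * (of_int \<lfloor>t / \<tau>\<rfloor> + 1)"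
    using assms by (simp_all only: pos_le_divide_eq pos_divide_less_eq mult.commute[of \<tau>])
  then show ?thesis
    by (auto simp: algebra_simps)
qed

text \<open>A solution that returns to its starting point is continued periodically. The only point to
  check is the junction: there both one-sided derivatives are the value of the field at the common
  point.\<close>

lemma periodic_extension:
  assumes "0 < \<tau>" "solution_upto F \<tau> \<phi>" "\<phi> 0 = \<phi> \<tau>"
  shows "\<exists>\<psi>. solution F \<psi> \<and> (\<forall>t. \<psi> (t + \<tau>) = \<psi> t) \<and> (\<forall>t\<in>{0..\<tau>}. \<psi> t = \<phi> t) \<and>
    range \<psi> = \<phi> ` {0..\<tau>}"
proof -
  define \<psi> where "\<psi> = (\<lambda>t. \<phi> (t - \<tau> * of_int \<lfloor>t / \<tau>\<rfloor>))"
  note fl = minus_period_floor[OF assms(1)]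
  have on: "\<psi> t = \<phi> (t - \<tau> * of_int k)" if "t \<in> {\<tau> * of_int k .. \<tau> * (of_int k + 1)}" for t k
  proof (cases "t = \<tau> * (of_int k + 1)")
    case True
    have "\<lfloor>t / \<tau>\<rfloor> = k + 1"
      using assms(1) True by (simp add: floor_eq_iff)
    then show ?thesis
      using True assms(3) by (simp add: \<psi>_def algebra_simps)
  next
    case False
    then have "\<lfloor>t / \<tau>\<rfloor> = k"
      using assms(1) that by (auto simp: floor_eq_iff field_simps)
    then show ?thesis
      by (simp add: \<psi>_def)
  qed
  have der: "(\<psi> has_vector_derivative F (\<psi> t)) (at t within {\<tau> * of_int k .. \<tau> * (of_int k + 1)})"
    (is "_ (at t within ?I)") if t: "t \<in> {\<tau> * of_int k .. \<tau> * (of_int k + 1)}" for t k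
  proof -
    have im: "(\<lambda>t. t - \<tau> * of_int k) ` ?I = {0..\<tau>}"
      by (auto simp: image_iff algebra_simps intro!: bexI[of _ "_ + \<tau> * of_int k"])
    have "t - \<tau> * of_int k \<in> {0..\<tau>}"
      using t by (auto simp: algebra_simps)
    then have "(\<phi> has_vector_derivative F (\<phi> (t - \<tau> * of_int k)))
        (at (t - \<tau> * of_int k) within (\<lambda>t. t - \<tau> * of_int k) ` ?I)"
      using assms unfolding im by (auto simp: solution_upto_def)
    moreover have "((\<lambda>t. t - \<tau> * of_int k) has_vector_derivative 1) (at t within ?I)"
      by (auto intro!: derivative_eq_intros)
    ultimately have "((\<phi> \<circ> (\<lambda>t. t - \<tau> * of_int k)) has_vector_derivative
        1 *\<^sub>R F (\<phi> (t - \<tau> * of_int k))) (at t within ?I)"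
      by (intro vector_diff_chain_within)
    then have "((\<lambda>t. \<phi> (t - \<tau> * of_int k)) has_vector_derivative F (\<psi> t)) (at t within ?I)"
      by (simp add: o_def on[OF t])
    then show ?thesis
      by (rule has_vector_derivative_transform[OF t on, rotated])
  qed
  have "solution F \<psi>"
    unfolding solution_def
  proof
    fix t
    define k where "k = \<lfloor>t / \<tau>\<rfloor>"
    have t: "\<tau> * of_int k \<le> t" "t < \<tau> * (of_int k + 1)"
      using fl[of t] by (auto simp: k_def algebra_simps)
    show "(\<psi> has_vector_derivative F (\<psi> t)) (at t)"
    proof (cases "t = \<tau> * of_int k")
      case False
      then have "t \<in> interior {\<tau> * of_int k .. \<tau> * (of_int k + 1)}"
        using t by auto
      then have "at t within {\<tau> * of_int k .. \<tau> * (of_int k + 1)} = at t"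
        by (rule at_within_interior)
      then show ?thesis
        using der[of t k] t by simp
    next
      case True
      have 1: "(\<psi> has_vector_derivative F (\<psi> t)) (at t within {\<tau> * (of_int k - 1) .. \<tau> * of_int k})"
        using der[of t "k - 1"] True assms(1) by (simp add: algebra_simps)
      have "(\<psi> has_vector_derivative F (\<psi> t)) (at t within
         ({\<tau> * (of_int k - 1) .. \<tau> * of_int k} \<union> {\<tau> * of_int k .. \<tau> * (of_int k + 1)}))"
        using 1 der[of t k] t by (intro has_vector_derivative_join) auto
      moreover have "{\<tau> * (of_int k - 1) .. \<tau> * of_int k} \<union> {\<tau> * of_int k .. \<tau> * (of_int k + 1)}
        = {\<tau> * (of_int k - 1) .. \<tau> * (of_int k + 1)}"
        using assms(1) by (intro ivl_disj_un_two_touch) (auto simp: algebra_simps)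
      moreover have "t \<in> interior {\<tau> * (of_int k - 1) .. \<tau> * (of_int k + 1)}"
        using True assms(1) by (simp add: algebra_simps)
      ultimately show ?thesis
        by (metis at_within_interior)
    qed
  qed
  moreover have "\<psi> (t + \<tau>) = \<psi> t" for t
  proof -
    have "(t + \<tau>) / \<tau> = t / \<tau> + 1"
      using assms(1) by (simp add: field_simps)
    then show ?thesis
      by (simp add: \<psi>_def algebra_simps)
  qed
  moreover have eq: "\<psi> t = \<phi> t" if "t \<in> {0..\<tau>}" for t
    using on[of t 0] that by simp
  moreover have "range \<psi> = \<phi> ` {0..\<tau>}"
  proof
    show "range \<psi> \<subseteq> \<phi> ` {0..\<tau>}"
      using fl by (fastforce simp: \<psi>_def)
    show "\<phi> ` {0..\<tau>} \<subseteq> range \<psi>"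
      using eq by (metis image_subsetI rangeI)
  qed
  ultimately show ?thesis
    by blast
qed

lemma periodic_orbit_of_two_arcs:
  assumes "orbit_arc F Z P Q" "orbit_arc F Z' Q P" "P \<noteq> Q"
  shows "\<exists>\<Gamma>. periodic_orbit F \<Gamma> \<and> P \<in> \<Gamma> \<and> Q \<in> \<Gamma> \<and> \<Gamma> \<subseteq> insert P (insert Q (Z \<union> Z'))"
proof -
  obtain \<tau> \<phi> where 1: "0 < \<tau>" "solution_upto F \<tau> \<phi>" "\<phi> 0 = P" "\<phi> \<tau> = Q"
    "\<forall>t\<in>{0<..<\<tau>}. \<phi> t \<in> Z"
    using assms(1) by (auto simp: orbit_arc_def)
  obtain \<sigma> \<psi> where 2: "0 < \<sigma>" "solution_upto F \<sigma> \<psi>" "\<psi> 0 = Q" "\<psi> \<sigma> = P"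
    "\<forall>t\<in>{0<..<\<sigma>}. \<psi> t \<in> Z'"
    using assms(2) by (auto simp: orbit_arc_def)
  define \<eta> where "\<eta> = (\<lambda>t. if t \<in> {0..\<tau>} then \<phi> t else \<psi> (t - \<tau>))"
  have "solution_upto F (\<tau> + \<sigma>) \<eta>"
    unfolding \<eta>_def using 1 2 by (intro solution_upto_append) auto
  moreover have "\<eta> 0 = \<eta> (\<tau> + \<sigma>)"
    using 1 2 by (auto simp: \<eta>_def)
  ultimately obtain \<xi> where \<xi>: "solution F \<xi>" "\<forall>t. \<xi> (t + (\<tau> + \<sigma>)) = \<xi> t"
     "\<forall>t\<in>{0..\<tau> + \<sigma>}. \<xi> t = \<eta> t" "range \<xi> = \<eta> ` {0..\<tau> + \<sigma>}"
    using periodic_extension[of "\<tau> + \<sigma>" F \<eta>] 1 2 by auto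
  have PQ: "\<xi> 0 = P" "\<xi> \<tau> = Q"
    using \<xi>(3) 1 2 by (auto simp: \<eta>_def)
  then have "\<not> \<xi> constant_on UNIV"
    using assms(3) by (metis UNIV_I constant_on_def)
  then have "periodic_orbit F (range \<xi>)"
    unfolding periodic_orbit_def using \<xi> 1 2 by (intro exI[of _ \<xi>] exI[of _ "\<tau> + \<sigma>"]) auto
  moreover have "\<eta> t \<in> insert P (insert Q (Z \<union> Z'))" if "t \<in> {0..\<tau> + \<sigma>}" for t
  proof (cases "t \<le> \<tau>")
    case True then show ?thesis using that 1 by (cases "t = 0"; cases "t = \<tau>") (auto simp: \<eta>_def)
  next
    case False then show ?thesis
      using that 1 2 by (cases "t = \<tau> + \<sigma>") (auto simp: \<eta>_def)
  qed
  ultimately show ?thesis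
    using PQ \<xi>(4) by (intro exI[of _ "range \<xi>"]) (auto, (metis rangeI)+)
qed

text \<open>Uniqueness: by the Lipschitz bound the squared distance of two solutions grows at most like
  \<open>exp (2 L t)\<close>, so it stays zero if it starts from zero.\<close>

lemma solution_upto_unique:
  assumes L: "L-lipschitz_on UNIV F"
    and "solution_upto F \<tau> \<phi>" "solution_upto F \<tau> \<psi>" "\<phi> 0 = \<psi> 0" "t \<in> {0..\<tau>}"
  shows "\<phi> t = \<psi> t"
proof -
  define e where "e = (\<lambda>t. exp (- (2 * L * t)) * ((\<phi> t - \<psi> t) \<bullet> (\<phi> t - \<psi> t)))"
  define e' where "e' = (\<lambda>t. exp (- (2 * L * t)) *
    (2 * ((\<phi> t - \<psi> t) \<bullet> (F (\<phi> t) - F (\<psi> t))) - 2 * L * ((\<phi> t - \<psi> t) \<bullet> (\<phi> t - \<psi> t))))"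
  have d: "(e has_real_derivative e' s) (at s within {0..\<tau>})" if "s \<in> {0..\<tau>}" for s
  proof -
    have 1: "((\<lambda>s. \<phi> s - \<psi> s) has_derivative (\<lambda>h. h *\<^sub>R (F (\<phi> s) - F (\<psi> s)))) (at s within {0..\<tau>})"
      using assms that by (auto simp: solution_upto_def scaleR_diff_right has_vector_derivative_def
        intro!: derivative_intros)
    have s: "((\<lambda>s. (\<phi> s - \<psi> s) \<bullet> (\<phi> s - \<psi> s)) has_real_derivative
        2 * ((\<phi> s - \<psi> s) \<bullet> (F (\<phi> s) - F (\<psi> s)))) (at s within {0..\<tau>})"
      unfolding has_field_derivative_def
      by (rule has_derivative_eq_rhs[OF has_derivative_inner[OF 1 1]])
        (auto simp: fun_eq_iff inner_commute algebra_simps)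
    have e: "((\<lambda>s. exp (- (2 * L * s))) has_real_derivative exp (- (2 * L * s)) * (- (2 * L)))
        (at s within {0..\<tau>})"
      by (auto intro!: derivative_eq_intros)
    show ?thesis
      unfolding e_def e'_def
      by (rule DERIV_cong[OF DERIV_mult[OF e s]]) (simp add: algebra_simps)
  qed
  have np: "e' s \<le> 0" for s
  proof -
    have "(\<phi> s - \<psi> s) \<bullet> (F (\<phi> s) - F (\<psi> s)) \<le> norm (\<phi> s - \<psi> s) * norm (F (\<phi> s) - F (\<psi> s))"
      using norm_cauchy_schwarz by blast
    also have "\<dots> \<le> norm (\<phi> s - \<psi> s) * (L * norm (\<phi> s - \<psi> s))"
      using lipschitz_onD[OF L, of "\<phi> s" "\<psi> s"]
      by (intro mult_left_mono) (auto simp: dist_norm)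
    also have "\<dots> = L * ((\<phi> s - \<psi> s) \<bullet> (\<phi> s - \<psi> s))"
      by (simp add: dot_square_norm power2_eq_square)
    finally show ?thesis
      by (simp add: e'_def mult_le_0_iff)
  qed
  have "e t \<le> e 0"
  proof (rule DERIV_nonpos_imp_decreasing_open[of 0 t e])
    have "continuous_on {0..\<tau>} e"
      by (rule DERIV_continuous_on[OF d])
    then show "continuous_on {0..t} e"
      by (rule continuous_on_subset) (use assms(5) in auto)
    fix s assume "0 < s" "s < t"
    then have s: "s \<in> {0<..<\<tau>}"
      using assms(5) by auto
    then have "at s within {0..\<tau>} = at s"
      by (intro at_within_interior) auto
    then show "\<exists>y. (e has_real_derivative y) (at s) \<and> y \<le> 0"
      using d[of s] np[of s] s by (intro exI[of _ "e' s"]) simp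
  qed (use assms in auto)
  then have "e t \<le> 0"
    using assms(4) by (simp add: e_def)
  then have "(\<phi> t - \<psi> t) \<bullet> (\<phi> t - \<psi> t) \<le> 0"
    by (simp add: e_def mult_le_0_iff)
  then show ?thesis
    by (metis eq_iff_diff_eq_0 inner_ge_zero inner_eq_zero_iff order_antisym)
qed

lemma lipschitz_on_uminus_field:
  fixes F :: "real^2 \<Rightarrow> real^2"
  shows "L-lipschitz_on UNIV F \<Longrightarrow> L-lipschitz_on UNIV (\<lambda>x. - F x)"
  by (simp add: lipschitz_on_def dist_minus)

lemma solution_unique:
  assumes L: "L-lipschitz_on UNIV F" and "solution F \<phi>" "solution F \<psi>" "\<phi> s = \<psi> t"
  shows "\<phi> (s + r) = \<psi> (t + r)"
proof (cases "0 \<le> r")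
  case True
  then show ?thesis
    using solution_upto_unique[OF L solution_upto_shift[OF assms(2), of r s]
       solution_upto_shift[OF assms(3), of r t], of r] assms(4) by simp
next
  case False
  note s = solution_upto_shift[OF solution_reverse]
  show ?thesis
    using solution_upto_unique[OF lipschitz_on_uminus_field[OF L] s[OF assms(2), of "- r" "- s"]
       s[OF assms(3), of "- r" "- t"], of "- r"] assms(4) False by (simp add: add.commute)
qed

lemma periodic_orbits_equal:
  assumes L: "L-lipschitz_on UNIV F" and "periodic_orbit F \<Gamma>" "periodic_orbit F \<Gamma>'"
    and "P \<in> \<Gamma>" "P \<in> \<Gamma>'"
  shows "\<Gamma> = \<Gamma>'"
proof -
  obtain \<phi> where 1: "solution F \<phi>" "\<Gamma> = range \<phi>"
    using assms(2) by (auto simp: periodic_orbit_def)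
  obtain \<psi> where 2: "solution F \<psi>" "\<Gamma>' = range \<psi>"
    using assms(3) by (auto simp: periodic_orbit_def)
  obtain s t where "\<phi> s = \<psi> t"
    using assms(4,5) 1 2 by auto
  note eq = solution_unique[OF L 1(1) 2(1) this]
  have "\<phi> r = \<psi> (t + (r - s))" "\<psi> r = \<phi> (s + (r - t))" for r
    using eq[of "r - s"] eq[of "r - t"] by simp_all
  have "range \<phi> = range \<psi>"
  proof (intro subset_antisym image_subsetI)
    show "\<phi> r \<in> range \<psi>" for r
      using \<open>\<phi> r = \<psi> (t + (r - s))\<close> by simp
    show "\<psi> r \<in> range \<phi>" for r
      using \<open>\<psi> r = \<phi> (s + (r - t))\<close> by simp
  qed
  then show ?thesis
    using 1 2 by simp
qed

lemma periodic_orbit_contains_arc_end: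
  assumes L: "L-lipschitz_on UNIV F" and "periodic_orbit F \<Gamma>" "orbit_arc F Z P Q" "P \<in> \<Gamma>"
  shows "Q \<in> \<Gamma>"
proof -
  obtain \<phi> where 1: "solution F \<phi>" "\<Gamma> = range \<phi>"
    using assms(2) by (auto simp: periodic_orbit_def)
  obtain \<tau> \<psi> where 2: "0 < \<tau>" "solution_upto F \<tau> \<psi>" "\<psi> 0 = P" "\<psi> \<tau> = Q"
    using assms(3) by (auto simp: orbit_arc_def)
  obtain s where "\<phi> s = P"
    using 1 assms(4) by auto
  then have "\<phi> (s + \<tau>) = \<psi> \<tau>"
    using solution_upto_unique[OF L solution_upto_shift[OF 1(1), of \<tau> s] 2(2), of \<tau>] 2 by auto
  then show ?thesis
    using 1 2 by (metis rangeI)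
qed

lemma periodic_orbit_uminus:
  assumes "periodic_orbit F \<Gamma>"
  shows "periodic_orbit (\<lambda>x. - F x) \<Gamma>"
proof -
  obtain \<phi> T where 1: "solution F \<phi>" "T > 0" "\<forall>t. \<phi> (t + T) = \<phi> t"
      "\<not> \<phi> constant_on UNIV" "\<Gamma> = range \<phi>"
    using assms by (auto simp: periodic_orbit_def)
  have "\<phi> (- (t + T)) = \<phi> (- t)" for t
    using 1(3)[rule_format, of "- (t + T)"] by simp
  moreover have "\<not> (\<lambda>t. \<phi> (- t)) constant_on UNIV"
    using 1(4) unfolding constant_on_def by (metis UNIV_I minus_minus)
  moreover have "\<Gamma> = range (\<lambda>t. \<phi> (- t))"
    using 1(5) image_comp[of \<phi> uminus UNIV] by (simp add: o_def)
  ultimately show ?thesis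
    unfolding periodic_orbit_def using 1(2) solution_reverse[OF 1(1)] by blast
qed

lemma periodic_orbit_uminus_iff: "periodic_orbit (\<lambda>x. - F x) = periodic_orbit F"
  using periodic_orbit_uminus[of F] periodic_orbit_uminus[of "\<lambda>x. - F x"] by (auto simp: fun_eq_iff)

lemma periodic_orbit_contains_arc_start:
  assumes L: "L-lipschitz_on UNIV F" and "periodic_orbit F \<Gamma>" "orbit_arc F Z P Q" "Q \<in> \<Gamma>"
  shows "P \<in> \<Gamma>"
  using periodic_orbit_contains_arc_end[OF lipschitz_on_uminus_field[OF L]
     periodic_orbit_uminus[OF assms(2)] orbit_arc_reverse[OF assms(3)] assms(4)] .

lemma periodic_orbit_compact:
  assumes "periodic_orbit F \<Gamma>"
  shows "compact \<Gamma>"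
proof -
  obtain \<phi> T where 1: "solution F \<phi>" "T > 0" "\<forall>t. \<phi> (t + T) = \<phi> t" "\<Gamma> = range \<phi>"
    using assms by (auto simp: periodic_orbit_def)
  have per: "\<phi> (t + of_int k * T) = \<phi> t" for t k
  proof (induction k rule: int_induct[of _ 0])
    case (step1 i)
    then show ?case
      using 1(3)[rule_format, of "t + of_int i * T"] by (simp add: algebra_simps)
  next
    case (step2 i)
    then show ?case
      using 1(3)[rule_format, of "t + of_int (i - 1) * T"] by (simp add: algebra_simps)
  qed simp
  have "\<Gamma> = \<phi> ` {0..T}"
  proof
    show "\<Gamma> \<subseteq> \<phi> ` {0..T}"
    proof
      fix x assume "x \<in> \<Gamma>"
      then obtain t where t: "x = \<phi> t"
        using 1 by auto
      have "t + of_int (- \<lfloor>t / T\<rfloor>) * T \<in> {0..T}"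
        using minus_period_floor[OF 1(2), of t] by (auto simp: algebra_simps)
      then show "x \<in> \<phi> ` {0..T}"
        using per[of t "- \<lfloor>t / T\<rfloor>"] t by (metis imageI)
    qed
  qed (use 1 in auto)
  moreover have "continuous_on {0..T} \<phi>"
    using 1(1) unfolding solution_def
    by (blast intro: continuous_at_imp_continuous_on has_vector_derivative_continuous)
  ultimately show ?thesis
    by (metis compact_Icc compact_continuous_image)
qed

section \<open>Limit cycles from monotone return maps\<close>

definition pt :: "real \<Rightarrow> real \<Rightarrow> real^2" where
  "pt x y = vector [x, y]"

lemma pt_simps [simp]:
  "pt x y $ 1 = x" "pt x y $ 2 = y" "pt x y = pt x' y' \<longleftrightarrow> x = x' \<and> y = y'"
  by (auto simp: pt_def vec_eq_iff forall_2)

lemma pt_eta: "pt (z $ 1) (z $ 2) = z"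
  by (simp add: vec_eq_iff forall_2)

lemma eq_pt_iff: "z = pt x y \<longleftrightarrow> z $ 1 = x \<and> z $ 2 = y"
  by (auto simp: vec_eq_iff forall_2)

lemma pt_linear: "pt x y + pt x' y' = pt (x + x') (y + y')" "pt x y - pt x' y' = pt (x - x') (y - y')"
  "- pt x y = pt (- x) (- y)" "r *\<^sub>R pt x y = pt (r * x) (r * y)" "0 = pt 0 0"
  by (simp_all add: vec_eq_iff forall_2)

lemma has_vector_derivative_pt:
  assumes "(x has_real_derivative x') (at t within S)" "(y has_real_derivative y') (at t within S)"
  shows "((\<lambda>t. pt (x t) (y t)) has_vector_derivative pt x' y') (at t within S)"
proof -
  have "((\<lambda>t. x t *\<^sub>R pt 1 0 + y t *\<^sub>R pt 0 1) has_vector_derivative x' *\<^sub>R pt 1 0 + y' *\<^sub>R pt 0 1)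
      (at t within S)"
    using assms by (auto intro!: derivative_eq_intros)
  then show ?thesis
    by (simp add: pt_linear)
qed

lemma has_vector_derivative_component:
  assumes "(\<phi> has_vector_derivative d) (at t within S)"
  shows "((\<lambda>t. \<phi> t $ i) has_real_derivative d $ i) (at t within S)"
  using bounded_linear.has_vector_derivative[OF bounded_linear_vec_nth assms]
  by (simp add: has_real_derivative_iff_has_vector_derivative)

text \<open>The return map \<open>Q\<close> of the half-line \<open>x = 0, y \<ge> 0\<close> is monotone because orbits of a planar
  field do not cross. Hence a periodic orbit all of whose hits lie in the domain of \<open>Q\<close> contains a
  fixed point of \<open>Q\<close>: its set \<open>H\<close> of hits is compact and \<open>Q\<close> maps \<open>H\<close> to itself, so the infimum
  of \<open>{v \<in> H. Q v \<le> v}\<close> is fixed, as in Tarski's theorem. If the fixed point is unique then the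
  complement of the rest of the half-line isolates the orbit through it.\<close>

lemma limit_cycle_of_return_map:
  fixes Q :: "real \<Rightarrow> real"
  assumes L: "L-lipschitz_on UNIV F" and "0 \<le> lo"
    and arcs: "\<And>v. lo < v \<Longrightarrow> v < hi \<Longrightarrow> 0 \<le> Q v \<and> (\<exists>u>0. orbit_arc F {z. z $ 1 < 0} (pt 0 v) (pt 0 (- u)) \<and>
       orbit_arc F {z. z $ 1 > 0} (pt 0 (- u)) (pt 0 (Q v)))"
    and mono: "\<And>v v'. lo < v \<Longrightarrow> v \<le> v' \<Longrightarrow> v' < hi \<Longrightarrow> Q v \<le> Q v'"
    and fp: "lo < w" "w < hi" "Q w = w"
    and uniq: "\<And>v. lo < v \<Longrightarrow> v < hi \<Longrightarrow> Q v = v \<Longrightarrow> v = w"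
    and cross: "\<And>\<Gamma>. periodic_orbit F \<Gamma> \<Longrightarrow> \<exists>v\<ge>0. pt 0 v \<in> \<Gamma>"
  shows "\<exists>\<Gamma>. limit_cycle F \<Gamma> \<and> (\<forall>v\<ge>0. pt 0 v \<in> \<Gamma> \<longleftrightarrow> v = w)"
proof -
  obtain u where u: "u > 0" "orbit_arc F {z. z $ 1 < 0} (pt 0 w) (pt 0 (- u))"
       "orbit_arc F {z. z $ 1 > 0} (pt 0 (- u)) (pt 0 w)"
    using arcs[OF fp(1,2)] fp(3) by auto
  obtain \<Gamma> where \<Gamma>: "periodic_orbit F \<Gamma>" "pt 0 w \<in> \<Gamma>"
    "\<Gamma> \<subseteq> insert (pt 0 w) (insert (pt 0 (- u)) ({z. z $ 1 < 0} \<union> {z. z $ 1 > 0}))"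
    using periodic_orbit_of_two_arcs[OF u(2,3)] u(1) fp assms(2) by auto
  have hit: "pt 0 v \<in> \<Gamma> \<longleftrightarrow> v = w" if "v \<ge> 0" for v
    using \<Gamma> that u(1) by auto
  \<comment> \<open>The half-line without the interval \<open>(lo, hi)\<close> is closed and disjoint from \<open>\<Gamma>\<close>.\<close>
  define U where "U = - {z :: real^2. z $ 1 = 0 \<and> z $ 2 \<ge> 0 \<and> (z $ 2 \<le> lo \<or> z $ 2 \<ge> hi)}"
  have "open U"
    unfolding U_def
    by (intro open_Compl closed_Collect_conj closed_Collect_disj closed_Collect_eq closed_Collect_le
        continuous_intros)
  moreover have "\<Gamma> \<subseteq> U"
  proof
    fix z assume "z \<in> \<Gamma>"
    then show "z \<in> U"
      using hit[of "z $ 2"] fp pt_eta[of z] by (cases "z $ 1 = 0") (auto simp: U_def)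
  qed
  moreover have "\<Gamma>' = \<Gamma>" if \<Gamma>': "periodic_orbit F \<Gamma>'" "\<Gamma>' \<subseteq> U" for \<Gamma>'
  proof -
    define H where "H = {v. v \<ge> 0 \<and> pt 0 v \<in> \<Gamma>'}"
    have H: "lo < v \<and> v < hi" if "v \<in> H" for v
      using that \<Gamma>'(2) by (force simp: H_def U_def)
    have "compact (\<Gamma>' \<inter> {z. z $ 1 = 0 \<and> z $ 2 \<ge> 0})"
      by (intro compact_Int_closed periodic_orbit_compact[OF \<Gamma>'(1)] closed_Collect_conj
          closed_Collect_eq closed_Collect_le continuous_intros)
    then have "compact ((\<lambda>z. z $ 2) ` (\<Gamma>' \<inter> {z. z $ 1 = 0 \<and> z $ 2 \<ge> 0}))"
      by (intro compact_continuous_image continuous_intros)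
    moreover have "(\<lambda>z. z $ 2) ` (\<Gamma>' \<inter> {z. z $ 1 = 0 \<and> z $ 2 \<ge> 0}) = H"
    proof
      show "(\<lambda>z. z $ 2) ` (\<Gamma>' \<inter> {z. z $ 1 = 0 \<and> z $ 2 \<ge> 0}) \<subseteq> H"
      proof
        fix r assume "r \<in> (\<lambda>z. z $ 2) ` (\<Gamma>' \<inter> {z. z $ 1 = 0 \<and> z $ 2 \<ge> 0})"
        then obtain z where "z \<in> \<Gamma>'" "z $ 1 = 0" "z $ 2 \<ge> 0" "r = z $ 2"
          by blast
        then show "r \<in> H"
          using pt_eta[of z] by (simp add: H_def)
      qed
      show "H \<subseteq> (\<lambda>z. z $ 2) ` (\<Gamma>' \<inter> {z. z $ 1 = 0 \<and> z $ 2 \<ge> 0})"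
        unfolding H_def by (auto intro!: image_eqI[of _ _ "pt 0 _"])
    qed
    ultimately have Hc: "compact H"
      by simp
    have Hne: "H \<noteq> {}"
      using cross[OF \<Gamma>'(1)] by (auto simp: H_def)
    have QH: "Q v \<in> H" if v: "v \<in> H" for v
    proof -
      obtain u where "orbit_arc F {z. z $ 1 < 0} (pt 0 v) (pt 0 (- u))"
         "orbit_arc F {z. z $ 1 > 0} (pt 0 (- u)) (pt 0 (Q v))" "0 \<le> Q v"
        using arcs[of v] H[OF v] by blast
      then show ?thesis
        using v periodic_orbit_contains_arc_end[OF L \<Gamma>'(1)] by (auto simp: H_def)
    qed
    obtain m where m: "m \<in> H" "\<forall>v\<in>H. v \<le> m"
      using compact_attains_sup[OF Hc Hne] by blast
    define A where "A = {v \<in> H. Q v \<le> v}"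
    have "m \<in> A"
      using m QH by (auto simp: A_def)
    have bdd: "bdd_below A"
      using H by (intro bdd_belowI[of _ lo]) (auto simp: A_def less_imp_le)
    have "Inf A \<in> closure A"
      using \<open>m \<in> A\<close> bdd by (intro closure_contains_Inf) auto
    also have "\<dots> \<subseteq> H"
      by (rule closure_minimal) (auto simp: A_def compact_imp_closed[OF Hc])
    finally have inf: "Inf A \<in> H" .
    have "Q (Inf A) \<le> v" if "v \<in> A" for v
      using mono[of "Inf A" v] cInf_lower[OF that bdd] H[OF inf] H[of v] that by (auto simp: A_def)
    then have le: "Q (Inf A) \<le> Inf A"
      using \<open>m \<in> A\<close> by (intro cInf_greatest) auto
    then have "Q (Inf A) \<in> A"
      using QH[OF inf] QH[OF QH[OF inf]] mono[of "Q (Inf A)" "Inf A"] H[OF inf] H[OF QH[OF inf]]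
      by (auto simp: A_def)
    then have "Inf A \<le> Q (Inf A)"
      using bdd by (rule cInf_lower)
    then have "Q (Inf A) = Inf A"
      using le by simp
    then have "pt 0 w \<in> \<Gamma>'"
      using uniq[of "Inf A"] H[OF inf] inf by (auto simp: H_def)
    then show "\<Gamma>' = \<Gamma>"
      using periodic_orbits_equal[OF L \<Gamma>'(1) \<Gamma>(1)] \<Gamma>(2) by blast
  qed
  ultimately show ?thesis
    unfolding limit_cycle_def using \<Gamma>(1) hit by blast
qed

section \<open>Affine changes of coordinates\<close>

lemma solution_affine:
  assumes "bounded_linear M" "\<And>z. M (F z) = G (M z + d)" "solution F \<phi>"
  shows "solution G (\<lambda>t. M (\<phi> t) + d)"
  unfolding solution_def
proof
  fix t
  have "((\<lambda>t. M (\<phi> t)) has_vector_derivative M (F (\<phi> t))) (at t)"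
    using assms(3) by (intro bounded_linear.has_vector_derivative[OF assms(1)]) (simp add: solution_def)
  then show "((\<lambda>t. M (\<phi> t) + d) has_vector_derivative G (M (\<phi> t) + d)) (at t)"
    by (simp add: assms(2) has_vector_derivative_add_const)
qed

lemma periodic_orbit_affine:
  assumes "bounded_linear M" "inj M" "\<And>z. M (F z) = G (M z + d)" "periodic_orbit F \<Gamma>"
  shows "periodic_orbit G ((\<lambda>z. M z + d) ` \<Gamma>)"
proof -
  obtain \<phi> T where 1: "solution F \<phi>" "T > 0" "\<forall>t. \<phi> (t + T) = \<phi> t"
      "\<not> \<phi> constant_on UNIV" "\<Gamma> = range \<phi>"
    using assms by (auto simp: periodic_orbit_def)
  have "\<not> (\<lambda>t. M (\<phi> t) + d) constant_on UNIV"
    using 1(4) injD[OF assms(2)] unfolding constant_on_def by (metis UNIV_I add_right_cancel)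
  then show ?thesis
    unfolding periodic_orbit_def using 1 solution_affine[OF assms(1,3) 1(1)]
    by (intro exI[of _ "\<lambda>t. M (\<phi> t) + d"] exI[of _ T]) auto
qed

lemma limit_cycle_affine:
  assumes M: "bounded_linear M" and N: "bounded_linear N"
    and MN: "\<And>z. M (N z) = z" "\<And>z. N (M z) = z"
    and conj: "\<And>z. M (F z) = G (M z + d)" and lc: "limit_cycle G \<Gamma>"
  shows "limit_cycle F ((\<lambda>z. N z - N d) ` \<Gamma>)"
proof -
  have inj: "inj M" "inj N"
    using MN by (metis injI)+
  interpret N: bounded_linear N by fact
  interpret M: bounded_linear M by fact
  have conj': "N (G z) = F (N z + (- N d))" for z
    using conj[of "N z - N d"] by (metis MN M.diff diff_add_cancel add_uminus_conv_diff)
  have MNd: "M (N z - N d) + d = z" "N (M z + d) - N d = z" for z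
    by (simp_all add: M.diff N.add MN)
  obtain U where U: "open U" "\<Gamma> \<subseteq> U" "\<And>\<Gamma>'. periodic_orbit G \<Gamma>' \<Longrightarrow> \<Gamma>' \<subseteq> U \<Longrightarrow> \<Gamma>' = \<Gamma>"
    and \<Gamma>: "periodic_orbit G \<Gamma>"
    using lc by (auto simp: limit_cycle_def)
  have 1: "periodic_orbit F ((\<lambda>z. N z - N d) ` \<Gamma>)"
    using periodic_orbit_affine[OF N inj(2) conj' \<Gamma>] by simp
  have 2: "open ((\<lambda>z. M z + d) -` U)"
    using U(1) by (intro open_vimage continuous_intros M.continuous_on)
  have 3: "(\<lambda>z. N z - N d) ` \<Gamma> \<subseteq> (\<lambda>z. M z + d) -` U"
    using U(2) MNd(1) by auto
  have 4: "\<Gamma>' = (\<lambda>z. N z - N d) ` \<Gamma>"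
    if "periodic_orbit F \<Gamma>'" "\<Gamma>' \<subseteq> (\<lambda>z. M z + d) -` U" for \<Gamma>'
  proof -
    have "(\<lambda>z. M z + d) ` \<Gamma>' = \<Gamma>"
      using U(3)[OF periodic_orbit_affine[OF M inj(1) conj that(1)]] that(2) by blast
    then have "(\<lambda>z. N z - N d) ` \<Gamma> = (\<lambda>z. N z - N d) ` (\<lambda>z. M z + d) ` \<Gamma>'"
      by simp
    also have "\<dots> = \<Gamma>'"
      by (simp add: image_image MNd(2))
    finally show ?thesis ..
  qed
  show ?thesis
    unfolding limit_cycle_def using 1 2 3 4 by (intro conjI exI[of _ "(\<lambda>z. M z + d) -` U"]) blast+
qed

section \<open>Three-zone systems in Lienard form\<close>

text \<open>The slopes to the right and to the left of the middle zone enter as multiples of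
  \<open>max x 0\<close> and \<open>max (- (x + w)) 0\<close>, so continuity needs no case distinction. The slope of \<open>f\<close>
  for \<open>x < - w\<close> is zero: this is the zone of the center.\<close>

definition lienard_field :: "real \<Rightarrow> real \<Rightarrow> real \<Rightarrow> real \<Rightarrow> real \<Rightarrow> real \<Rightarrow> real \<Rightarrow> real^2 \<Rightarrow> real^2" where
  "lienard_field To Tp Dm Do Dp w a z =
     pt (To * z $ 1 + (Tp - To) * max (z $ 1) 0 + To * max (- (z $ 1 + w)) 0 - z $ 2)
        (Do * z $ 1 + (Dp - Do) * max (z $ 1) 0 + (Do - Dm) * max (- (z $ 1 + w)) 0 - a)"

lemma lienard_field_right:
  "0 < w \<Longrightarrow> 0 \<le> x \<Longrightarrow> lienard_field To Tp Dm Do Dp w a (pt x y) = pt (Tp * x - y) (Dp * x - a)"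
  by (auto simp: lienard_field_def max_def algebra_simps)

lemma lienard_field_middle:
  "0 < w \<Longrightarrow> - w \<le> x \<Longrightarrow> x \<le> 0 \<Longrightarrow>
    lienard_field To Tp Dm Do Dp w a (pt x y) = pt (To * x - y) (Do * x - a)"
  by (auto simp: lienard_field_def max_def algebra_simps)

lemma lienard_field_left:
  "0 < w \<Longrightarrow> x \<le> - w \<Longrightarrow>
    lienard_field To Tp Dm Do Dp w a (pt x y) = pt (- To * w - y) (Dm * (x + w) - Do * w - a)"
  by (auto simp: lienard_field_def max_def algebra_simps)

lemma norm_pt_le: "norm (pt x y) \<le> \<bar>x\<bar> + \<bar>y\<bar>"
  using norm_le_l1_cart[of "pt x y"] by (simp add: sum_2)

text \<open>Positive parts are contractions, so the field is Lipschitz in each coordinate.\<close>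

lemma lienard_field_lipschitz: "\<exists>L. L-lipschitz_on UNIV (lienard_field To Tp Dm Do Dp w a)"
proof -
  let ?A = "\<bar>To\<bar> + \<bar>Tp - To\<bar> + \<bar>To\<bar> + 1" and ?B = "\<bar>Do\<bar> + \<bar>Dp - Do\<bar> + \<bar>Do - Dm\<bar>"
  let ?L = "?A + ?B"
  have mx: "\<bar>max r 0 - max s 0\<bar> \<le> \<bar>r - s\<bar>" for r s :: real
    by (auto simp: max_def)
  have "dist (lienard_field To Tp Dm Do Dp w a z) (lienard_field To Tp Dm Do Dp w a z') \<le> ?L * dist z z'"
    for z z'
  proof -
    let ?d = "\<bar>z $ 1 - z' $ 1\<bar>" and ?e = "\<bar>z $ 2 - z' $ 2\<bar>"
    let ?m = "max (z $ 1) 0 - max (z' $ 1) 0"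
    let ?l = "max (- (z $ 1 + w)) 0 - max (- (z' $ 1 + w)) 0"
    have m: "\<bar>?m\<bar> \<le> ?d" "\<bar>?l\<bar> \<le> ?d"
      using mx[of "z $ 1" "z' $ 1"] mx[of "- (z $ 1 + w)" "- (z' $ 1 + w)"] by linarith+
    have de: "?d \<le> norm (z - z')" "?e \<le> norm (z - z')"
      using component_le_norm_cart[of "z - z'" 1] component_le_norm_cart[of "z - z'" 2] by simp_all
    have lin: "\<bar>p * (z $ 1 - z' $ 1) + q * ?m + r * ?l\<bar> \<le> (\<bar>p\<bar> + \<bar>q\<bar> + \<bar>r\<bar>) * norm (z - z')" for p q r
    proof -
      have "\<bar>p * (z $ 1 - z' $ 1) + q * ?m + r * ?l\<bar> \<le> \<bar>p\<bar> * ?d + \<bar>q\<bar> * \<bar>?m\<bar> + \<bar>r\<bar> * \<bar>?l\<bar>"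
        unfolding abs_mult[symmetric] by linarith
      also have "\<dots> \<le> \<bar>p\<bar> * norm (z - z') + \<bar>q\<bar> * norm (z - z') + \<bar>r\<bar> * norm (z - z')"
        using m de by (intro add_mono mult_left_mono) auto
      finally show ?thesis
        by (simp add: algebra_simps)
    qed
    have "lienard_field To Tp Dm Do Dp w a z - lienard_field To Tp Dm Do Dp w a z' =
      pt (To * (z $ 1 - z' $ 1) + (Tp - To) * ?m + To * ?l - (z $ 2 - z' $ 2))
         (Do * (z $ 1 - z' $ 1) + (Dp - Do) * ?m + (Do - Dm) * ?l)"
      by (simp add: lienard_field_def pt_linear algebra_simps)
    then have "dist (lienard_field To Tp Dm Do Dp w a z) (lienard_field To Tp Dm Do Dp w a z') \<le>
      \<bar>To * (z $ 1 - z' $ 1) + (Tp - To) * ?m + To * ?l - (z $ 2 - z' $ 2)\<bar> +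
      \<bar>Do * (z $ 1 - z' $ 1) + (Dp - Do) * ?m + (Do - Dm) * ?l\<bar>"
      unfolding dist_norm by (metis norm_pt_le)
    also have "\<dots> \<le> (\<bar>To * (z $ 1 - z' $ 1) + (Tp - To) * ?m + To * ?l\<bar> + ?e) +
      \<bar>Do * (z $ 1 - z' $ 1) + (Dp - Do) * ?m + (Do - Dm) * ?l\<bar>"
      by (intro add_right_mono abs_triangle_ineq4)
    also have "\<dots> \<le> ((\<bar>To\<bar> + \<bar>Tp - To\<bar> + \<bar>To\<bar>) * norm (z - z') + norm (z - z')) +
      ?B * norm (z - z')"
      by (intro add_mono lin de)
    finally show ?thesis
      by (simp add: dist_norm algebra_simps)
  qed
  then show ?thesis
    by (intro exI[of _ ?L] lipschitz_onI) auto
qed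

text \<open>The reflection \<open>y \<mapsto> - y\<close> combined with time reversal changes the signs of the traces.\<close>

lemma lienard_field_reflect:
  "lienard_field (- To) (- Tp) Dm Do Dp w a (pt (z $ 1) (- z $ 2)) =
     - pt (lienard_field To Tp Dm Do Dp w a z $ 1) (- lienard_field To Tp Dm Do Dp w a z $ 2)"
  by (simp add: lienard_field_def pt_linear algebra_simps)

lemma orbit_arc_reflect:
  assumes "orbit_arc (lienard_field (- To) (- Tp) Dm Do Dp w a) {z. z $ 1 \<in> I} (pt x y) (pt x' y')"
  shows "orbit_arc (lienard_field To Tp Dm Do Dp w a) {z. z $ 1 \<in> I} (pt x' (- y')) (pt x (- y))"
proof -
  let ?G = "lienard_field To Tp Dm Do Dp w a" and ?G' = "lienard_field (- To) (- Tp) Dm Do Dp w a"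
  obtain \<tau> \<phi> where 1: "0 < \<tau>" "solution_upto ?G' \<tau> \<phi>" "\<phi> 0 = pt x y" "\<phi> \<tau> = pt x' y'"
    "\<forall>t\<in>{0<..<\<tau>}. \<phi> t $ 1 \<in> I"
    using assms by (auto simp: orbit_arc_def)
  define \<psi> where "\<psi> = (\<lambda>t. pt (\<phi> t $ 1) (- \<phi> t $ 2))"
  have "solution_upto (\<lambda>z. - ?G z) \<tau> \<psi>"
    unfolding solution_upto_def
  proof
    fix t assume t: "t \<in> {0..\<tau>}"
    have d: "(\<phi> has_vector_derivative ?G' (\<phi> t)) (at t within {0..\<tau>})"
      using 1(2) t by (simp add: solution_upto_def)
    have "(\<psi> has_vector_derivative pt (?G' (\<phi> t) $ 1) (- ?G' (\<phi> t) $ 2)) (at t within {0..\<tau>})"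
      unfolding \<psi>_def
      by (intro has_vector_derivative_pt has_vector_derivative_component[OF d]
          DERIV_minus)
    also have "pt (?G' (\<phi> t) $ 1) (- ?G' (\<phi> t) $ 2) = - ?G (\<psi> t)"
      using lienard_field_reflect[of "- To" "- Tp" Dm Do Dp w a "\<phi> t"]
      by (simp add: \<psi>_def pt_linear pt_eta)
    finally show "(\<psi> has_vector_derivative - ?G (\<psi> t)) (at t within {0..\<tau>})" .
  qed
  then have "orbit_arc (\<lambda>z. - ?G z) {z. z $ 1 \<in> I} (pt x (- y)) (pt x' (- y'))"
    unfolding orbit_arc_def using 1 by (intro exI[of _ \<tau>] exI[of _ \<psi>]) (auto simp: \<psi>_def)
  from orbit_arc_reverse[OF this] show ?thesis
    by simp
qed

text \<open>Every periodic orbit crosses the half-line \<open>x = 0, y \<ge> 0\<close>. It cannot stay in \<open>x \<le> 0\<close>, where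
  \<open>y\<close> decreases, nor in \<open>x \<ge> 0\<close>, where the trace is positive and the quadratic expression \<open>E\<close>
  below does not decrease; and \<open>x\<close> can only become negative while \<open>y \<ge> 0\<close>.\<close>

lemma periodic_orbit_crosses_section:
  assumes pos: "0 < a" "0 < Tp" "0 < Dp" "0 < Do" "0 < Dm" "0 < w"
    and po: "periodic_orbit (lienard_field To Tp Dm Do Dp w a) \<Gamma>"
  shows "\<exists>v\<ge>0. pt 0 v \<in> \<Gamma>"
proof -
  let ?G = "lienard_field To Tp Dm Do Dp w a"
  obtain \<phi> T where 1: "solution ?G \<phi>" "T > 0" "\<forall>t. \<phi> (t + T) = \<phi> t"
      "\<not> \<phi> constant_on UNIV" "\<Gamma> = range \<phi>"
    using po by (auto simp: periodic_orbit_def)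
  define x y where "x = (\<lambda>t. \<phi> t $ 1)" and "y = (\<lambda>t. \<phi> t $ 2)"
  have \<phi>: "\<phi> t = pt (x t) (y t)" for t
    by (simp add: x_def y_def pt_eta)
  have dx: "(x has_real_derivative ?G (pt (x t) (y t)) $ 1) (at t)"
    and dy: "(y has_real_derivative ?G (pt (x t) (y t)) $ 2) (at t)" for t
    using 1(1)[unfolded solution_def, rule_format, of t, THEN has_vector_derivative_component]
    by (simp_all add: x_def y_def pt_eta)
  have per: "x (t + T) = x t" "y (t + T) = y t" for t
    using 1(3) by (simp_all add: x_def y_def)
  have cont: "continuous_on S x" for S
    using dx by (meson DERIV_isCont continuous_at_imp_continuous_on)
  have "\<exists>t. x t > 0"
  proof (rule ccontr)
    assume "\<not> ?thesis"
    then have le: "x t \<le> 0" for t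
      by (simp add: not_less)
    have neg: "?G (pt (x t) (y t)) $ 2 < 0" for t
    proof (cases "- w \<le> x t")
      case True
      have "Do * x t \<le> 0"
        using pos le[of t] by (simp add: mult_le_0_iff)
      then show ?thesis
        using True le[of t] pos by (simp add: lienard_field_middle)
    next
      case False
      have "Dm * (x t + w) \<le> 0"
        using pos False by (simp add: mult_le_0_iff)
      moreover have "0 < Do * w"
        using pos by simp
      ultimately have "Dm * (x t + w) - Do * w < a"
        using pos by linarith
      then show ?thesis
        using False pos by (simp add: lienard_field_left)
    qed
    have "y T < y 0"
      by (rule DERIV_neg_imp_decreasing[OF 1(2)]) (rule exI, rule conjI[OF dy neg])
    then show False
      using per(2)[of 0] by simp
  qed
  then obtain t1 where t1: "x t1 > 0" ..
  have "\<exists>t. x t < 0"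
  proof (rule ccontr)
    assume "\<not> ?thesis"
    then have ge: "x t \<ge> 0" for t
      by (simp add: not_less)
    have dx': "(x has_real_derivative Tp * x t - y t) (at t)"
      and dy': "(y has_real_derivative Dp * x t - a) (at t)" for t
      using dx[of t] dy[of t] ge[of t] pos by (simp_all add: lienard_field_right)
    define E where "E = (\<lambda>t. (Tp * x t - y t)\<^sup>2 + Dp * (x t - a / Dp)\<^sup>2)"
    have dE: "(E has_real_derivative 2 * Tp * (Tp * x t - y t)\<^sup>2) (at t)" for t
    proof -
      have "((\<lambda>t. Tp * x t - y t) has_real_derivative Tp * (Tp * x t - y t) - (Dp * x t - a)) (at t)"
        "((\<lambda>t. x t - a / Dp) has_real_derivative Tp * x t - y t) (at t)"
        by (auto intro!: derivative_eq_intros dx' dy')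
      from DERIV_add[OF DERIV_power[OF this(1), of 2] DERIV_cmult[OF DERIV_power[OF this(2), of 2], of Dp]]
      have "(E has_real_derivative 2 * (Tp * x t - y t) * (Tp * (Tp * x t - y t) - (Dp * x t - a))
          + Dp * (2 * (x t - a / Dp) * (Tp * x t - y t))) (at t)"
        unfolding E_def by (rule DERIV_cong) (use pos in \<open>simp add: field_simps\<close>)
      also have "2 * (Tp * x t - y t) * (Tp * (Tp * x t - y t) - (Dp * x t - a))
          + Dp * (2 * (x t - a / Dp) * (Tp * x t - y t)) = 2 * Tp * (Tp * x t - y t)\<^sup>2"
        using pos by (simp add: field_simps power2_eq_square)
      finally show ?thesis .
    qed
    have mono: "E s \<le> E t" if "s \<le> t" for s t
    proof (rule DERIV_nonneg_imp_nondecreasing[OF that])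
      fix r show "\<exists>d. (E has_real_derivative d) (at r) \<and> 0 \<le> d"
        using dE[of r] pos by (intro exI[of _ "2 * Tp * (Tp * x r - y r)\<^sup>2"]) simp
    qed
    have Ec: "E t = E s" if "s < t" "t < s + T" for s t
      using mono[of s t] mono[of t "s + T"] that per[of s] by (simp add: E_def)
    have x0: "Tp * x t - y t = 0" for t
    proof -
      have "\<forall>s. \<bar>t - s\<bar> < T \<longrightarrow> E t = E s"
        using Ec by (metis abs_less_iff add.commute diff_less_eq linorder_less_linear minus_diff_eq)
      then have "2 * Tp * (Tp * x t - y t)\<^sup>2 = 0"
        using DERIV_local_const[OF dE 1(2)] by blast
      then show ?thesis
        using pos by simp
    qed
    have xc: "x t = x 0" for t
      by (rule DERIV_isconst_all) (use dx' x0 in auto)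
    have "\<phi> t = pt (x 0) (Tp * x 0)" for t
      using x0[of t] \<phi>[of t] xc[of t] by simp
    then show False
      using 1(4) by (auto simp: constant_on_def)
  qed
  then obtain t2 where t2: "x t2 < 0" ..
  have per': "x (t + of_nat n * T) = x t" for n t
  proof (induction n)
    case (Suc n)
    then show ?case
      using per(1)[of "t + of_nat n * T"] by (simp add: algebra_simps)
  qed simp
  obtain n :: nat where n: "t1 < t2 + of_nat n * T"
    using reals_Archimedean3[OF 1(2), rule_format, of "t1 - t2"] by (auto simp: algebra_simps)
  define t3 where "t3 = t2 + of_nat n * T"
  have t3: "t1 < t3" "x t3 < 0"
    using n t2 per' by (simp_all add: t3_def)
  define A where "A = {t \<in> {t1..t3}. x t \<le> 0}"
  have A: "closed A" "t3 \<in> A" "bdd_below A"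
  proof -
    show "closed A"
      unfolding A_def Collect_conj_eq Collect_mem_eq
      by (intro closed_Int closed_Collect_le cont continuous_on_const closed_atLeastAtMost)
  qed (use t3 in \<open>auto simp: A_def intro!: bdd_belowI[of _ t1]\<close>)
  define t0 where "t0 = Inf A"
  have "t0 \<in> A"
    unfolding t0_def using A by (intro closed_contains_Inf) auto
  then have t0: "t1 < t0" "x t0 \<le> 0"
    using t1 by (auto simp: A_def less_le)
  have before: "x t > 0" if "t1 \<le> t" "t < t0" for t
  proof (rule ccontr)
    assume "\<not> ?thesis"
    then have "t \<in> A"
      using that \<open>t0 \<in> A\<close> by (simp add: A_def)
    then show False
      using cInf_lower[OF _ A(3), of t] that(2) by (simp add: t0_def)
  qed
  have "x t0 \<ge> 0"
  proof (rule tendsto_lowerbound)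
    show "(x \<longlongrightarrow> x t0) (at_left t0)"
      using DERIV_isCont[OF dx] by (simp add: isCont_def filterlim_at_split)
    show "\<forall>\<^sub>F t in at_left t0. 0 \<le> x t"
      using eventually_at_left_real[OF t0(1)] before by (auto elim!: eventually_mono intro: less_imp_le)
  qed simp
  then have x0: "x t0 = 0"
    using t0 by simp
  have "?G (pt (x t0) (y t0)) $ 1 \<le> 0"
  proof (rule ccontr)
    assume "\<not> ?thesis"
    then obtain d where d: "d > 0" "\<And>h. h > 0 \<Longrightarrow> h < d \<Longrightarrow> x (t0 - h) < x t0"
      using DERIV_pos_inc_left[OF dx, of t0] by auto
    define h where "h = min (d / 2) (t0 - t1)"
    have "0 < h" "h < d" "t1 \<le> t0 - h"
      using d(1) t0(1) by (auto simp: h_def)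
    then show False
      using d(2)[of h] before[of "t0 - h"] x0 by simp
  qed
  then have "0 \<le> y t0"
    using x0 pos by (simp add: lienard_field_right)
  then show ?thesis
    using x0 \<phi>[of t0] 1(5) by (metis rangeI)
qed

section \<open>The passage functions of a focus\<close>

text \<open>Consider \<open>x'' = T x' - D x + a\<close> with \<open>T = 2 g b\<close>, \<open>D = b\<^sup>2 (1 + g\<^sup>2)\<close> and \<open>a = k b (1 + g\<^sup>2)\<close>. The
  orbit that leaves \<open>x = 0\<close> and comes back to it after time \<open>\<theta> / b\<close> starts with velocity
  \<open>- k pfun g \<theta>\<close> and ends with velocity \<open>k pfun (- g) \<theta>\<close>. The change of sign of \<open>g\<close> is
  time reversal.\<close>

definition pfun :: "real \<Rightarrow> real \<Rightarrow> real" where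
  "pfun g \<theta> = (exp (- g * \<theta>) - cos \<theta> + g * sin \<theta>) / sin \<theta>"

text \<open>The orbit of the same equation that goes from \<open>x = 0\<close> to \<open>x = - W / b\<close> in time \<open>\<theta> / b\<close> has velocity
  \<open>- vfun g W k \<theta>\<close> at the start and \<open>- qfun g W k \<theta>\<close> at the end (\<open>xpos_at_exit\<close>, \<open>xvel_at_exit\<close>); \<open>W = 0\<close>
  is the case of \<open>pfun\<close>.\<close>

definition vfun :: "real \<Rightarrow> real \<Rightarrow> real \<Rightarrow> real \<Rightarrow> real" where
  "vfun g W k \<theta> = W * exp (- g * \<theta>) / sin \<theta> + k * pfun g \<theta>"

definition qfun :: "real \<Rightarrow> real \<Rightarrow> real \<Rightarrow> real \<Rightarrow> real" where
  "qfun g W k \<theta> = W * (g + cos \<theta> / sin \<theta>) - k * pfun (- g) \<theta>"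

lemma pfun_deriv:
  assumes "sin \<theta> \<noteq> 0"
  shows "(pfun g has_real_derivative exp (- g * \<theta>) * pfun (- g) \<theta> / sin \<theta>) (at \<theta>)"
proof -
  have "(pfun g has_real_derivative
      ((exp (- g * \<theta>) * (- g) + sin \<theta> + g * cos \<theta>) * sin \<theta> -
       (exp (- g * \<theta>) - cos \<theta> + g * sin \<theta>) * cos \<theta>) / (sin \<theta> * sin \<theta>)) (at \<theta>)"
    unfolding pfun_def[abs_def] using assms
    by (auto intro!: derivative_eq_intros)
  also have "((exp (- g * \<theta>) * (- g) + sin \<theta> + g * cos \<theta>) * sin \<theta> -
       (exp (- g * \<theta>) - cos \<theta> + g * sin \<theta>) * cos \<theta>) =
     ((sin \<theta>)\<^sup>2 + (cos \<theta>)\<^sup>2) - exp (- g * \<theta>) * (cos \<theta> + g * sin \<theta>)"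
    by (simp add: algebra_simps power2_eq_square)
  also have "\<dots> = exp (- g * \<theta>) * (exp (g * \<theta>) - cos \<theta> - g * sin \<theta>)"
    by (simp add: algebra_simps flip: exp_add)
  finally show ?thesis
    by (simp add: pfun_def[of "- g"])
qed

text \<open>Together with \<open>qfun_deriv\<close> this says \<open>q dq = exp (2 g \<theta>) v dv\<close>: the flux between neighbouring
  orbits, like every area, is multiplied by \<open>exp (T t)\<close> in time \<open>t = \<theta> / b\<close>.\<close>

lemma vfun_deriv:
  assumes "sin \<theta> \<noteq> 0"
  shows "(vfun g W k has_real_derivative - exp (- g * \<theta>) * qfun g W k \<theta> / sin \<theta>) (at \<theta>)"
proof -
  have "(vfun g W k has_real_derivative
     (W * (exp (- g * \<theta>) * (- g)) * sin \<theta> - W * exp (- g * \<theta>) * cos \<theta>) / (sin \<theta> * sin \<theta>) +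
      k * (exp (- g * \<theta>) * pfun (- g) \<theta> / sin \<theta>)) (at \<theta>)"
    unfolding vfun_def[abs_def] using assms
    by (auto intro!: derivative_eq_intros pfun_deriv simp: mult_ac)
  also have "(W * (exp (- g * \<theta>) * (- g)) * sin \<theta> - W * exp (- g * \<theta>) * cos \<theta>) / (sin \<theta> * sin \<theta>) +
      k * (exp (- g * \<theta>) * pfun (- g) \<theta> / sin \<theta>) = - exp (- g * \<theta>) * qfun g W k \<theta> / sin \<theta>"
    using assms by (simp add: qfun_def field_simps)
  finally show ?thesis .
qed

lemma qfun_deriv:
  assumes "sin \<theta> \<noteq> 0"
  shows "(qfun g W k has_real_derivative - exp (g * \<theta>) * vfun g W k \<theta> / sin \<theta>) (at \<theta>)"
proof -
  have "(qfun g W k has_real_derivative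
     W * ((- sin \<theta> * sin \<theta> - cos \<theta> * cos \<theta>) / (sin \<theta> * sin \<theta>)) -
      k * (exp (g * \<theta>) * pfun g \<theta> / sin \<theta>)) (at \<theta>)"
    unfolding qfun_def[abs_def] using assms pfun_deriv[of \<theta> "- g"]
    by (auto intro!: derivative_eq_intros simp: mult_ac)
  also have "- sin \<theta> * sin \<theta> - cos \<theta> * cos \<theta> = - 1"
    using sin_cos_squared_add[of \<theta>] by (simp add: power2_eq_square)
  also have "W * (- 1 / (sin \<theta> * sin \<theta>)) - k * (exp (g * \<theta>) * pfun g \<theta> / sin \<theta>) =
     - exp (g * \<theta>) * vfun g W k \<theta> / sin \<theta>"
    using assms by (simp add: vfun_def field_simps flip: exp_add)
  finally show ?thesis .
qed

lemma pnum_deriv: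
  "((\<lambda>\<theta>. 1 - exp (g * \<theta>) * (cos \<theta> - g * sin \<theta>)) has_real_derivative
     (1 + g\<^sup>2) * exp (g * \<theta>) * sin \<theta>) (at \<theta>)"
  by (auto intro!: derivative_eq_intros simp: algebra_simps power2_eq_square)

lemma pfun_eq: "pfun g \<theta> = exp (- g * \<theta>) * (1 - exp (g * \<theta>) * (cos \<theta> - g * sin \<theta>)) / sin \<theta>"
  by (simp add: pfun_def algebra_simps flip: exp_add)

text \<open>The numerator of \<open>pfun\<close>, up to an exponential factor, vanishes at \<open>0\<close> and increases as long as \<open>sin\<close> is
  positive; beyond \<open>\<pi>\<close> it decreases, which is used in \<open>pfun_neg\<close>.\<close>

lemma pnum_pos:
  assumes "0 < \<theta>" "\<theta> \<le> pi"
  shows "0 < 1 - exp (g * \<theta>) * (cos \<theta> - g * sin \<theta>)"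
proof -
  let ?f = "\<lambda>\<theta>. 1 - exp (g * \<theta>) * (cos \<theta> - g * sin \<theta>)"
  have "?f 0 < ?f \<theta>"
  proof (rule DERIV_pos_imp_increasing_open[of 0 \<theta> ?f])
    fix t assume "0 < t" "t < \<theta>"
    then show "\<exists>d. (?f has_real_derivative d) (at t) \<and> 0 < d"
      using assms pnum_deriv[of g t] sin_gt_zero[of t]
      by (intro exI[of _ "(1 + g\<^sup>2) * exp (g * t) * sin t"]) (simp add: add_pos_nonneg)
  qed (use assms in \<open>auto intro!: continuous_intros\<close>)
  then show ?thesis
    by simp
qed

lemma pfun_pos:
  assumes "0 < \<theta>" "\<theta> < pi"
  shows "0 < pfun g \<theta>"
  using assms pnum_pos[of \<theta> g] sin_gt_zero[of \<theta>] by (simp add: pfun_eq)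

lemma sin_neg_right: "pi < \<theta> \<Longrightarrow> \<theta> < 2 * pi \<Longrightarrow> sin \<theta> < 0"
  using sin_lt_zero by blast

lemma pfun_neg:
  assumes "0 < g" "pi < \<theta>" "\<theta> < 2 * pi"
  shows "pfun (- g) \<theta> < 0"
proof -
  let ?f = "\<lambda>\<theta>. 1 - exp (- g * \<theta>) * (cos \<theta> - (- g) * sin \<theta>)"
  have "?f (2 * pi) < ?f \<theta>"
  proof (rule DERIV_neg_imp_decreasing_open[of \<theta> "2 * pi" ?f])
    fix t assume "\<theta> < t" "t < 2 * pi"
    then show "\<exists>d. (?f has_real_derivative d) (at t) \<and> d < 0"
      using assms pnum_deriv[of "- g" t] sin_neg_right[of t]
      by (intro exI[of _ "(1 + (- g)\<^sup>2) * exp (- g * t) * sin t"])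
        (simp add: add_pos_nonneg mult_pos_neg)
  qed (use assms in \<open>auto intro!: continuous_intros\<close>)
  moreover have "0 < ?f (2 * pi)"
    using assms by simp
  ultimately have "0 < ?f \<theta>"
    by linarith
  then show ?thesis
    using assms sin_neg_right[of \<theta>] by (simp add: pfun_eq divide_pos_neg)
qed

lemma pfun_strict_mono_left:
  assumes "0 < s" "s < t" "t < pi"
  shows "pfun g s < pfun g t"
proof (rule DERIV_pos_imp_increasing[OF assms(2)])
  fix r assume "s \<le> r" "r \<le> t"
  then have "0 < r" "r < pi"
    using assms by auto
  then show "\<exists>d. (pfun g has_real_derivative d) (at r) \<and> 0 < d"
    using pfun_deriv[of r g] pfun_pos[of r "- g"] sin_gt_zero[of r]
    by (intro exI[of _ "exp (- g * r) * pfun (- g) r / sin r"]) simp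
qed

lemma pfun_strict_mono_right:
  assumes "0 < g" "pi < s" "s < t" "t < 2 * pi"
  shows "pfun g s < pfun g t"
proof (rule DERIV_pos_imp_increasing[OF assms(3)])
  fix r assume "s \<le> r" "r \<le> t"
  then have "pi < r" "r < 2 * pi"
    using assms by auto
  then show "\<exists>d. (pfun g has_real_derivative d) (at r) \<and> 0 < d"
    using pfun_deriv[of r g] pfun_neg[of g r] sin_neg_right[of r] assms(1)
    by (intro exI[of _ "exp (- g * r) * pfun (- g) r / sin r"]) (auto intro!: divide_neg_neg mult_pos_neg)
qed

section \<open>Arcs in the three zones\<close>

text \<open>The solution of \<open>x'' = T x' - D x + a\<close>, for \<open>T = 2 g b\<close>, \<open>D = b\<^sup>2 (1 + g\<^sup>2)\<close> and
  \<open>a = k b (1 + g\<^sup>2)\<close>, that starts from \<open>x = 0\<close> with velocity \<open>\<nu>\<close> is \<open>x = xpos g k \<nu> (b t) / b\<close>, and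
  its velocity is \<open>xvel g k \<nu> (b t)\<close>.\<close>

definition xpos :: "real \<Rightarrow> real \<Rightarrow> real \<Rightarrow> real \<Rightarrow> real" where
  "xpos g k \<nu> \<theta> = \<nu> * exp (g * \<theta>) * sin \<theta> + k * (1 - exp (g * \<theta>) * (cos \<theta> - g * sin \<theta>))"

definition xvel :: "real \<Rightarrow> real \<Rightarrow> real \<Rightarrow> real \<Rightarrow> real" where
  "xvel g k \<nu> \<theta> = \<nu> * exp (g * \<theta>) * (cos \<theta> + g * sin \<theta>) + k * (1 + g\<^sup>2) * exp (g * \<theta>) * sin \<theta>"

lemma xpos_deriv: "(xpos g k \<nu> has_real_derivative xvel g k \<nu> \<theta>) (at \<theta>)"
  unfolding xpos_def[abs_def] xvel_def
  by (auto intro!: derivative_eq_intros simp: algebra_simps power2_eq_square)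

lemma xvel_deriv:
  "(xvel g k \<nu> has_real_derivative 2 * g * xvel g k \<nu> \<theta> - (1 + g\<^sup>2) * (xpos g k \<nu> \<theta> - k)) (at \<theta>)"
  unfolding xpos_def xvel_def[abs_def]
  by (auto intro!: derivative_eq_intros simp: algebra_simps power2_eq_square)

text \<open>A trajectory of one linear system is an arc of the piecewise linear system as long as it
  stays in the zone of that system. \<open>C\<close> is the closed zone, and \<open>Z\<close> the set in which the interior of
  the arc is wanted.\<close>

lemma linear_orbit_arc:
  assumes b: "0 < b" and \<Theta>: "0 < \<Theta>"
    and G: "\<And>x y. x \<in> C \<Longrightarrow> G (pt x y) = pt (2 * g * b * x - y) (b\<^sup>2 * (1 + g\<^sup>2) * x - b * (1 + g\<^sup>2) * k)"
    and Z: "\<And>\<theta>. 0 < \<theta> \<Longrightarrow> \<theta> < \<Theta> \<Longrightarrow> xpos g k \<nu> \<theta> / b \<in> Z" "Z \<subseteq> C" "0 \<in> C" "xpos g k \<nu> \<Theta> / b \<in> C"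
  shows "orbit_arc G {z. z $ 1 \<in> Z} (pt 0 (- \<nu>))
    (pt (xpos g k \<nu> \<Theta> / b) (2 * g * xpos g k \<nu> \<Theta> - xvel g k \<nu> \<Theta>))"
proof -
  define \<phi> where "\<phi> = (\<lambda>t. pt (xpos g k \<nu> (b * t) / b) (2 * g * xpos g k \<nu> (b * t) - xvel g k \<nu> (b * t)))"
  have x: "((\<lambda>t. xpos g k \<nu> (b * t)) has_real_derivative b * xvel g k \<nu> (b * t)) (at t)" for t
    by (rule DERIV_cong[OF DERIV_chain2[OF xpos_deriv DERIV_cmult[OF DERIV_ident]]]) simp
  have v: "((\<lambda>t. xvel g k \<nu> (b * t)) has_real_derivative
      b * (2 * g * xvel g k \<nu> (b * t) - (1 + g\<^sup>2) * (xpos g k \<nu> (b * t) - k))) (at t)" for t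
    by (rule DERIV_cong[OF DERIV_chain2[OF xvel_deriv DERIV_cmult[OF DERIV_ident]]]) simp
  have "solution_upto G (\<Theta> / b) \<phi>"
    unfolding solution_upto_def
  proof
    fix t assume "t \<in> {0..\<Theta> / b}"
    then have t: "0 \<le> t" "b * t \<le> \<Theta>"
      using b by (auto simp: field_simps)
    have C: "xpos g k \<nu> (b * t) / b \<in> C"
    proof (cases "t = 0 \<or> b * t = \<Theta>")
      case True then show ?thesis using Z(3,4) by (auto simp: xpos_def)
    next
      case False then show ?thesis using Z(1)[of "b * t"] Z(2) t b by auto
    qed
    have "(\<phi> has_vector_derivative pt (xvel g k \<nu> (b * t))
       (2 * g * (b * xvel g k \<nu> (b * t)) -
        b * (2 * g * xvel g k \<nu> (b * t) - (1 + g\<^sup>2) * (xpos g k \<nu> (b * t) - k)))) (at t)"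
      unfolding \<phi>_def using b
      by (intro has_vector_derivative_pt) (auto intro!: derivative_eq_intros x v)
    also have "pt (xvel g k \<nu> (b * t))
       (2 * g * (b * xvel g k \<nu> (b * t)) -
        b * (2 * g * xvel g k \<nu> (b * t) - (1 + g\<^sup>2) * (xpos g k \<nu> (b * t) - k))) = G (\<phi> t)"
      unfolding \<phi>_def G[OF C] using b by (simp add: field_simps power2_eq_square)
    finally show "(\<phi> has_vector_derivative G (\<phi> t)) (at t within {0..\<Theta> / b})"
      by (rule has_vector_derivative_at_within)
  qed
  moreover have "\<phi> t $ 1 \<in> Z" if "t \<in> {0<..<\<Theta> / b}" for t
  proof -
    have "0 < b * t" "b * t < \<Theta>"
      using that b by (auto simp: field_simps)
    then show ?thesis
      using Z(1) by (simp add: \<phi>_def)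
  qed
  ultimately show ?thesis
    unfolding orbit_arc_def using b \<Theta>
    by (intro exI[of _ "\<Theta> / b"] exI[of _ \<phi>]) (auto simp: \<phi>_def xpos_def xvel_def)
qed

lemma xpos_eq_pfun:
  assumes "sin \<theta> \<noteq> 0"
  shows "xpos g k \<nu> \<theta> = exp (g * \<theta>) * sin \<theta> * (\<nu> + k * pfun g \<theta>)"
  using assms by (simp add: xpos_def pfun_eq field_simps flip: exp_add)

lemma xpos_at_exit:
  assumes "sin \<Theta> \<noteq> 0"
  shows "xpos g k (- vfun g W k \<Theta>) \<Theta> = - W"
  using assms by (simp add: xpos_eq_pfun vfun_def field_simps flip: exp_add)

lemma xvel_at_exit:
  assumes s: "sin \<Theta> \<noteq> 0"
  shows "xvel g k (- vfun g W k \<Theta>) \<Theta> = - qfun g W k \<Theta>"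
proof -
  have e: "exp (g * \<Theta>) * exp (- g * \<Theta>) = 1"
    by (simp flip: exp_add)
  have id: "- pfun g \<Theta> * exp (g * \<Theta>) * (cos \<Theta> + g * sin \<Theta>) + (1 + g\<^sup>2) * exp (g * \<Theta>) * sin \<Theta>
      = pfun (- g) \<Theta>"
  proof -
    have "(- p * E * (c + g * s) + (1 + g\<^sup>2) * E * s) * s = p' * s"
      if "p * s = E' - c + g * s" "p' * s = E - c - g * s" "E * E' = 1" "s\<^sup>2 + c\<^sup>2 = 1"
      for p p' E E' c s :: real
      using that by algebra
    from this[of "pfun g \<Theta>" "sin \<Theta>" "exp (- g * \<Theta>)" "cos \<Theta>" "pfun (- g) \<Theta>" "exp (g * \<Theta>)"]
    have "(- pfun g \<Theta> * exp (g * \<Theta>) * (cos \<Theta> + g * sin \<Theta>) + (1 + g\<^sup>2) * exp (g * \<Theta>) * sin \<Theta>) * sin \<Theta>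
      = pfun (- g) \<Theta> * sin \<Theta>"
      using s e by (simp add: pfun_def)
    then show ?thesis
      using s by simp
  qed
  have "xvel g k (- vfun g W k \<Theta>) \<Theta> =
     - W * (exp (g * \<Theta>) * exp (- g * \<Theta>)) * (cos \<Theta> + g * sin \<Theta>) / sin \<Theta> +
     k * (- pfun g \<Theta> * exp (g * \<Theta>) * (cos \<Theta> + g * sin \<Theta>) + (1 + g\<^sup>2) * exp (g * \<Theta>) * sin \<Theta>)"
    using s by (simp add: xvel_def vfun_def field_simps)
  also have "\<dots> = - qfun g W k \<Theta>"
    unfolding id e using s by (simp add: qfun_def field_simps)
  finally show ?thesis .
qed

lemma focus_arc:
  assumes b: "0 < b" and \<Theta>: "0 < \<Theta>" "sin \<Theta> \<noteq> 0"
    and G: "\<And>x y. x \<in> C \<Longrightarrow> G (pt x y) = pt (2 * g * b * x - y) (b\<^sup>2 * (1 + g\<^sup>2) * x - b * (1 + g\<^sup>2) * k)"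
    and Z: "\<And>\<theta>. 0 < \<theta> \<Longrightarrow> \<theta> < \<Theta> \<Longrightarrow> xpos g k (- vfun g W k \<Theta>) \<theta> / b \<in> Z"
      "Z \<subseteq> C" "0 \<in> C" "- W / b \<in> C"
  shows "orbit_arc G {z. z $ 1 \<in> Z} (pt 0 (vfun g W k \<Theta>)) (pt (- W / b) (qfun g W k \<Theta> - 2 * g * W))"
  using linear_orbit_arc[OF b \<Theta>(1) G Z(1-3)] Z(4) \<Theta>
  by (simp add: xpos_at_exit xvel_at_exit)

text \<open>A passage through \<open>x > 0\<close> about a focus at positive \<open>x\<close> takes more than half a turn. The
  trajectory cannot come back to \<open>x = 0\<close> before the angle \<open>\<Theta>\<close>, because \<open>pfun g\<close> is monotone beyond \<open>\<pi>\<close>.\<close>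

lemma right_arc:
  assumes "0 < b" "0 < w" "0 < g" "0 < k" and \<Theta>: "pi < \<Theta>" "\<Theta> < 2 * pi" "pfun g \<Theta> < 0"
  shows "orbit_arc (lienard_field To (2 * g * b) Dm Do (b\<^sup>2 * (1 + g\<^sup>2)) w (b * (1 + g\<^sup>2) * k)) {z. z $ 1 > 0}
    (pt 0 (k * pfun g \<Theta>)) (pt 0 (- (k * pfun (- g) \<Theta>)))"
proof -
  let ?G = "lienard_field To (2 * g * b) Dm Do (b\<^sup>2 * (1 + g\<^sup>2)) w (b * (1 + g\<^sup>2) * k)"
  have s: "sin \<Theta> < 0"
    using sin_neg_right \<Theta> by blast
  have "xpos g k (- vfun g 0 k \<Theta>) \<theta> / b \<in> {0<..}" if \<theta>: "0 < \<theta>" "\<theta> < \<Theta>" for \<theta>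
  proof -
    consider "\<theta> < pi" | "\<theta> = pi" | "pi < \<theta>" by linarith
    then have "0 < xpos g k (- vfun g 0 k \<Theta>) \<theta>"
    proof cases
      case 1
      then have "0 < sin \<theta>" "0 < pfun g \<theta>"
        using \<theta> sin_gt_zero pfun_pos by auto
      moreover have "vfun g 0 k \<Theta> < 0"
        using assms by (simp add: vfun_def mult_pos_neg)
      moreover have "0 < k * pfun g \<theta>"
        using \<open>0 < pfun g \<theta>\<close> assms by simp
      ultimately have "0 < exp (g * \<theta>) * sin \<theta> * (- vfun g 0 k \<Theta> + k * pfun g \<theta>)"
        by (intro mult_pos_pos) auto
      then show ?thesis
        using \<open>0 < sin \<theta>\<close> by (simp add: xpos_eq_pfun)
    next
      case 2
      then show ?thesis
        using assms by (simp add: xpos_def add_pos_pos)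
    next
      case 3
      have "sin \<theta> < 0"
        using 3 \<theta> \<Theta> by (intro sin_neg_right) auto
      moreover have "k * pfun g \<theta> < k * pfun g \<Theta>"
        using 3 \<theta> \<Theta> assms pfun_strict_mono_right[of g \<theta> \<Theta>] by simp
      ultimately show ?thesis
        by (simp add: xpos_eq_pfun vfun_def mult_neg_neg mult_pos_neg)
    qed
    then show ?thesis
      using assms(1) by simp
  qed
  then have "orbit_arc ?G {z. z $ 1 \<in> {0<..}} (pt 0 (vfun g 0 k \<Theta>)) (pt (- 0 / b) (qfun g 0 k \<Theta> - 2 * g * 0))"
    using assms s by (intro focus_arc[where C = "{0..}"]) (auto simp: lienard_field_right)
  then show ?thesis
    by (simp add: vfun_def qfun_def)
qed

text \<open>Seen from \<open>x < 0\<close> the focus is virtual, so a passage takes less than half a turn. The bound \<open>b w\<close> on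
  the initial velocity keeps it in the middle zone, as the oscillation is damped (\<open>g < 0\<close>).\<close>

lemma short_left_arc:
  assumes "0 < b" "0 < w" "g < 0" "0 < k" and \<Theta>: "0 < \<Theta>" "\<Theta> < pi" "k * pfun g \<Theta> \<le> b * w"
  shows "orbit_arc (lienard_field (2 * g * b) Tp Dm (b\<^sup>2 * (1 + g\<^sup>2)) Dp w (b * (1 + g\<^sup>2) * k)) {z. z $ 1 < 0}
    (pt 0 (k * pfun g \<Theta>)) (pt 0 (- (k * pfun (- g) \<Theta>)))"
proof -
  let ?G = "lienard_field (2 * g * b) Tp Dm (b\<^sup>2 * (1 + g\<^sup>2)) Dp w (b * (1 + g\<^sup>2) * k)"
  have s: "0 < sin \<Theta>"
    using sin_gt_zero \<Theta> by blast
  have "xpos g k (- vfun g 0 k \<Theta>) \<theta> / b \<in> {- w..<0}" if \<theta>: "0 < \<theta>" "\<theta> < \<Theta>" for \<theta>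
  proof -
    have s\<theta>: "0 < sin \<theta>"
      using \<theta> \<Theta> by (intro sin_gt_zero) auto
    have pm: "k * pfun g \<theta> < k * pfun g \<Theta>"
      using \<theta> \<Theta> assms pfun_strict_mono_left[of \<theta> \<Theta> g] by simp
    have p0: "0 < k * pfun g \<theta>"
      using \<theta> \<Theta> assms pfun_pos[of \<theta> g] by simp
    have x: "xpos g k (- vfun g 0 k \<Theta>) \<theta> = - (exp (g * \<theta>) * sin \<theta> * (k * pfun g \<Theta> - k * pfun g \<theta>))"
      using s\<theta> by (simp add: xpos_eq_pfun vfun_def algebra_simps)
    have "exp (g * \<theta>) * sin \<theta> \<le> 1 * 1"
      using assms \<theta> s\<theta> by (intro mult_mono) (auto simp: mult_le_0_iff)
    then have "exp (g * \<theta>) * sin \<theta> * (k * pfun g \<Theta> - k * pfun g \<theta>) \<le> 1 * (b * w)"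
      using pm p0 \<Theta>(3) s\<theta> by (intro mult_mono) auto
    moreover have "0 < exp (g * \<theta>) * sin \<theta> * (k * pfun g \<Theta> - k * pfun g \<theta>)"
      using pm s\<theta> by simp
    ultimately show ?thesis
      using assms(1) by (simp add: x field_simps)
  qed
  then have "orbit_arc ?G {z. z $ 1 \<in> {- w..<0}} (pt 0 (vfun g 0 k \<Theta>)) (pt (- 0 / b) (qfun g 0 k \<Theta> - 2 * g * 0))"
    using assms s by (intro focus_arc[where C = "{- w..0}"]) (auto simp: lienard_field_middle)
  then have "orbit_arc ?G {z. z $ 1 \<in> {- w..<0}} (pt 0 (k * pfun g \<Theta>)) (pt 0 (- (k * pfun (- g) \<Theta>)))"
    by (simp add: vfun_def qfun_def)
  then show ?thesis
    by (rule orbit_arc_mono) auto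
qed

lemma vfun_pos:
  assumes "0 < W" "0 \<le> k" "0 < \<theta>" "\<theta> < pi"
  shows "0 < vfun g W k \<theta>"
  using assms pfun_pos[of \<theta> g] sin_gt_zero[of \<theta>] by (auto simp: vfun_def intro!: add_pos_nonneg)

lemma qfun_strict_antimono:
  assumes "0 < W" "0 \<le> k" "0 < s" "s < t" "t < pi"
  shows "qfun g W k t < qfun g W k s"
proof (rule DERIV_neg_imp_decreasing[OF assms(4)])
  fix r assume "s \<le> r" "r \<le> t"
  then have r: "0 < r" "r < pi"
    using assms by auto
  then have "- exp (g * r) * vfun g W k r / sin r < 0"
    using vfun_pos[OF assms(1,2) r, of g] sin_gt_zero[of r] by (simp add: divide_neg_pos)
  then show "\<exists>d. (qfun g W k has_real_derivative d) (at r) \<and> d < 0"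
    using qfun_deriv[of r g W k] sin_gt_zero[of r] r by (intro exI conjI) auto
qed

lemma vfun_strict_antimono:
  assumes "0 < W" "0 \<le> k" "0 < s" "s < t" "t < pi" "0 < qfun g W k t"
  shows "vfun g W k t < vfun g W k s"
proof (rule DERIV_neg_imp_decreasing[OF assms(4)])
  fix r assume "s \<le> r" "r \<le> t"
  then have r: "0 < r" "r < pi"
    using assms by auto
  have "qfun g W k t \<le> qfun g W k r"
    using qfun_strict_antimono[of W k r t g] assms r \<open>r \<le> t\<close> by (cases "r = t") auto
  then have "- exp (- g * r) * qfun g W k r / sin r < 0"
    using assms sin_gt_zero[of r] r by (simp add: divide_neg_pos)
  then show "\<exists>d. (vfun g W k has_real_derivative d) (at r) \<and> d < 0"
    using vfun_deriv[of r g W k] sin_gt_zero[of r] r by (intro exI conjI) auto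
qed

text \<open>Positive \<open>qfun\<close> makes \<open>\<Theta>\<close> the first angle at which \<open>x = - w\<close> is reached: \<open>vfun\<close> decreases as long as
  \<open>qfun\<close> is positive, so no smaller angle belongs to the same initial velocity.\<close>

lemma transit_arc:
  assumes "0 < b" "0 < w" "0 \<le> k" and \<Theta>: "0 < \<Theta>" "\<Theta> < pi" "0 < qfun g (b * w) k \<Theta>"
  shows "orbit_arc (lienard_field (2 * g * b) Tp Dm (b\<^sup>2 * (1 + g\<^sup>2)) Dp w (b * (1 + g\<^sup>2) * k))
    {z. z $ 1 \<in> {- w<..<0}}
    (pt 0 (vfun g (b * w) k \<Theta>)) (pt (- w) (qfun g (b * w) k \<Theta> - 2 * g * b * w))"
proof -
  let ?G = "lienard_field (2 * g * b) Tp Dm (b\<^sup>2 * (1 + g\<^sup>2)) Dp w (b * (1 + g\<^sup>2) * k)"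
  have s: "0 < sin \<Theta>"
    using sin_gt_zero \<Theta> by blast
  have W: "0 < b * w"
    using assms by simp
  have "xpos g k (- vfun g (b * w) k \<Theta>) \<theta> / b \<in> {- w<..<0}" if \<theta>: "0 < \<theta>" "\<theta> < \<Theta>" for \<theta>
  proof -
    have s\<theta>: "0 < sin \<theta>"
      using \<theta> \<Theta> by (intro sin_gt_zero) auto
    have x: "xpos g k (- vfun g (b * w) k \<Theta>) \<theta> =
        - (exp (g * \<theta>) * sin \<theta> * (vfun g (b * w) k \<Theta> - k * pfun g \<theta>))"
      using s\<theta> by (simp add: xpos_eq_pfun algebra_simps)
    have "k * pfun g \<theta> \<le> k * pfun g \<Theta>"
      using \<theta> \<Theta> assms pfun_strict_mono_left[of \<theta> \<Theta> g] by (intro mult_left_mono) auto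
    also have "\<dots> < vfun g (b * w) k \<Theta>"
      using s W by (simp add: vfun_def)
    finally have 1: "0 < exp (g * \<theta>) * sin \<theta> * (vfun g (b * w) k \<Theta> - k * pfun g \<theta>)"
      using s\<theta> by simp
    have "vfun g (b * w) k \<Theta> < vfun g (b * w) k \<theta>"
      using vfun_strict_antimono[OF W assms(3) \<theta> \<Theta>(2,3)] .
    then have "exp (g * \<theta>) * sin \<theta> * (vfun g (b * w) k \<Theta> - k * pfun g \<theta>) <
       exp (g * \<theta>) * sin \<theta> * (vfun g (b * w) k \<theta> - k * pfun g \<theta>)"
      using s\<theta> by (intro mult_strict_left_mono) auto
    also have "\<dots> = b * w"
      using s\<theta> by (simp add: vfun_def field_simps flip: exp_add)
    finally show ?thesis
      using 1 assms(1) by (simp add: x field_simps)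
  qed
  then have "orbit_arc ?G {z. z $ 1 \<in> {- w<..<0}} (pt 0 (vfun g (b * w) k \<Theta>))
     (pt (- (b * w) / b) (qfun g (b * w) k \<Theta> - 2 * g * (b * w)))"
    using assms s by (intro focus_arc[where C = "{- w..0}"]) (auto simp: lienard_field_middle)
  then show ?thesis
    using assms(1) by (simp add: mult.assoc)
qed

text \<open>In the outer zone the system is a center, whose orbits are symmetric about the point of
  tangency with the line \<open>x = - w\<close>.\<close>

lemma center_arc:
  assumes "0 < w" "0 < Dm" "0 < Do" "0 \<le> a" "0 < q"
  shows "orbit_arc (lienard_field To Tp Dm Do Dp w a) {z. z $ 1 < - w}
     (pt (- w) (- To * w + q)) (pt (- w) (- To * w - q))"
proof -
  define \<beta> where "\<beta> = sqrt Dm"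
  define m where "m = (Do * w + a) / Dm"
  \<comment> \<open>\<open>m\<close> is the distance of the center from \<open>x = - w\<close>, and \<open>arctan r\<close> half of the angle that the orbit sweeps in \<open>x < - w\<close>.\<close>
  define r where "r = q / (\<beta> * m)"
  have \<beta>: "0 < \<beta>" "Dm = \<beta>\<^sup>2" and m: "0 < m" "Dm * m = Do * w + a"
    using assms by (auto simp: \<beta>_def m_def add_pos_nonneg)
  have r: "0 < r" "\<beta> * m * r = q"
    using \<beta> m assms by (auto simp: r_def)
  define h where "h = arctan r"
  have h: "0 < h" "h < pi / 2" "tan h = r"
    using r arctan_bounded[of r] by (auto simp: h_def tan_arctan)
  have ch: "0 < cos h"
    using h by (intro cos_gt_zero) auto
  have sh: "sin h = r * cos h"
    using h(3) ch by (simp add: tan_def field_simps)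
  define X where "X = (\<lambda>t. m * (1 - cos (\<beta> * t)) - q / \<beta> * sin (\<beta> * t))"
  define X' where "X' = (\<lambda>t. m * \<beta> * sin (\<beta> * t) - q * cos (\<beta> * t))"
  have dX: "(X has_real_derivative X' t) (at t)" for t
    unfolding X_def X'_def using \<beta> by (auto intro!: derivative_eq_intros simp: field_simps)
  have dX': "(X' has_real_derivative Dm * (m - X t)) (at t)" for t
    unfolding X_def X'_def using \<beta>
    by (auto intro!: derivative_eq_intros simp: field_simps power2_eq_square)
  have half: "X (2 * s / \<beta>) = 2 * m * sin s * (sin s - r * cos s)" for s
  proof -
    have "X (2 * s / \<beta>) = m * (1 - cos (2 * s)) - m * r * sin (2 * s)"
      using \<beta> m by (simp add: X_def r_def)
    also have "\<dots> = 2 * m * sin s * (sin s - r * cos s)"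
      unfolding cos_double_sin sin_double by (simp add: algebra_simps power2_eq_square)
    finally show ?thesis .
  qed
  have neg: "X t < 0" if "0 < t" "t < 2 * h / \<beta>" for t
  proof -
    define s where "s = \<beta> * t / 2"
    have s: "0 < s" "s < h" "t = 2 * s / \<beta>"
      using that \<beta> by (auto simp: s_def field_simps)
    have "tan s < tan h"
      using s h by (intro tan_monotone) auto
    then have "tan s < r"
      using h by simp
    moreover have "0 < cos s" "0 < sin s"
      using s h by (auto intro!: cos_gt_zero sin_gt_zero)
    ultimately have "sin s < r * cos s"
      by (simp add: tan_def field_simps)
    then show ?thesis
      using \<open>0 < sin s\<close> m unfolding s(3) half by (simp add: mult_pos_neg)
  qed
  have Xe: "X (2 * h / \<beta>) = 0"
    unfolding half using sh by simp
  have X'e: "X' (2 * h / \<beta>) = q"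
  proof -
    have "X' (2 * h / \<beta>) = m * \<beta> * sin (2 * h) - q * cos (2 * h)"
      using \<beta> by (simp add: X'_def)
    also have "\<dots> = m * \<beta> * (2 * (r * cos h) * cos h) - q * (2 * (cos h)\<^sup>2 - 1)"
      unfolding cos_double_cos sin_double sh ..
    also have "\<dots> = q"
      unfolding r(2)[symmetric] by (simp add: algebra_simps power2_eq_square)
    finally show ?thesis .
  qed
  define \<phi> where "\<phi> = (\<lambda>t. pt (- w + X t) (- To * w - X' t))"
  have Xle: "X t \<le> 0" if "t \<in> {0..2 * h / \<beta>}" for t
    using neg[of t] Xe that by (cases "t = 0"; cases "t = 2 * h / \<beta>") (auto simp: X_def)
  have "solution_upto (lienard_field To Tp Dm Do Dp w a) (2 * h / \<beta>) \<phi>"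
    unfolding solution_upto_def
  proof
    fix t assume t: "t \<in> {0..2 * h / \<beta>}"
    have "(\<phi> has_vector_derivative pt (X' t) (- (Dm * (m - X t)))) (at t)"
      unfolding \<phi>_def by (intro has_vector_derivative_pt) (auto intro!: derivative_eq_intros dX dX')
    also have "pt (X' t) (- (Dm * (m - X t))) = lienard_field To Tp Dm Do Dp w a (\<phi> t)"
      unfolding \<phi>_def using Xle[OF t] assms m(2) by (simp add: lienard_field_left algebra_simps)
    finally show "(\<phi> has_vector_derivative lienard_field To Tp Dm Do Dp w a (\<phi> t)) (at t within {0..2 * h / \<beta>})"
      by (rule has_vector_derivative_at_within)
  qed
  moreover have "\<phi> 0 = pt (- w) (- To * w + q)"
    by (simp add: \<phi>_def X_def X'_def)
  moreover have "\<phi> (2 * h / \<beta>) = pt (- w) (- To * w - q)"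
    by (simp add: \<phi>_def Xe X'e)
  ultimately show ?thesis
    unfolding orbit_arc_def using neg h \<beta>
    by (intro exI[of _ "2 * h / \<beta>"] exI[of _ \<phi>]) (auto simp: \<phi>_def)
qed

text \<open>The arc consists of a transit from \<open>x = 0\<close> to \<open>x = - w\<close>, half of an orbit about the center, which
  only reverses the velocity, and a transit back. The last one is a transit of the
  reflected system in reversed time, hence the parameter \<open>- g\<close>.\<close>

lemma long_left_arc:
  assumes "0 < b" "0 < w" "0 < Dm" "0 \<le> k"
    and 1: "0 < \<theta>" "\<theta> < pi" "0 < qfun g (b * w) k \<theta>"
    and 2: "0 < \<theta>'" "\<theta>' < pi" "qfun (- g) (b * w) k \<theta>' = qfun g (b * w) k \<theta>"
  shows "orbit_arc (lienard_field (2 * g * b) Tp Dm (b\<^sup>2 * (1 + g\<^sup>2)) Dp w (b * (1 + g\<^sup>2) * k)) {z. z $ 1 < 0}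
    (pt 0 (vfun g (b * w) k \<theta>)) (pt 0 (- vfun (- g) (b * w) k \<theta>'))"
proof -
  let ?Do = "b\<^sup>2 * (1 + g\<^sup>2)" and ?a = "b * (1 + g\<^sup>2) * k" and ?W = "b * w" and ?q = "qfun g (b * w) k \<theta>"
  let ?G = "lienard_field (2 * g * b) Tp Dm ?Do Dp w ?a"
  have pos: "0 < 1 + g\<^sup>2"
    by (simp add: add_pos_nonneg)
  have top: "orbit_arc ?G {z. z $ 1 < 0} (pt 0 (vfun g ?W k \<theta>)) (pt (- w) (- (2 * g * b) * w + ?q))"
    by (rule orbit_arc_mono[where Z = "{z. z $ 1 \<in> {- w<..<0}}"])
      (use transit_arc[OF assms(1,2,4) 1, of Tp Dm Dp] in \<open>auto simp: add.commute\<close>)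
  have mid: "orbit_arc ?G {z. z $ 1 < 0} (pt (- w) (- (2 * g * b) * w + ?q)) (pt (- w) (- (2 * g * b) * w - ?q))"
    by (rule orbit_arc_mono[OF center_arc]) (use assms pos 1 in auto)
  have "orbit_arc (lienard_field (- (2 * g * b)) (- Tp) Dm ?Do Dp w ?a) {z. z $ 1 \<in> {- w<..<0}}
     (pt 0 (vfun (- g) ?W k \<theta>')) (pt (- w) (2 * g * b * w + ?q))"
    using transit_arc[OF assms(1,2,4) 2(1,2), of "- g" "- Tp" Dm Dp] 2(3) 1(3) by (simp add: add.commute)
  from orbit_arc_reflect[OF this]
  have "orbit_arc ?G {z. z $ 1 \<in> {- w<..<0}} (pt (- w) (- (2 * g * b) * w - ?q)) (pt 0 (- vfun (- g) ?W k \<theta>'))"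
    by simp
  then have bot: "orbit_arc ?G {z. z $ 1 < 0} (pt (- w) (- (2 * g * b) * w - ?q)) (pt 0 (- vfun (- g) ?W k \<theta>'))"
    by (rule orbit_arc_mono) auto
  show ?thesis
    using orbit_arc_append[OF top orbit_arc_append[OF mid bot]] assms(2) by simp
qed

lemma half_turn_right:
  assumes "0 < b" "0 < w" "0 < u"
  shows "orbit_arc (lienard_field To (2 * g * b) Dm Do (b\<^sup>2 * (1 + g\<^sup>2)) w 0) {z. z $ 1 > 0}
    (pt 0 (- u)) (pt 0 (u * exp (g * pi)))"
proof -
  have "orbit_arc (lienard_field To (2 * g * b) Dm Do (b\<^sup>2 * (1 + g\<^sup>2)) w 0) {z. z $ 1 \<in> {0<..}}
    (pt 0 (- u)) (pt (xpos g 0 u pi / b) (2 * g * xpos g 0 u pi - xvel g 0 u pi))"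
    using assms by (intro linear_orbit_arc[where C = "{0..}"])
      (auto simp: lienard_field_right xpos_def sin_gt_zero)
  then show ?thesis
    by (simp add: xpos_def xvel_def)
qed

lemma half_turn_left:
  assumes "0 < b" "0 < w" "g < 0" "0 < v" "v \<le> b * w"
  shows "orbit_arc (lienard_field (2 * g * b) Tp Dm (b\<^sup>2 * (1 + g\<^sup>2)) Dp w 0) {z. z $ 1 < 0}
    (pt 0 v) (pt 0 (- (v * exp (g * pi))))"
proof -
  have "xpos g 0 (- v) \<theta> / b \<in> {- w..<0}" if \<theta>: "0 < \<theta>" "\<theta> < pi" for \<theta>
  proof -
    have s: "0 < sin \<theta>"
      using \<theta> by (rule sin_gt_zero)
    have "exp (g * \<theta>) * sin \<theta> \<le> 1 * 1"
      using assms \<theta> s by (intro mult_mono) (auto simp: mult_le_0_iff)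
    then have "v * (exp (g * \<theta>) * sin \<theta>) \<le> (b * w) * 1"
      using assms s by (intro mult_mono) auto
    moreover have "0 < v * (exp (g * \<theta>) * sin \<theta>)"
      using assms s by simp
    ultimately show ?thesis
      using assms(1) by (simp add: xpos_def field_simps)
  qed
  then have "orbit_arc (lienard_field (2 * g * b) Tp Dm (b\<^sup>2 * (1 + g\<^sup>2)) Dp w 0) {z. z $ 1 \<in> {- w..<0}}
    (pt 0 (- (- v))) (pt (xpos g 0 (- v) pi / b) (2 * g * xpos g 0 (- v) pi - xvel g 0 (- v) pi))"
    using assms by (intro linear_orbit_arc[where C = "{- w..0}"])
      (auto simp: lienard_field_middle xpos_def)
  then have "orbit_arc (lienard_field (2 * g * b) Tp Dm (b\<^sup>2 * (1 + g\<^sup>2)) Dp w 0) {z. z $ 1 \<in> {- w..<0}}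
    (pt 0 v) (pt 0 (- (v * exp (g * pi))))"
    by (simp add: xpos_def xvel_def)
  then show ?thesis
    by (rule orbit_arc_mono) auto
qed

section \<open>Ranges of the passage functions\<close>

lemma pfun_at_bot: "filterlim (pfun g) at_bot (at_right pi)"
proof -
  have "((\<lambda>\<theta>. exp (- g * \<theta>) - cos \<theta> + g * sin \<theta>) \<longlongrightarrow> exp (- g * pi) - cos pi + g * sin pi) (at_right pi)"
    by (intro tendsto_intros)
  then have 1: "((\<lambda>\<theta>. exp (- g * \<theta>) - cos \<theta> + g * sin \<theta>) \<longlongrightarrow> exp (- g * pi) + 1) (at_right pi)"
    by simp
  have "(sin \<longlongrightarrow> sin pi) (at_right pi)"
    by (intro tendsto_intros)
  moreover have "\<forall>\<^sub>F \<theta> in at_right pi. sin \<theta> < 0"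
    using eventually_at_right_real[of pi "2 * pi"] by (auto elim!: eventually_mono simp: sin_neg_right)
  ultimately have "filterlim (\<lambda>\<theta>. inverse (sin \<theta>)) at_bot (at_right pi)"
    by (intro filterlim_inverse_at_bot) auto
  from filterlim_tendsto_pos_mult_at_bot[OF 1 _ this] show ?thesis
    by (simp add: pfun_def[abs_def] divide_inverse add_pos_pos)
qed

lemma pfun_at_top: "filterlim (pfun g) at_top (at_left pi)"
proof -
  have "((\<lambda>\<theta>. exp (- g * \<theta>) - cos \<theta> + g * sin \<theta>) \<longlongrightarrow> exp (- g * pi) - cos pi + g * sin pi) (at_left pi)"
    by (intro tendsto_intros)
  then have 1: "((\<lambda>\<theta>. exp (- g * \<theta>) - cos \<theta> + g * sin \<theta>) \<longlongrightarrow> exp (- g * pi) + 1) (at_left pi)"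
    by simp
  have "(sin \<longlongrightarrow> sin pi) (at_left pi)"
    by (intro tendsto_intros)
  moreover have "\<forall>\<^sub>F \<theta> in at_left pi. 0 < sin \<theta>"
    using eventually_at_left_real[of 0 pi] by (auto elim!: eventually_mono simp: sin_gt_zero)
  ultimately have "filterlim (\<lambda>\<theta>. inverse (sin \<theta>)) at_top (at_left pi)"
    by (intro filterlim_inverse_at_top) auto
  from filterlim_tendsto_pos_mult_at_top[OF 1 _ this] show ?thesis
    by (simp add: pfun_def[abs_def] divide_inverse add_pos_pos)
qed

text \<open>Both the numerator and \<open>sin\<close> vanish at \<open>0\<close>; their derivatives there are \<open>0\<close> and \<open>1\<close>.\<close>

lemma pfun_at_0: "(pfun g \<longlongrightarrow> 0) (at_right 0)"
proof -
  have "((\<lambda>\<theta>. exp (- g * \<theta>) - cos \<theta> + g * sin \<theta>) has_real_derivative 0) (at 0)"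
    by (auto intro!: derivative_eq_intros)
  then have 1: "((\<lambda>h. (exp (- g * h) - cos h + g * sin h) / h) \<longlongrightarrow> 0) (at 0)"
    by (simp add: DERIV_def)
  have "((\<lambda>h::real. sin h / h) \<longlongrightarrow> 1) (at 0)"
    using DERIV_sin[of "0::real"] by (simp add: DERIV_def)
  from tendsto_divide[OF 1 this] have "((\<lambda>h. (exp (- g * h) - cos h + g * sin h) / h / (sin h / h)) \<longlongrightarrow> 0) (at 0)"
    by simp
  then have "((\<lambda>h. (exp (- g * h) - cos h + g * sin h) / h / (sin h / h)) \<longlongrightarrow> 0) (at_right 0)"
    by (rule filterlim_mono) (auto simp: at_le)
  then show ?thesis
    by (rule Lim_transform_eventually)
      (auto simp: pfun_def[abs_def] eventually_at_filter)
qed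

lemma continuous_on_pfun: "(\<And>\<theta>. \<theta> \<in> S \<Longrightarrow> sin \<theta> \<noteq> 0) \<Longrightarrow> continuous_on S (pfun g)"
  unfolding pfun_def[abs_def] by (intro continuous_intros) auto

lemma pfun_onto_left:
  assumes "0 < y"
  shows "\<exists>\<theta>. 0 < \<theta> \<and> \<theta> < pi \<and> pfun g \<theta> = y"
proof -
  have "\<forall>\<^sub>F \<theta> in at_right 0. pfun g \<theta> < y"
    using order_tendstoD(2)[OF pfun_at_0 assms] .
  moreover have "\<forall>\<^sub>F \<theta> in at_right 0. \<theta> \<in> {0<..<pi/2 :: real}"
    by (rule eventually_at_right_real) simp
  ultimately have "\<forall>\<^sub>F \<theta> in at_right 0. pfun g \<theta> < y \<and> \<theta> \<in> {0<..<pi/2}"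
    by eventually_elim auto
  then obtain s where s: "pfun g s < y" "0 < s" "s < pi / 2"
    using eventually_happens'[of "at_right (0::real)"] by force
  have "\<forall>\<^sub>F \<theta> in at_left pi. y < pfun g \<theta>"
    using pfun_at_top[of g] by (simp add: filterlim_at_top_dense)
  moreover have "\<forall>\<^sub>F \<theta> in at_left pi. \<theta> \<in> {pi/2<..<pi}"
    by (rule eventually_at_left_real) simp
  ultimately have "\<forall>\<^sub>F \<theta> in at_left pi. y < pfun g \<theta> \<and> \<theta> \<in> {pi/2<..<pi}"
    by eventually_elim auto
  then obtain t where t: "y < pfun g t" "pi / 2 < t" "t < pi"
    using eventually_happens'[of "at_left pi"] by force
  have "sin \<theta> \<noteq> 0" if "\<theta> \<in> {s..t}" for \<theta>
    using sin_gt_zero[of \<theta>] that s t by auto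
  then have "continuous_on {s..t} (pfun g)"
    by (rule continuous_on_pfun)
  then obtain \<theta> where "s \<le> \<theta>" "\<theta> \<le> t" "pfun g \<theta> = y"
    using IVT'[of "pfun g" s y t] s t by auto
  then show ?thesis
    using s t by (intro exI[of _ \<theta>]) auto
qed

lemma pfun_onto_right:
  assumes "pi < \<Theta>" "\<Theta> < 2 * pi" "y < pfun g \<Theta>"
  shows "\<exists>\<theta>. pi < \<theta> \<and> \<theta> < \<Theta> \<and> pfun g \<theta> = y"
proof -
  have "\<forall>\<^sub>F \<theta> in at_right pi. pfun g \<theta> < y"
    using pfun_at_bot[of g] by (simp add: filterlim_at_bot_dense)
  moreover have "\<forall>\<^sub>F \<theta> in at_right pi. \<theta> \<in> {pi<..<\<Theta>}"
    by (rule eventually_at_right_real) (use assms in simp)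
  ultimately have "\<forall>\<^sub>F \<theta> in at_right pi. pfun g \<theta> < y \<and> \<theta> \<in> {pi<..<\<Theta>}"
    by eventually_elim auto
  then obtain s where s: "pfun g s < y" "pi < s" "s < \<Theta>"
    using eventually_happens'[of "at_right pi"] by force
  have "sin \<theta> \<noteq> 0" if "\<theta> \<in> {s..\<Theta>}" for \<theta>
    using sin_neg_right[of \<theta>] that s assms by auto
  then have "continuous_on {s..\<Theta>} (pfun g)"
    by (rule continuous_on_pfun)
  then obtain \<theta> where "s \<le> \<theta>" "\<theta> \<le> \<Theta>" "pfun g \<theta> = y"
    using IVT'[of "pfun g" s y \<Theta>] s assms by auto
  then show ?thesis
    using s assms by (intro exI[of _ \<theta>]) (auto simp: less_le)
qed

lemma cot_surj: "\<exists>\<theta>. 0 < \<theta> \<and> \<theta> < pi \<and> cos \<theta> / sin \<theta> = M \<and> (0 < M \<longrightarrow> \<theta> < pi / 2)"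
proof -
  define \<theta> where "\<theta> = pi / 2 - arctan M"
  have "cos \<theta> / sin \<theta> = tan (arctan M)"
    by (simp add: \<theta>_def cos_diff sin_diff tan_def)
  then show ?thesis
    using arctan_bounded[of M] by (intro exI[of _ \<theta>]) (auto simp: \<theta>_def tan_arctan)
qed

lemma qfun_onto:
  assumes "0 < W" "0 \<le> k" "0 < q"
  shows "\<exists>\<theta>. 0 < \<theta> \<and> \<theta> < pi \<and> qfun g W k \<theta> = q"
proof -
  define M where "M = (q + k * pfun (- g) (pi / 2)) / W + \<bar>g\<bar> + 1"
  have pp: "0 < pfun (- g) (pi / 2)"
    by (intro pfun_pos) auto
  have M: "0 < M"
    using assms pp by (simp add: M_def add_nonneg_pos)
  obtain s where s: "0 < s" "s < pi" "cos s / sin s = M" "s < pi / 2"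
    using cot_surj[of M] M by blast
  have "q + k * pfun (- g) (pi / 2) \<le> W * (g + M)"
  proof -
    have "0 \<le> W * (g + \<bar>g\<bar> + 1)"
      using assms by simp
    moreover have "W * (g + M) = q + k * pfun (- g) (pi / 2) + W * (g + \<bar>g\<bar> + 1)"
      using assms by (simp add: M_def field_simps)
    ultimately show ?thesis
      by linarith
  qed
  moreover have "k * pfun (- g) s \<le> k * pfun (- g) (pi / 2)"
    using pfun_strict_mono_left[of s "pi / 2" "- g"] s assms by (intro mult_left_mono) auto
  ultimately have 1: "q \<le> qfun g W k s"
    using s by (simp add: qfun_def)
  obtain t where t: "0 < t" "t < pi" "cos t / sin t = - g - 1"
    using cot_surj[of "- g - 1"] by blast
  have "0 \<le> k * pfun (- g) t"
    using pfun_pos[of t "- g"] t assms by simp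
  then have 2: "qfun g W k t \<le> q"
    using t assms by (simp add: qfun_def)
  have st: "s \<le> t"
  proof (rule ccontr)
    assume "\<not> ?thesis"
    then have "qfun g W k s < qfun g W k t"
      using qfun_strict_antimono[of W k t s g] assms s t by simp
    moreover have "qfun g W k t < 0"
      using \<open>0 \<le> k * pfun (- g) t\<close> t assms by (simp add: qfun_def)
    ultimately show False
      using 1 assms by simp
  qed
  have "sin \<theta> \<noteq> 0" if "\<theta> \<in> {s..t}" for \<theta>
    using sin_gt_zero[of \<theta>] that s t by auto
  then have "continuous_on {s..t} (qfun g W k)"
    unfolding qfun_def[abs_def] by (intro continuous_intros continuous_on_pfun) auto
  then obtain \<theta> where "s \<le> \<theta>" "\<theta> \<le> t" "qfun g W k \<theta> = q"
    using IVT2'[of "qfun g W k" t q s] 1 2 st by auto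
  then show ?thesis
    using s t by (intro exI[of _ \<theta>]) auto
qed

section \<open>Half-return maps in squared coordinates\<close>

text \<open>A curve \<open>(X \<theta>, Y \<theta>)\<close> with \<open>Y' = s X'\<close> is the graph of a function of \<open>X\<close> with slope \<open>s\<close>. The
  half-return maps below are given by such curves, with \<open>\<theta>\<close> the angle swept.\<close>

lemma DERIV_curve_as_graph:
  fixes X Y :: "real \<Rightarrow> real"
  assumes "open S" "inj_on X S" "\<theta> \<in> S"
    and X: "\<And>\<theta>. \<theta> \<in> S \<Longrightarrow> (X has_real_derivative X' \<theta>) (at \<theta>)" "\<And>\<theta>. \<theta> \<in> S \<Longrightarrow> X' \<theta> \<noteq> 0"
    and Y: "(Y has_real_derivative s * X' \<theta>) (at \<theta>)"
  shows "((\<lambda>V. Y (the_inv_into S X V)) has_real_derivative s) (at (X \<theta>))"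
proof -
  let ?g = "the_inv_into S X"
  have inv: "?g (X t) = t" if "t \<in> S" for t
    using the_inv_into_f_f[OF assms(2) that] .
  have "continuous_on S X"
    using X(1) by (meson DERIV_isCont continuous_at_imp_continuous_on)
  then have "(?g has_derivative (*) (inverse (X' \<theta>))) (at (X \<theta>))"
    using X(1)[OF assms(3)] X(2)[OF assms(3)] inv assms(1,3)
    by (intro has_derivative_inverse_strong[of S \<theta> X ?g "(*) (X' \<theta>)"]) (auto simp: has_field_derivative_def)
  then have "(?g has_real_derivative inverse (X' \<theta>)) (at (X \<theta>))"
    by (simp add: has_field_derivative_def)
  moreover have "(Y has_real_derivative s * X' \<theta>) (at (?g (X \<theta>)))"
    using Y inv[OF assms(3)] by simp
  ultimately have "((\<lambda>V. Y (?g V)) has_real_derivative (s * X' \<theta>) * inverse (X' \<theta>)) (at (X \<theta>))"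
    by (rule DERIV_chain2[rotated])
  then show ?thesis
    using X(2)[OF assms(3)] by (simp add: mult.assoc)
qed

lemma tangency_angle_exists:
  assumes "0 < g"
  shows "\<exists>\<theta>. pi < \<theta> \<and> \<theta> < 2 * pi \<and> pfun g \<theta> = 0"
proof -
  let ?f = "\<lambda>\<theta>. exp (- g * \<theta>) - cos \<theta> + g * sin \<theta>"
  have "0 < ?f pi" "?f (2 * pi) < 0"
    using assms by (auto simp: add_pos_pos)
  moreover have "continuous_on {pi..2 * pi} ?f"
    by (intro continuous_intros)
  ultimately obtain \<theta> where \<theta>: "pi \<le> \<theta>" "\<theta> \<le> 2 * pi" "?f \<theta> = 0"
    using IVT2'[of ?f "2 * pi" 0 pi] by auto
  moreover have "\<theta> \<noteq> pi" "\<theta> \<noteq> 2 * pi"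
    using \<theta>(3) \<open>0 < ?f pi\<close> \<open>?f (2 * pi) < 0\<close> by auto
  ultimately show ?thesis
    by (intro exI[of _ \<theta>]) (auto simp: pfun_def)
qed

text \<open>At this angle a passage through \<open>x > 0\<close> starts with velocity zero, tangentially to \<open>x = 0\<close>. All
  passages with positive initial velocity have angles between \<open>\<pi>\<close> and this one.\<close>

definition tangency_angle :: "real \<Rightarrow> real" where
  "tangency_angle g = (SOME \<theta>. pi < \<theta> \<and> \<theta> < 2 * pi \<and> pfun g \<theta> = 0)"

lemma tangency_angle:
  assumes "0 < g"
  shows "pi < tangency_angle g" "tangency_angle g < 2 * pi" "pfun g (tangency_angle g) = 0"
  using someI_ex[OF tangency_angle_exists[OF assms]] by (simp_all add: tangency_angle_def)

lemma pfun_neg_before_tangency: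
  assumes "0 < g" "pi < \<theta>" "\<theta> < tangency_angle g"
  shows "pfun g \<theta> < 0"
  using pfun_strict_mono_right[of g \<theta> "tangency_angle g"] tangency_angle[OF assms(1)] assms by simp

lemma pfun_uminus_strict_mono_right:
  assumes "0 < g" "pi < s" "s < t" "t \<le> tangency_angle g"
  shows "pfun (- g) s < pfun (- g) t"
proof (rule DERIV_pos_imp_increasing_open[OF assms(3)])
  have t: "t < 2 * pi"
    using tangency_angle[OF assms(1)] assms by simp
  show "\<exists>d. (pfun (- g) has_real_derivative d) (at r) \<and> 0 < d" if "s < r" "r < t" for r
  proof -
    have "sin r < 0" "pfun g r < 0"
      using that assms t by (auto intro!: sin_neg_right pfun_neg_before_tangency)
    then show ?thesis
      using pfun_deriv[of r "- g"]
      by (intro exI[of _ "exp (g * r) * pfun g r / sin r"]) (auto intro!: divide_neg_neg mult_pos_neg)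
  qed
  have "sin r \<noteq> 0" if "r \<in> {s..t}" for r
    using sin_neg_right[of r] that assms t by auto
  then show "continuous_on {s..t} (pfun (- g))"
    by (rule continuous_on_pfun)
qed

lemma power2_less_of_neg:
  fixes x y :: real
  assumes "x < y" "y \<le> 0" shows "y\<^sup>2 < x\<^sup>2"
  using power_strict_mono[of "- y" "- x" 2] assms by simp

lemma strict_antimono_imp_inj_on:
  fixes f :: "real \<Rightarrow> real"
  assumes "\<And>x y. x \<in> S \<Longrightarrow> y \<in> S \<Longrightarrow> x < y \<Longrightarrow> f y < f x"
  shows "inj_on f S"
proof (rule inj_onI)
  fix x y assume "x \<in> S" "y \<in> S" "f x = f y"
  then show "x = y"
    using assms[of x y] assms[of y x] by (cases x y rule: linorder_cases) auto
qed

text \<open>For a passage through \<open>x > 0\<close> that ends at height \<open>v\<close>, \<open>right_angle\<close> is its angle and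
  \<open>right_graph\<close> the square of the height at which it starts, both as functions of \<open>V = v\<^sup>2\<close>. Only
  \<open>V > tangency_value g k\<close> is meaningful.\<close>

definition right_angle :: "real \<Rightarrow> real \<Rightarrow> real \<Rightarrow> real" where
  "right_angle g k = the_inv_into {pi<..<tangency_angle g} (\<lambda>\<theta>. (k * pfun (- g) \<theta>)\<^sup>2)"

definition right_graph :: "real \<Rightarrow> real \<Rightarrow> real \<Rightarrow> real" where
  "right_graph g k V = (k * pfun g (right_angle g k V))\<^sup>2"

definition tangency_value :: "real \<Rightarrow> real \<Rightarrow> real" where
  "tangency_value g k = (k * pfun (- g) (tangency_angle g))\<^sup>2"

lemma right_square_antimono:
  assumes "0 < g" "0 < k" "pi < s" "s < t" "t \<le> tangency_angle g"
  shows "(k * pfun (- g) t)\<^sup>2 < (k * pfun (- g) s)\<^sup>2"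
proof (rule power2_less_of_neg)
  show "k * pfun (- g) s < k * pfun (- g) t"
    using assms pfun_uminus_strict_mono_right[of g s t] by simp
  show "k * pfun (- g) t \<le> 0"
    using assms pfun_neg[of g t] tangency_angle[of g] by (simp add: mult_le_0_iff)
qed

lemma right_angle_eq:
  assumes "0 < g" "0 < k" "pi < \<theta>" "\<theta> < tangency_angle g"
  shows "right_angle g k ((k * pfun (- g) \<theta>)\<^sup>2) = \<theta>"
  unfolding right_angle_def
  by (rule the_inv_into_f_f[OF strict_antimono_imp_inj_on])
    (use assms right_square_antimono[of g k] in auto)

lemma right_graph_deriv_aux:
  assumes "0 < g" "0 < k" "pi < \<theta>" "\<theta> < tangency_angle g"
  shows "(right_graph g k has_real_derivative exp (- 2 * g * \<theta>)) (at ((k * pfun (- g) \<theta>)\<^sup>2))"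
  unfolding right_graph_def[abs_def] right_angle_def
proof (rule DERIV_curve_as_graph[where X' = "\<lambda>\<theta>. 2 * (k * pfun (- g) \<theta>) * (k * (exp (g * \<theta>) * pfun g \<theta> / sin \<theta>))"])
  let ?S = "{pi<..<tangency_angle g}"
  have s: "sin t < 0" "pfun g t < 0" "pfun (- g) t < 0" if "t \<in> ?S" for t
    using that assms(1) tangency_angle[of g]
    by (auto intro!: sin_neg_right pfun_neg_before_tangency pfun_neg)
  show "inj_on (\<lambda>\<theta>. (k * pfun (- g) \<theta>)\<^sup>2) ?S"
    using assms right_square_antimono[of g k] by (intro strict_antimono_imp_inj_on) auto
  show "((\<lambda>\<theta>. (k * pfun (- g) \<theta>)\<^sup>2) has_real_derivative
      2 * (k * pfun (- g) t) * (k * (exp (g * t) * pfun g t / sin t))) (at t)" if "t \<in> ?S" for t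
    using s[OF that] pfun_deriv[of t "- g"] by (auto intro!: derivative_eq_intros)
  show "2 * (k * pfun (- g) t) * (k * (exp (g * t) * pfun g t / sin t)) \<noteq> 0" if "t \<in> ?S" for t
    using s[OF that] assms(2) by simp
  have "((\<lambda>\<theta>. (k * pfun g \<theta>)\<^sup>2) has_real_derivative
      2 * (k * pfun g \<theta>) * (k * (exp (- g * \<theta>) * pfun (- g) \<theta> / sin \<theta>))) (at \<theta>)"
    using s[of \<theta>] assms pfun_deriv[of \<theta> g] by (auto intro!: derivative_eq_intros)
  also have "exp (- g * \<theta>) = exp (- 2 * g * \<theta>) * exp (g * \<theta>)"
    by (simp flip: exp_add)
  finally show "((\<lambda>\<theta>. (k * pfun g \<theta>)\<^sup>2) has_real_derivative exp (- 2 * g * \<theta>) *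
      (2 * (k * pfun (- g) \<theta>) * (k * (exp (g * \<theta>) * pfun g \<theta> / sin \<theta>)))) (at \<theta>)"
    by (simp add: mult_ac)
qed (use assms in auto)

lemma right_square_onto:
  assumes "0 < g" "0 < k" "tangency_value g k < V"
  shows "\<exists>\<theta>. pi < \<theta> \<and> \<theta> < tangency_angle g \<and> V = (k * pfun (- g) \<theta>)\<^sup>2"
proof -
  note t = tangency_angle[OF assms(1)]
  have V: "0 < V"
    using assms(3) unfolding tangency_value_def by (metis le_less_trans zero_le_power2)
  have "k * pfun (- g) (tangency_angle g) < 0"
    using pfun_neg[OF assms(1) t(1,2)] assms(2) by (simp add: mult_pos_neg)
  then have "- sqrt V < k * pfun (- g) (tangency_angle g)"
    using real_less_rsqrt[of "- (k * pfun (- g) (tangency_angle g))" V] assms(3)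
    by (simp add: tangency_value_def)
  then have "- sqrt V / k < pfun (- g) (tangency_angle g)"
    using assms(2) by (simp add: field_simps)
  then obtain \<theta> where \<theta>: "pi < \<theta>" "\<theta> < tangency_angle g" "pfun (- g) \<theta> = - sqrt V / k"
    using pfun_onto_right[OF t(1,2)] by blast
  then have "(k * pfun (- g) \<theta>)\<^sup>2 = V"
    using assms(2) V by simp
  then show ?thesis
    using \<theta> by auto
qed

lemma right_graph:
  assumes "0 < g" "0 < k" "tangency_value g k < V"
  shows "pi < right_angle g k V" "right_angle g k V < tangency_angle g"
    "(k * pfun (- g) (right_angle g k V))\<^sup>2 = V"
    "(right_graph g k has_real_derivative exp (- 2 * g * right_angle g k V)) (at V)"
  using right_square_onto[OF assms] right_angle_eq[OF assms(1,2)] right_graph_deriv_aux[OF assms(1,2)]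
  by auto

lemma right_angle_antimono:
  assumes "0 < g" "0 < k" "tangency_value g k < V" "V < V'"
  shows "right_angle g k V' < right_angle g k V"
proof (rule ccontr)
  assume n: "\<not> ?thesis"
  note 1 = right_graph[OF assms(1-3)] and 2 = right_graph[OF assms(1,2) less_trans[OF assms(3,4)]]
  have "(k * pfun (- g) (right_angle g k V'))\<^sup>2 \<le> (k * pfun (- g) (right_angle g k V))\<^sup>2"
    using right_square_antimono[OF assms(1,2) 1(1), of "right_angle g k V'"] n 2(2)
    by (cases "right_angle g k V' = right_angle g k V") auto
  then show False
    using 1(3) 2(3) assms(4) by simp
qed

text \<open>A passage with the focus in \<open>x > 0\<close> takes more than half a turn, so it expands more than the half-turn
  about a focus on \<open>x = 0\<close>, which multiplies heights by \<open>exp (g \<pi>)\<close>.\<close>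

lemma right_graph_upper:
  assumes "0 < g" "0 < k" "tangency_value g k < V"
  shows "right_graph g k V < exp (- 2 * pi * g) * V"
proof -
  define \<theta> where "\<theta> = right_angle g k V"
  note \<theta> = right_graph(1-3)[OF assms, folded \<theta>_def]
  define s where "s = \<theta> - pi"
  have s: "0 < s" "s < pi" "\<theta> = pi + s"
    using \<theta> tangency_angle[OF assms(1)] by (auto simp: s_def)
  have ss: "0 < sin s"
    using s by (intro sin_gt_zero)
  let ?A = "exp (g * s) - cos s + g * sin s" and ?B = "exp (- (g * s)) - cos s - g * sin s"
  have "1 < exp (g * s)"
    using assms(1) s by simp
  moreover have "cos s \<le> 1" "0 < g * sin s"
    using assms(1) ss by auto
  ultimately have A: "0 < ?A"
    by linarith
  have "exp (- (g * s)) \<le> exp (g * s)"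
    using assms(1) s by simp
  then have "?B \<le> ?A"
    using \<open>0 < g * sin s\<close> by linarith
  then have "exp (- (g * pi)) * ?B \<le> exp (- (g * pi)) * ?A"
    by simp
  also have "\<dots> < 1 * ?A"
    using A assms(1) by (intro mult_strict_right_mono) auto
  finally have lt: "exp (- (g * pi)) * ?B < ?A"
    by simp
  have "(exp (- g * pi) * pfun (- g) \<theta> - pfun g \<theta>) * sin s = exp (- (g * pi)) * ?B - ?A"
    using ss unfolding s(3) pfun_def
    by (simp add: algebra_simps diff_divide_distrib add_divide_distrib flip: exp_add)
  then have "exp (- g * pi) * pfun (- g) \<theta> < pfun g \<theta>"
    using lt ss by (metis diff_less_0_iff_less mult_less_0_iff not_less_iff_gr_or_eq)
  then have "k * (exp (- g * pi) * pfun (- g) \<theta>) < k * pfun g \<theta>"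
    using assms(2) by simp
  moreover have "k * pfun g \<theta> \<le> 0"
    using pfun_neg_before_tangency[OF assms(1) \<theta>(1,2)] assms(2) by (simp add: mult_le_0_iff)
  ultimately have "(k * pfun g \<theta>)\<^sup>2 < (k * (exp (- g * pi) * pfun (- g) \<theta>))\<^sup>2"
    by (rule power2_less_of_neg)
  also have "\<dots> = (exp (- g * pi))\<^sup>2 * (k * pfun (- g) \<theta>)\<^sup>2"
    by (simp add: power_mult_distrib mult_ac)
  also have "\<dots> = exp (- 2 * pi * g) * V"
    unfolding \<theta>(3) by (simp add: power2_eq_square mult_ac flip: exp_add)
  finally show ?thesis
    by (simp add: right_graph_def \<theta>_def)
qed

text \<open>For \<open>k \<longlonglongrightarrow> 0\<close> the angle \<open>c\<close> may be chosen close to \<open>\<pi>\<close>, so that the bound approaches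
  the upper bound \<open>right_graph_upper\<close>.\<close>

lemma right_graph_lower:
  assumes "0 < g" "0 < k" and c: "pi < c" "c < tangency_angle g" "(k * pfun (- g) c)\<^sup>2 < V"
  shows "exp (- 2 * g * c) * (V - (k * pfun (- g) c)\<^sup>2) \<le> right_graph g k V"
proof -
  let ?C = "(k * pfun (- g) c)\<^sup>2"
  have tv: "tangency_value g k < ?C"
    unfolding tangency_value_def by (rule right_square_antimono[OF assms(1,2) c(1,2) order_refl])
  have d: "(right_graph g k has_real_derivative exp (- 2 * g * right_angle g k r)) (at r)" if "?C \<le> r" for r
    by (rule right_graph(4)[OF assms(1,2)]) (use that tv in linarith)
  obtain z where z: "?C < z" "z < V"
    "right_graph g k V - right_graph g k ?C = (V - ?C) * exp (- 2 * g * right_angle g k z)"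
    using MVT2[OF c(3) d] by auto
  have "right_angle g k z < c"
    using right_angle_antimono[OF assms(1,2) tv z(1)] right_angle_eq[OF assms(1,2) c(1,2)] by simp
  then have "(V - ?C) * exp (- 2 * g * c) \<le> (V - ?C) * exp (- 2 * g * right_angle g k z)"
    using assms(1) c(3) by (intro mult_left_mono) auto
  then have "(V - ?C) * exp (- 2 * g * c) \<le> right_graph g k V - right_graph g k ?C"
    using z(3) by simp
  moreover have "0 \<le> right_graph g k ?C"
    by (simp add: right_graph_def)
  ultimately have "(V - ?C) * exp (- 2 * g * c) \<le> right_graph g k V"
    by linarith
  then show ?thesis
    by (subst mult.commute)
qed

text \<open>For a passage through \<open>x < 0\<close> that starts at height \<open>v\<close> and stays in the middle zone, \<open>left_angle\<close> is
  its angle and \<open>short_left_graph\<close> the square of the height at which it ends, as functions of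
  \<open>V = v\<^sup>2\<close>.\<close>

definition left_angle :: "real \<Rightarrow> real \<Rightarrow> real \<Rightarrow> real" where
  "left_angle g k = the_inv_into {0<..<pi} (\<lambda>\<theta>. (k * pfun g \<theta>)\<^sup>2)"

definition short_left_graph :: "real \<Rightarrow> real \<Rightarrow> real \<Rightarrow> real" where
  "short_left_graph g k V = (k * pfun (- g) (left_angle g k V))\<^sup>2"

lemma left_square_mono:
  assumes "0 < k" "0 < s" "s < t" "t < pi"
  shows "(k * pfun g s)\<^sup>2 < (k * pfun g t)\<^sup>2"
  using assms pfun_strict_mono_left[of s t g] pfun_pos[of s g]
  by (intro power_strict_mono) auto

lemma left_square_inj: "0 < k \<Longrightarrow> inj_on (\<lambda>\<theta>. (k * pfun g \<theta>)\<^sup>2) {0<..<pi}"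
proof (rule inj_onI)
  fix x y assume *: "0 < k" "x \<in> {0<..<pi}" "y \<in> {0<..<pi}" "(k * pfun g x)\<^sup>2 = (k * pfun g y)\<^sup>2"
  then show "x = y"
    using left_square_mono[of k x y g] left_square_mono[of k y x g]
    by (cases x y rule: linorder_cases) auto
qed

lemma left_angle_eq:
  assumes "0 < k" "0 < \<theta>" "\<theta> < pi"
  shows "left_angle g k ((k * pfun g \<theta>)\<^sup>2) = \<theta>"
  unfolding left_angle_def by (rule the_inv_into_f_f[OF left_square_inj]) (use assms in auto)

lemma short_left_graph_deriv_aux:
  assumes "0 < k" "0 < \<theta>" "\<theta> < pi"
  shows "(short_left_graph g k has_real_derivative exp (2 * g * \<theta>)) (at ((k * pfun g \<theta>)\<^sup>2))"
  unfolding short_left_graph_def[abs_def] left_angle_def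
proof (rule DERIV_curve_as_graph[where X' = "\<lambda>\<theta>. 2 * (k * pfun g \<theta>) * (k * (exp (- g * \<theta>) * pfun (- g) \<theta> / sin \<theta>))"])
  let ?S = "{0<..<pi}"
  have s: "0 < sin t" "0 < pfun g t" "0 < pfun (- g) t" if "t \<in> ?S" for t
    using that by (auto intro!: sin_gt_zero pfun_pos)
  show "inj_on (\<lambda>\<theta>. (k * pfun g \<theta>)\<^sup>2) ?S"
    using assms by (intro left_square_inj)
  show "((\<lambda>\<theta>. (k * pfun g \<theta>)\<^sup>2) has_real_derivative
      2 * (k * pfun g t) * (k * (exp (- g * t) * pfun (- g) t / sin t))) (at t)" if "t \<in> ?S" for t
    using s[OF that] pfun_deriv[of t g] by (auto intro!: derivative_eq_intros)
  show "2 * (k * pfun g t) * (k * (exp (- g * t) * pfun (- g) t / sin t)) \<noteq> 0" if "t \<in> ?S" for t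
    using s[OF that] assms(1) by simp
  have "((\<lambda>\<theta>. (k * pfun (- g) \<theta>)\<^sup>2) has_real_derivative
      2 * (k * pfun (- g) \<theta>) * (k * (exp (g * \<theta>) * pfun g \<theta> / sin \<theta>))) (at \<theta>)"
    using s[of \<theta>] assms pfun_deriv[of \<theta> "- g"] by (auto intro!: derivative_eq_intros)
  also have "exp (g * \<theta>) = exp (2 * g * \<theta>) * exp (- g * \<theta>)"
    by (simp flip: exp_add)
  finally show "((\<lambda>\<theta>. (k * pfun (- g) \<theta>)\<^sup>2) has_real_derivative exp (2 * g * \<theta>) *
      (2 * (k * pfun g \<theta>) * (k * (exp (- g * \<theta>) * pfun (- g) \<theta> / sin \<theta>)))) (at \<theta>)"
    by (simp add: mult_ac)
qed (use assms in auto)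

lemma short_left_graph:
  assumes "0 < k" "0 < V"
  shows "0 < left_angle g k V" "left_angle g k V < pi" "k * pfun g (left_angle g k V) = sqrt V"
    "(short_left_graph g k has_real_derivative exp (2 * g * left_angle g k V)) (at V)"
    "0 < short_left_graph g k V"
proof -
  obtain \<theta> where \<theta>: "0 < \<theta>" "\<theta> < pi" "pfun g \<theta> = sqrt V / k"
    using pfun_onto_left[of "sqrt V / k" g] assms by auto
  then have eq: "k * pfun g \<theta> = sqrt V" "(k * pfun g \<theta>)\<^sup>2 = V"
    using assms by simp_all
  have ang: "left_angle g k V = \<theta>"
    using left_angle_eq[OF assms(1) \<theta>(1,2), of g] eq by simp
  then show "0 < left_angle g k V" "left_angle g k V < pi" "k * pfun g (left_angle g k V) = sqrt V"
    "0 < short_left_graph g k V"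
    using \<theta> eq pfun_pos[OF \<theta>(1,2), of "- g"] assms by (auto simp: short_left_graph_def)
  show "(short_left_graph g k has_real_derivative exp (2 * g * left_angle g k V)) (at V)"
    using short_left_graph_deriv_aux[OF assms(1) \<theta>(1,2), of g] eq ang by simp
qed

lemma left_angle_mono:
  assumes "0 < k" "0 < V" "V < V'"
  shows "left_angle g k V < left_angle g k V'"
proof (rule ccontr)
  assume n: "\<not> ?thesis"
  note 1 = short_left_graph[OF assms(1,2), of g] and 2 = short_left_graph[OF assms(1) less_trans[OF assms(2,3)], of g]
  have "pfun g (left_angle g k V') \<le> pfun g (left_angle g k V)"
    using pfun_strict_mono_left[OF 2(1), of "left_angle g k V" g] n 1(2)
    by (cases "left_angle g k V' = left_angle g k V") auto
  then have "k * pfun g (left_angle g k V') \<le> k * pfun g (left_angle g k V)"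
    using assms(1) by simp
  then show False
    using 1(3) 2(3) assms(3) by simp
qed

lemma short_left_graph_mono:
  assumes "0 < k" "0 < V" "V < V'"
  shows "short_left_graph g k V < short_left_graph g k V'"
  unfolding short_left_graph_def using assms
  by (intro left_square_mono left_angle_mono short_left_graph) auto

lemma short_left_graph_upper:
  assumes "g < 0" "0 < k" and c: "0 < c" "c < pi" "(k * pfun g c)\<^sup>2 < V"
  shows "short_left_graph g k V \<le> (k * pfun (- g) c)\<^sup>2 + exp (2 * g * c) * V"
proof -
  let ?C = "(k * pfun g c)\<^sup>2"
  have C: "0 < ?C"
    using pfun_pos[OF c(1,2), of g] assms by simp
  have d: "(short_left_graph g k has_real_derivative exp (2 * g * left_angle g k r)) (at r)" if "?C \<le> r" for r
    by (rule short_left_graph(4)[OF assms(2)]) (use that C in linarith)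
  obtain z where z: "?C < z" "z < V"
    "short_left_graph g k V - short_left_graph g k ?C = (V - ?C) * exp (2 * g * left_angle g k z)"
    using MVT2[OF c(3) d] by auto
  have "c < left_angle g k z"
    using left_angle_mono[OF assms(2) C z(1), of g] left_angle_eq[OF assms(2) c(1,2), of g] by simp
  then have "(V - ?C) * exp (2 * g * left_angle g k z) \<le> V * exp (2 * g * c)"
    using assms(1) c(3) C less_imp_le[OF less_trans[OF C c(3)]] by (intro mult_mono) auto
  then show ?thesis
    using z(3) left_angle_eq[OF assms(2) c(1,2), of g] by (simp add: short_left_graph_def mult.commute)
qed

text \<open>A passage through \<open>x < 0\<close> that reaches \<open>x = - w\<close> is described by the angle \<open>\<theta>\<close> of its first
  transit, which has to end with positive \<open>qfun\<close>. The angle of the second transit is determined by the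
  condition that the orbit comes back to \<open>x = - w\<close> with the velocity reversed.\<close>

definition top_domain :: "real \<Rightarrow> real \<Rightarrow> real \<Rightarrow> real set" where
  "top_domain g W k = {\<theta>. 0 < \<theta> \<and> \<theta> < pi \<and> 0 < qfun g W k \<theta>}"

definition top_angle :: "real \<Rightarrow> real \<Rightarrow> real \<Rightarrow> real \<Rightarrow> real" where
  "top_angle g W k = the_inv_into (top_domain g W k) (\<lambda>\<theta>. (vfun g W k \<theta>)\<^sup>2)"

definition bottom_angle :: "real \<Rightarrow> real \<Rightarrow> real \<Rightarrow> real \<Rightarrow> real" where
  "bottom_angle g W k \<theta> = the_inv_into {0<..<pi} (qfun (- g) W k) (qfun g W k \<theta>)"

definition long_left_graph :: "real \<Rightarrow> real \<Rightarrow> real \<Rightarrow> real \<Rightarrow> real" where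
  "long_left_graph g W k V = (vfun (- g) W k (bottom_angle g W k (top_angle g W k V)))\<^sup>2"

lemma qfun_inj: "0 < W \<Longrightarrow> 0 \<le> k \<Longrightarrow> inj_on (qfun g W k) {0<..<pi}"
  by (rule strict_antimono_imp_inj_on) (auto intro: qfun_strict_antimono)

lemma bottom_angle:
  assumes "0 < W" "0 \<le> k" "\<theta> \<in> top_domain g W k"
  shows "0 < bottom_angle g W k \<theta>" "bottom_angle g W k \<theta> < pi"
    "qfun (- g) W k (bottom_angle g W k \<theta>) = qfun g W k \<theta>"
proof -
  obtain \<theta>' where \<theta>': "0 < \<theta>'" "\<theta>' < pi" "qfun (- g) W k \<theta>' = qfun g W k \<theta>"
    using qfun_onto[OF assms(1,2), of "qfun g W k \<theta>" "- g"] assms(3) by (auto simp: top_domain_def)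
  then have "bottom_angle g W k \<theta> = \<theta>'"
    unfolding bottom_angle_def using the_inv_into_f_f[OF qfun_inj[OF assms(1,2), of "- g"], of \<theta>'] by simp
  then show "0 < bottom_angle g W k \<theta>" "bottom_angle g W k \<theta> < pi"
    "qfun (- g) W k (bottom_angle g W k \<theta>) = qfun g W k \<theta>"
    using \<theta>' by auto
qed

lemma top_domain_open:
  shows "open (top_domain g W k)"
proof -
  have "sin \<theta> \<noteq> 0" if "\<theta> \<in> {0<..<pi}" for \<theta>
    using sin_gt_zero[of \<theta>] that by auto
  then have "continuous_on {0<..<pi} (qfun g W k)"
    unfolding qfun_def[abs_def] by (intro continuous_intros continuous_on_pfun) auto
  then have "open ({0<..<pi} \<inter> qfun g W k -` {0<..})"
    by (intro continuous_open_preimage) auto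
  moreover have "{0<..<pi} \<inter> qfun g W k -` {0<..} = top_domain g W k"
    by (auto simp: top_domain_def)
  ultimately show ?thesis
    by simp
qed

lemma top_square_antimono:
  assumes "0 < W" "0 \<le> k" "s \<in> top_domain g W k" "t \<in> top_domain g W k" "s < t"
  shows "(vfun g W k t)\<^sup>2 < (vfun g W k s)\<^sup>2"
  using assms vfun_strict_antimono[OF assms(1,2), of s t g] vfun_pos[OF assms(1,2), of t g]
  by (intro power_strict_mono) (auto simp: top_domain_def)

lemma top_angle_eq:
  assumes "0 < W" "0 \<le> k" "\<theta> \<in> top_domain g W k"
  shows "top_angle g W k ((vfun g W k \<theta>)\<^sup>2) = \<theta>"
  unfolding top_angle_def
  by (rule the_inv_into_f_f[OF strict_antimono_imp_inj_on])
    (use assms top_square_antimono[OF assms(1,2)] in auto)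

lemma bottom_angle_mono:
  assumes "0 < W" "0 \<le> k" "s \<in> top_domain g W k" "t \<in> top_domain g W k" "s < t"
  shows "bottom_angle g W k s < bottom_angle g W k t"
proof (rule ccontr)
  assume n: "\<not> ?thesis"
  note 1 = bottom_angle[OF assms(1-3)] and 2 = bottom_angle[OF assms(1,2,4)]
  have "qfun (- g) W k (bottom_angle g W k s) \<le> qfun (- g) W k (bottom_angle g W k t)"
    using qfun_strict_antimono[OF assms(1,2) 2(1), of "bottom_angle g W k s" "- g"] n 1
    by (cases "bottom_angle g W k s = bottom_angle g W k t") auto
  moreover have "qfun g W k t < qfun g W k s"
    using assms by (intro qfun_strict_antimono) (auto simp: top_domain_def)
  ultimately show False
    using 1 2 by simp
qed

text \<open>The two transits contribute the factors \<open>exp (2 g \<theta>)\<close> and \<open>exp (2 g \<theta>')\<close>. The zone of the center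
  contributes none, since \<open>q\<close> does not change.\<close>

lemma long_left_graph_deriv:
  assumes "0 < W" "0 \<le> k" "\<theta> \<in> top_domain g W k"
  shows "(long_left_graph g W k has_real_derivative exp (2 * g * (\<theta> + bottom_angle g W k \<theta>)))
    (at ((vfun g W k \<theta>)\<^sup>2))"
  unfolding long_left_graph_def[abs_def] top_angle_def
proof (rule DERIV_curve_as_graph[where
      X' = "\<lambda>\<theta>. 2 * vfun g W k \<theta> * (- exp (- g * \<theta>) * qfun g W k \<theta> / sin \<theta>)" and S = "top_domain g W k"])
  let ?S = "top_domain g W k"
  have s: "0 < sin t" "0 < vfun g W k t" "0 < qfun g W k t" if "t \<in> ?S" for t
    using that assms by (auto simp: top_domain_def intro!: sin_gt_zero vfun_pos)
  show "open ?S" by (rule top_domain_open)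
  show "inj_on (\<lambda>\<theta>. (vfun g W k \<theta>)\<^sup>2) ?S"
    using top_square_antimono[OF assms(1,2)] by (intro strict_antimono_imp_inj_on) auto
  show "((\<lambda>\<theta>. (vfun g W k \<theta>)\<^sup>2) has_real_derivative
      2 * vfun g W k t * (- exp (- g * t) * qfun g W k t / sin t)) (at t)" if "t \<in> ?S" for t
    using s[OF that] vfun_deriv[of t g W k] by (auto intro!: derivative_eq_intros)
  show "2 * vfun g W k t * (- exp (- g * t) * qfun g W k t / sin t) \<noteq> 0" if "t \<in> ?S" for t
    using s[OF that] by simp
  define \<theta>' where "\<theta>' = bottom_angle g W k \<theta>"
  let ?B = "\<lambda>q. (vfun (- g) W k (the_inv_into {0<..<pi} (qfun (- g) W k) q))\<^sup>2"
  note \<theta>' = bottom_angle[OF assms, folded \<theta>'_def]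
  have B: "(?B has_real_derivative 2 * qfun g W k \<theta> * exp (2 * g * \<theta>')) (at (qfun (- g) W k \<theta>'))"
  proof (rule DERIV_curve_as_graph[where X' = "\<lambda>t. - exp (- g * t) * vfun (- g) W k t / sin t"])
    have s: "0 < sin t" "0 < vfun (- g) W k t" if "t \<in> {0<..<pi}" for t
      using that assms by (auto intro!: sin_gt_zero vfun_pos)
    show "inj_on (qfun (- g) W k) {0<..<pi}"
      using assms by (intro qfun_inj)
    show "(qfun (- g) W k has_real_derivative - exp (- g * t) * vfun (- g) W k t / sin t) (at t)"
      if "t \<in> {0<..<pi}" for t
      using qfun_deriv[of t "- g" W k] s[OF that] by simp
    show "- exp (- g * t) * vfun (- g) W k t / sin t \<noteq> 0" if "t \<in> {0<..<pi}" for t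
      using s[OF that] by simp
    have "((\<lambda>t. (vfun (- g) W k t)\<^sup>2) has_real_derivative
       2 * vfun (- g) W k \<theta>' * (- exp (g * \<theta>') * qfun (- g) W k \<theta>' / sin \<theta>')) (at \<theta>')"
      using s[of \<theta>'] \<theta>' vfun_deriv[of \<theta>' "- g" W k] by (auto intro!: derivative_eq_intros)
    also have "exp (g * \<theta>') = exp (2 * g * \<theta>') * exp (- g * \<theta>')"
      by (simp flip: exp_add)
    finally show "((\<lambda>t. (vfun (- g) W k t)\<^sup>2) has_real_derivative
       2 * qfun g W k \<theta> * exp (2 * g * \<theta>') * (- exp (- g * \<theta>') * vfun (- g) W k \<theta>' / sin \<theta>')) (at \<theta>')"
      by (simp add: \<theta>'(3) mult_ac)
  qed (use \<theta>' in auto)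
  have "(qfun g W k has_real_derivative - exp (g * \<theta>) * vfun g W k \<theta> / sin \<theta>) (at \<theta>)"
    using s[OF assms(3)] qfun_deriv[of \<theta> g W k] by simp
  from DERIV_chain2[OF B[unfolded \<theta>'(3)] this]
  have "((\<lambda>\<theta>. (vfun (- g) W k (bottom_angle g W k \<theta>))\<^sup>2) has_real_derivative
     2 * qfun g W k \<theta> * exp (2 * g * \<theta>') * (- exp (g * \<theta>) * vfun g W k \<theta> / sin \<theta>)) (at \<theta>)"
    by (simp add: bottom_angle_def)
  also have "2 * qfun g W k \<theta> * exp (2 * g * \<theta>') * (- exp (g * \<theta>) * vfun g W k \<theta> / sin \<theta>) =
    exp (2 * g * (\<theta> + \<theta>')) * (2 * vfun g W k \<theta> * (- exp (- g * \<theta>) * qfun g W k \<theta> / sin \<theta>))"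
  proof -
    have "exp (g * \<theta>) = exp (2 * g * \<theta>) * exp (- g * \<theta>)"
      by (simp flip: exp_add)
    then show ?thesis
      by (simp add: distrib_left exp_add mult_ac)
  qed
  finally show "((\<lambda>\<theta>. (vfun (- g) W k (bottom_angle g W k \<theta>))\<^sup>2) has_real_derivative
    exp (2 * g * (\<theta> + bottom_angle g W k \<theta>)) *
    (2 * vfun g W k \<theta> * (- exp (- g * \<theta>) * qfun g W k \<theta> / sin \<theta>))) (at \<theta>)"
    by (simp add: \<theta>'_def)
qed (use assms in auto)

section \<open>Zeros of concave and almost convex functions\<close>

text \<open>A strictly concave function that is positive near the left end has at most one zero: a second one
  would force slopes that are first negative and then zero.\<close>

lemma unique_zero_strictly_concave:
  fixes D D' :: "real \<Rightarrow> real"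
  assumes D: "\<And>V. a < V \<Longrightarrow> V < b \<Longrightarrow> (D has_real_derivative D' V) (at V)"
    and anti: "\<And>V V'. a < V \<Longrightarrow> V < V' \<Longrightarrow> V' < b \<Longrightarrow> D' V' < D' V"
    and pos: "\<And>V. a < V \<Longrightarrow> V < b \<Longrightarrow> \<exists>V0. a < V0 \<and> V0 < V \<and> 0 < D V0"
    and neg: "a < V1" "V1 < b" "D V1 < 0"
  shows "\<exists>w. a < w \<and> w < b \<and> D w = 0 \<and> (\<forall>V. a < V \<and> V < b \<and> D V = 0 \<longrightarrow> V = w)"
proof -
  have uniq: False if "a < V" "V < V'" "V' < b" "D V = 0" "D V' = 0" for V V'
  proof -
    obtain V0 where V0: "a < V0" "V0 < V" "0 < D V0"
      using pos[of V] \<open>a < V\<close> \<open>V < V'\<close> \<open>V' < b\<close> by auto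
    obtain x where x: "V0 < x" "x < V" "D V - D V0 = (V - V0) * D' x"
    proof -
      have "(D has_real_derivative D' r) (at r)" if "V0 \<le> r" "r \<le> V" for r
        by (rule D) (use that V0 \<open>V < V'\<close> \<open>V' < b\<close> in linarith)+
      from MVT2[OF V0(2) this] show thesis
        using that by auto
    qed
    obtain y where y: "V < y" "y < V'" "D V' - D V = (V' - V) * D' y"
    proof -
      have "(D has_real_derivative D' r) (at r)" if "V \<le> r" "r \<le> V'" for r
        by (rule D) (use that \<open>a < V\<close> \<open>V' < b\<close> in linarith)+
      from MVT2[OF \<open>V < V'\<close> this] show thesis
        using that by auto
    qed
    have "(V - V0) * D' x < 0"
      using x(3) V0(3) \<open>D V = 0\<close> by simp
    then have "D' x < 0"
      using V0(2) by (simp add: mult_less_0_iff)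
    moreover have "D' y = 0"
      using y that by simp
    moreover have "D' y < D' x"
      using anti[of x y] x y V0 that by linarith
    ultimately show False
      by simp
  qed
  obtain V0 where V0: "a < V0" "V0 < V1" "0 < D V0"
    using pos[OF neg(1,2)] by blast
  have "continuous_on {V0..V1} D"
  proof (rule DERIV_continuous_on)
    fix x assume "x \<in> {V0..V1}"
    then show "(D has_real_derivative D' x) (at x within {V0..V1})"
      using D[of x] V0 neg by (auto intro: DERIV_subset)
  qed
  then obtain w where w: "V0 \<le> w" "w \<le> V1" "D w = 0"
    using IVT2'[of D V1 0 V0] V0 neg by auto
  then have ab: "a < w" "w < b"
    using V0 neg by auto
  have "V = w" if "a < V \<and> V < b \<and> D V = 0" for V
    using uniq[of V w] uniq[of w V] that w ab by (cases V w rule: linorder_cases) auto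
  then show ?thesis
    using ab w by blast
qed

text \<open>If \<open>j\<close> were constant, \<open>D\<close> would be convex and negative at \<open>a\<close>, so it would have at most one zero. The
  condition on \<open>j1 - j0\<close> says that the deviation from convexity is too small, compared with the
  initial value \<open>- e\<close>, to allow another one.\<close>

lemma unique_zero_almost_convex:
  fixes D i j :: "real \<Rightarrow> real"
  assumes "a < b"
    and D: "\<And>V. a \<le> V \<Longrightarrow> V \<le> b \<Longrightarrow> (D has_real_derivative i V - j V) (at V)"
    and i: "\<And>V V'. a \<le> V \<Longrightarrow> V < V' \<Longrightarrow> V' \<le> b \<Longrightarrow> i V \<le> i V'"
    and j: "\<And>V. a \<le> V \<Longrightarrow> V \<le> b \<Longrightarrow> j0 \<le> j V \<and> j V \<le> j1"
    and neg: "D a \<le> - e" "0 < e" and pos: "0 < D b" and small: "(j1 - j0) * (b - a) < e"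
  shows "\<exists>w. a < w \<and> w < b \<and> D w = 0 \<and> (\<forall>V. a < V \<and> V < b \<and> D V = 0 \<longrightarrow> V = w)"
proof -
  have uniq: False if "a < V" "V < V'" "V' < b" "D V = 0" "D V' = 0" for V V'
  proof -
    obtain x where x: "a < x" "x < V" "D V - D a = (V - a) * (i x - j x)"
    proof -
      have "(D has_real_derivative i r - j r) (at r)" if "a \<le> r" "r \<le> V" for r
        by (rule D) (use that \<open>V < V'\<close> \<open>V' < b\<close> in linarith)+
      from MVT2[OF \<open>a < V\<close> this] show thesis
        using that by auto
    qed
    obtain y where y: "V < y" "y < V'" "D V' - D V = (V' - V) * (i y - j y)"
    proof -
      have "(D has_real_derivative i r - j r) (at r)" if "V \<le> r" "r \<le> V'" for r
        by (rule D) (use that \<open>a < V\<close> \<open>V' < b\<close> in linarith)+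
      from MVT2[OF \<open>V < V'\<close> this] show thesis
        using that by auto
    qed
    have "i y = j y"
      using y that by simp
    moreover have "i x \<le> i y"
      using i[of x y] x y that by simp
    ultimately have "i x - j x \<le> j1 - j0"
      using j[of y] j[of x] x y that by simp
    then have "(V - a) * (i x - j x) \<le> (V - a) * (j1 - j0)"
      using that by (intro mult_left_mono) auto
    also have "\<dots> \<le> (b - a) * (j1 - j0)"
      using that j[of a] by (intro mult_right_mono) auto
    also have "\<dots> < e"
      using small by (simp add: mult.commute)
    finally show False
      using x(3) neg that by simp
  qed
  have "continuous_on {a..b} D"
  proof (rule DERIV_continuous_on)
    fix x assume "x \<in> {a..b}"
    then show "(D has_real_derivative (i x - j x)) (at x within {a..b})"
      using D[of x] by (auto intro: DERIV_subset)
  qed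
  then obtain w where w: "a \<le> w" "w \<le> b" "D w = 0"
    using IVT'[of D a 0 b] neg pos assms(1) by auto
  then have ab: "a < w" "w < b"
    using neg pos by (auto simp: less_le)
  have "V = w" if "a < V \<and> V < b \<and> D V = 0" for V
    using uniq[of V w] uniq[of w V] that w ab by (cases V w rule: linorder_cases) auto
  then show ?thesis
    using ab w by blast
qed

section \<open>Limit cycles from crossings of the graphs\<close>

text \<open>The function \<open>lam\<close> describes the passage through \<open>x < 0\<close> in squared heights. Composing it with the
  passage through \<open>x > 0\<close>, whose inverse is \<open>right_graph\<close>, gives the return map, so that the fixed points
  of the return map are the crossings of \<open>lam\<close> and \<open>right_graph\<close>.\<close>

lemma limit_cycle_from_crossing:
  fixes lam :: "real \<Rightarrow> real" and To g b Dm Do w k :: real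
  defines "G \<equiv> lienard_field To (2 * g * b) Dm Do (b\<^sup>2 * (1 + g\<^sup>2)) w (b * (1 + g\<^sup>2) * k)"
  assumes par: "0 < g" "0 < b" "0 < k" "0 < w" "0 < Dm" "0 < Do"
    and lo: "0 \<le> lo" "0 < hi" "tangency_value g k \<le> lo\<^sup>2"
    and left: "\<And>v. lo < v \<Longrightarrow> v < hi \<Longrightarrow> 0 < lam (v\<^sup>2) \<and>
        orbit_arc G {z. z $ 1 < 0} (pt 0 v) (pt 0 (- sqrt (lam (v\<^sup>2))))"
    and mono: "\<And>v v'. lo < v \<Longrightarrow> v < v' \<Longrightarrow> v' < hi \<Longrightarrow> lam (v\<^sup>2) \<le> lam (v'\<^sup>2)"
    and V: "lo\<^sup>2 < V" "V < hi\<^sup>2" "lam V = right_graph g k V"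
    and uniq: "\<And>V'. lo\<^sup>2 < V' \<Longrightarrow> V' < hi\<^sup>2 \<Longrightarrow> lam V' = right_graph g k V' \<Longrightarrow> V' = V"
  shows "\<exists>\<Gamma>. limit_cycle G \<Gamma> \<and> (\<forall>v\<ge>0. pt 0 v \<in> \<Gamma> \<longleftrightarrow> v = sqrt V)"
proof -
  note ta = tangency_angle[OF par(1)]
  have pos: "0 < 1 + g\<^sup>2"
    by (simp add: add_pos_nonneg)
  define ang where "ang = (\<lambda>u. SOME \<theta>. pi < \<theta> \<and> \<theta> < tangency_angle g \<and> k * pfun g \<theta> = - u)"
  define R where "R = (\<lambda>u. - (k * pfun (- g) (ang u)))"
  have ang: "pi < ang u \<and> ang u < tangency_angle g \<and> k * pfun g (ang u) = - u" if "0 < u" for u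
  proof -
    have "- u / k < pfun g (tangency_angle g)"
      using that par ta by simp
    then obtain \<theta> where "pi < \<theta>" "\<theta> < tangency_angle g" "pfun g \<theta> = - u / k"
      using pfun_onto_right[OF ta(1,2)] by blast
    then have "\<exists>\<theta>. pi < \<theta> \<and> \<theta> < tangency_angle g \<and> k * pfun g \<theta> = - u"
      using par by (intro exI[of _ \<theta>]) auto
    then show ?thesis
      unfolding ang_def by (rule someI_ex)
  qed
  have ang_anti: "ang u' \<le> ang u" if "0 < u" "u \<le> u'" for u u'
  proof (rule ccontr)
    assume "\<not> ?thesis"
    then have "pfun g (ang u) < pfun g (ang u')"
      using ang[OF that(1)] ang[of u'] that ta par by (intro pfun_strict_mono_right) auto
    then have "k * pfun g (ang u) < k * pfun g (ang u')"
      using par by simp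
    then show False
      using ang[OF that(1)] ang[of u'] that by simp
  qed
  have R_mono: "R u \<le> R u'" if "0 < u" "u \<le> u'" for u u'
  proof (cases "ang u' = ang u")
    case False
    then have "pfun (- g) (ang u') < pfun (- g) (ang u)"
      using ang[OF that(1)] ang[of u'] that ang_anti[OF that]
      by (intro pfun_uminus_strict_mono_right par) auto
    then show ?thesis
      using par by (simp add: R_def)
  qed (simp add: R_def)
  have R_pos: "0 < R u" if "0 < u" for u
    using ang[OF that] pfun_neg[OF par(1), of "ang u"] ta par by (simp add: R_def mult_pos_neg)
  have arcs: "orbit_arc G {z. z $ 1 > 0} (pt 0 (- u)) (pt 0 (R u))" if "0 < u" for u
    using right_arc[OF par(2,4,1,3), of "ang u" To Dm Do] ang[OF that] ta
      pfun_neg_before_tangency[OF par(1), of "ang u"]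
    unfolding G_def R_def by auto
  have R_graph: "right_graph g k ((R u)\<^sup>2) = u\<^sup>2" "tangency_value g k < (R u)\<^sup>2" if "0 < u" for u
  proof -
    note a = ang[OF that]
    show "right_graph g k ((R u)\<^sup>2) = u\<^sup>2"
      using right_angle_eq[OF par(1,3), of "ang u"] a by (simp add: right_graph_def R_def)
    show "tangency_value g k < (R u)\<^sup>2"
      using right_square_antimono[OF par(1,3), of "ang u" "tangency_angle g"] a
      by (simp add: tangency_value_def R_def)
  qed
  define Q where "Q = (\<lambda>v. R (sqrt (lam (v\<^sup>2))))"
  define v0 where "v0 = sqrt V"
  have V0: "0 < V"
    using V(1) zero_le_power2[of lo] by linarith
  have v0: "lo < v0" "v0 < hi" "v0\<^sup>2 = V"
    using V V0 lo real_less_rsqrt[of lo V] real_less_lsqrt[of hi V] by (auto simp: v0_def)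
  have Qv0: "Q v0 = v0"
  proof -
    have tv: "tangency_value g k < V"
      using V(1) lo by linarith
    define \<theta> where "\<theta> = right_angle g k V"
    note \<theta> = right_graph(1-3)[OF par(1,3) tv, folded \<theta>_def]
    have n: "k * pfun g \<theta> < 0" "k * pfun (- g) \<theta> < 0"
      using \<theta> ta par pfun_neg_before_tangency[of g \<theta>] pfun_neg[of g \<theta>] by (auto simp: mult_pos_neg)
    define u where "u = sqrt (lam V)"
    have "lam V = (k * pfun g \<theta>)\<^sup>2"
      using V(3) by (simp add: right_graph_def \<theta>_def)
    then have u: "u = - (k * pfun g \<theta>)"
      using n by (simp add: u_def)
    then have u0: "0 < u"
      using n by simp
    have "ang u = \<theta>"
    proof (rule ccontr)
      assume ne: "ang u \<noteq> \<theta>"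
      have "pfun g (ang u) \<noteq> pfun g \<theta>"
        using ang[OF u0] \<theta> ta ne pfun_strict_mono_right[OF par(1), of "ang u" \<theta>]
          pfun_strict_mono_right[OF par(1), of \<theta> "ang u"]
        by (cases "ang u" \<theta> rule: linorder_cases) auto
      then show False
        using ang[OF u0] u par by simp
    qed
    then have "Q v0 = - (k * pfun (- g) \<theta>)"
      by (simp add: Q_def R_def v0 flip: u_def)
    also have "\<dots> = sqrt V"
      using n unfolding \<theta>(3)[symmetric] by simp
    finally show ?thesis
      by (simp add: v0_def)
  qed
  obtain L where L: "L-lipschitz_on UNIV G"
    using lienard_field_lipschitz unfolding G_def by blast
  have "\<exists>\<Gamma>. limit_cycle G \<Gamma> \<and> (\<forall>v\<ge>0. pt 0 v \<in> \<Gamma> \<longleftrightarrow> v = v0)"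
  proof (rule limit_cycle_of_return_map[OF L lo(1), where Q = Q and hi = hi])
    fix v assume v: "lo < v" "v < hi"
    define u where "u = sqrt (lam (v\<^sup>2))"
    have u: "0 < u" "orbit_arc G {z. z $ 1 < 0} (pt 0 v) (pt 0 (- u))"
      using left[OF v] by (auto simp: u_def)
    then show "0 \<le> Q v \<and> (\<exists>u>0. orbit_arc G {z. z $ 1 < 0} (pt 0 v) (pt 0 (- u)) \<and>
       orbit_arc G {z. 0 < z $ 1} (pt 0 (- u)) (pt 0 (Q v)))"
      using arcs[OF u(1)] R_pos[OF u(1)] unfolding Q_def u_def[symmetric] by (auto intro: less_imp_le)
    show "v = v0" if "Q v = v"
    proof -
      have Ru: "R u = v"
        using that by (simp add: Q_def u_def)
      have "lo\<^sup>2 < v\<^sup>2" "v\<^sup>2 < hi\<^sup>2"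
        using v lo by (auto intro!: power_strict_mono)
      moreover have "right_graph g k (v\<^sup>2) = lam (v\<^sup>2)"
        using R_graph(1)[OF u(1)] left[OF v] unfolding Ru by (simp add: u_def)
      ultimately have "v\<^sup>2 = V"
        using uniq[of "v\<^sup>2"] by simp
      then show ?thesis
        using v lo by (simp add: v0_def real_sqrt_unique)
    qed
  next
    fix v v' assume v: "lo < v" "v \<le> v'" "v' < hi"
    then have "lam (v\<^sup>2) \<le> lam (v'\<^sup>2)"
      using mono[of v v'] by (cases "v = v'") auto
    then show "Q v \<le> Q v'"
      using left[of v] v unfolding Q_def by (intro R_mono) auto
  next
    show "\<exists>v\<ge>0. pt 0 v \<in> \<Gamma>" if "periodic_orbit G \<Gamma>" for \<Gamma>
      by (rule periodic_orbit_crosses_section[OF _ _ _ _ _ _ that[unfolded G_def]]) (use par pos in auto)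
  qed (use v0 Qv0 in auto)
  then show ?thesis
    by (simp add: v0_def)
qed

text \<open>At the tangency value the passage through \<open>R\<^sub>+\<close> starts at height zero, so \<open>r\<close> vanishes there and
  \<open>l - r\<close> is positive. At \<open>V1\<close> the angle of the passage through \<open>R\<^sub>+\<close> is less than \<open>c\<close>, and that of the
  passage through \<open>R\<^sub>o\<close> is greater than \<open>d\<close>. The last hypothesis turns these bounds into \<open>l < r\<close> at \<open>V1\<close>.\<close>

lemma small_limit_cycle:
  fixes a go gp bo bp w Dm :: real
  defines "G \<equiv> lienard_field (2 * go * bo) (2 * gp * bp) Dm (bo\<^sup>2 * (1 + go\<^sup>2)) (bp\<^sup>2 * (1 + gp\<^sup>2)) w a"
  assumes par: "go < 0" "0 < gp" "0 < bo" "0 < bp" "0 < w" "0 < Dm" "0 < ko" "0 < kp"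
    and a: "a = bo * (1 + go\<^sup>2) * ko" "a = bp * (1 + gp\<^sup>2) * kp"
    and c: "pi < c" "c < tangency_angle gp" "0 < d" "d < pi"
    and V1: "V1 < (bo * w)\<^sup>2" "(kp * pfun (- gp) c)\<^sup>2 < V1" "(ko * pfun go d)\<^sup>2 < V1"
    and less: "(ko * pfun (- go) d)\<^sup>2 + exp (2 * go * d) * V1 <
      exp (- 2 * gp * c) * (V1 - (kp * pfun (- gp) c)\<^sup>2)"
  shows "\<exists>\<Gamma> v. limit_cycle G \<Gamma> \<and> 0 \<le> v \<and> v < bo * w \<and> (\<forall>v'\<ge>0. pt 0 v' \<in> \<Gamma> \<longleftrightarrow> v' = v)"
proof -
  note ta = tangency_angle[OF par(2)]
  define A where "A = tangency_value gp kp"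
  let ?l = "short_left_graph go ko" and ?r = "right_graph gp kp"
  have pos: "0 < 1 + go\<^sup>2" "0 < 1 + gp\<^sup>2"
    by (simp_all add: add_pos_nonneg)
  have A0: "0 < A"
    using pfun_neg[OF par(2) ta(1,2)] par by (simp add: A_def tangency_value_def)
  have AV: "A < V1"
    using right_square_antimono[OF par(2,8) c(1,2) order_refl] V1(2) by (simp add: A_def tangency_value_def)
  have "\<exists>V. A < V \<and> V < (bo * w)\<^sup>2 \<and> ?l V - ?r V = 0 \<and>
    (\<forall>V'. A < V' \<and> V' < (bo * w)\<^sup>2 \<and> ?l V' - ?r V' = 0 \<longrightarrow> V' = V)"
  proof (rule unique_zero_strictly_concave[where
        D' = "\<lambda>V. exp (2 * go * left_angle go ko V) - exp (- 2 * gp * right_angle gp kp V)"])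
    fix V assume V: "A < V" "V < (bo * w)\<^sup>2"
    show "((\<lambda>V. ?l V - ?r V) has_real_derivative
        exp (2 * go * left_angle go ko V) - exp (- 2 * gp * right_angle gp kp V)) (at V)"
      using V A0 short_left_graph(4)[OF par(7), of V go] right_graph(4)[OF par(2,8), of V]
      by (intro DERIV_diff) (auto simp: A_def)
    show "\<exists>V0. A < V0 \<and> V0 < V \<and> 0 < ?l V0 - ?r V0"
    proof -
      have lA: "0 < ?l A"
        using short_left_graph(5)[OF par(7) A0] .
      have "isCont (\<lambda>\<theta>. (kp * pfun gp \<theta>)\<^sup>2) (tangency_angle gp)"
        using pfun_deriv[of "tangency_angle gp" gp] sin_neg_right[OF ta(1,2)]
        by (intro continuous_intros) (auto intro: DERIV_isCont)
      then have "((\<lambda>\<theta>. (kp * pfun gp \<theta>)\<^sup>2) \<longlongrightarrow> 0) (at_left (tangency_angle gp))"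
        using ta by (simp add: isCont_def filterlim_at_split)
      then have "\<forall>\<^sub>F \<theta> in at_left (tangency_angle gp). (kp * pfun gp \<theta>)\<^sup>2 < ?l A"
        using lA by (rule order_tendstoD)
      moreover have "right_angle gp kp V < tangency_angle gp"
        using right_graph(2)[OF par(2,8)] V by (simp add: A_def)
      then have "\<forall>\<^sub>F \<theta> in at_left (tangency_angle gp). \<theta> \<in> {right_angle gp kp V<..<tangency_angle gp}"
        by (rule eventually_at_left_real)
      ultimately have "\<forall>\<^sub>F \<theta> in at_left (tangency_angle gp). (kp * pfun gp \<theta>)\<^sup>2 < ?l A \<and>
          \<theta> \<in> {right_angle gp kp V<..<tangency_angle gp}"
        by eventually_elim auto
      then obtain \<theta> where \<theta>: "(kp * pfun gp \<theta>)\<^sup>2 < ?l A" "right_angle gp kp V < \<theta>" "\<theta> < tangency_angle gp"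
        using eventually_happens'[of "at_left (tangency_angle gp)"] by force
      have \<theta>pi: "pi < \<theta>"
        using right_graph(1)[OF par(2,8), of V] V \<theta> by (simp add: A_def)
      define V0 where "V0 = (kp * pfun (- gp) \<theta>)\<^sup>2"
      have "A < V0"
        using right_square_antimono[OF par(2,8) \<theta>pi \<theta>(3) order_refl] by (simp add: A_def V0_def tangency_value_def)
      moreover have "V0 < V"
        using right_square_antimono[OF par(2,8) _ \<theta>(2) less_imp_le[OF \<theta>(3)]] right_graph[OF par(2,8), of V] V
        by (simp add: V0_def A_def)
      moreover have "?r V0 < ?l A"
        using \<theta> right_angle_eq[OF par(2,8) \<theta>pi \<theta>(3)] by (simp add: V0_def right_graph_def)
      moreover have "?l A < ?l V0"
        using short_left_graph_mono[OF par(7) A0 \<open>A < V0\<close>] .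
      ultimately show ?thesis
        by (intro exI[of _ V0]) auto
    qed
  next
    fix V V' assume V: "A < V" "V < V'" "V' < (bo * w)\<^sup>2"
    have "go * left_angle go ko V' < go * left_angle go ko V"
      using left_angle_mono[OF par(7) _ V(2), of go] A0 V par by simp
    moreover have "gp * right_angle gp kp V' < gp * right_angle gp kp V"
      using right_angle_antimono[OF par(2,8) _ V(2)] V par by (simp add: A_def)
    ultimately show "exp (2 * go * left_angle go ko V') - exp (- 2 * gp * right_angle gp kp V') <
        exp (2 * go * left_angle go ko V) - exp (- 2 * gp * right_angle gp kp V)"
      by (intro diff_strict_mono) auto
  next
    show "?l V1 - ?r V1 < 0"
      using short_left_graph_upper[OF par(1,7) c(3,4) V1(3)] right_graph_lower[OF par(2,8) c(1,2) V1(2)] less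
      by linarith
  qed (use AV V1 in auto)
  then obtain V where V: "A < V" "V < (bo * w)\<^sup>2" "?l V = ?r V"
    "\<And>V'. A < V' \<Longrightarrow> V' < (bo * w)\<^sup>2 \<Longrightarrow> ?l V' = ?r V' \<Longrightarrow> V' = V"
    by (metis (no_types, lifting) right_minus_eq)
  have s: "(sqrt A)\<^sup>2 = A"
    using A0 by simp
  have cyc: "\<exists>\<Gamma>. limit_cycle G \<Gamma> \<and> (\<forall>v\<ge>0. pt 0 v \<in> \<Gamma> \<longleftrightarrow> v = sqrt V)"
    unfolding G_def a(2)
  proof (rule limit_cycle_from_crossing[where lo = "sqrt A" and hi = "bo * w" and lam = ?l and V = V])
    fix v assume v: "sqrt A < v" "v < bo * w"
    have v0: "0 < v"
      using v A0 real_sqrt_gt_zero[OF A0] by linarith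
    let ?\<theta> = "left_angle go ko (v\<^sup>2)"
    note l = short_left_graph[OF par(7), of "v\<^sup>2" go]
    have "0 < ko * pfun (- go) ?\<theta>"
      using l(1,2) v0 par pfun_pos[of ?\<theta> "- go"] by simp
    then have sq: "sqrt (?l (v\<^sup>2)) = ko * pfun (- go) ?\<theta>"
      by (simp add: short_left_graph_def)
    show "0 < ?l (v\<^sup>2) \<and> orbit_arc (lienard_field (2 * go * bo) (2 * gp * bp) Dm (bo\<^sup>2 * (1 + go\<^sup>2))
         (bp\<^sup>2 * (1 + gp\<^sup>2)) w (bp * (1 + gp\<^sup>2) * kp)) {z. z $ 1 < 0} (pt 0 v) (pt 0 (- sqrt (?l (v\<^sup>2))))"
      unfolding sq a(2)[symmetric] a(1)
      using short_left_arc[OF par(3,5,1,7), of ?\<theta> "2 * gp * bp" Dm] l v0 v by simp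
  next
    fix v v' assume v: "sqrt A < v" "v < v'" "v' < bo * w"
    have v0: "0 < v"
      using v A0 real_sqrt_gt_zero[OF A0] by linarith
    have "v\<^sup>2 < v'\<^sup>2"
      using v v0 by (intro power_strict_mono) auto
    then show "?l (v\<^sup>2) \<le> ?l (v'\<^sup>2)"
      using short_left_graph_mono[OF par(7), of "v\<^sup>2" "v'\<^sup>2" go] v0 by simp
  next
    show "(sqrt A)\<^sup>2 < V" "V < (bo * w)\<^sup>2" "?l V = ?r V" "0 \<le> sqrt A"
      using V(1-3) A0 s by simp_all
    show "tangency_value gp kp \<le> (sqrt A)\<^sup>2"
      unfolding s by (simp add: A_def)
    show "V' = V" if "(sqrt A)\<^sup>2 < V'" "V' < (bo * w)\<^sup>2" "?l V' = ?r V'" for V'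
      using V(4)[of V'] that s by simp
  qed (use par pos in simp_all)
  have w1: "sqrt V < bo * w"
    using V(1,2) A0 par by (intro real_less_lsqrt) simp_all
  have w2: "0 \<le> sqrt V"
    using V(1) A0 by simp
  show ?thesis
    using cyc w1 w2 by blast
qed

text \<open>The angles \<open>s\<close> and \<open>s'\<close> of the first transit mark the lower and the upper end of the range of heights. The
  angles \<open>t\<close> and \<open>t'\<close> belong to second transits of other orbits, which bound \<open>l\<close> at the ends by
  monotonicity. This keeps all hypotheses explicit in \<open>ko\<close> and \<open>kp\<close>, so that they hold for small \<open>ko\<close>
  and \<open>kp\<close> if they hold strictly in the limit.\<close>

lemma big_limit_cycle:
  fixes a go gp bo bp w Dm :: real
  defines "G \<equiv> lienard_field (2 * go * bo) (2 * gp * bp) Dm (bo\<^sup>2 * (1 + go\<^sup>2)) (bp\<^sup>2 * (1 + gp\<^sup>2)) w a"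
    and "W \<equiv> bo * w"
  assumes par: "go < 0" "0 < gp" "0 < bo" "0 < bp" "0 < w" "0 < Dm" "0 < ko" "0 < kp"
    and a: "a = bo * (1 + go\<^sup>2) * ko" "a = bp * (1 + gp\<^sup>2) * kp"
    and c: "pi < c" "c < tangency_angle gp"
    and s: "0 < s'" "s' < s" "s < pi" "0 < qfun go W ko s"
    and t: "0 < t" "t < pi" "qfun go W ko s \<le> qfun (- go) W ko t"
    and t': "0 < t'" "t' < pi" "0 < qfun (- go) W ko t'" "qfun (- go) W ko t' \<le> qfun go W ko s'"
    and V: "(kp * pfun (- gp) c)\<^sup>2 < (vfun go W ko s)\<^sup>2" "0 < e"
      "(vfun (- go) W ko t)\<^sup>2 \<le> exp (- 2 * gp * c) * ((vfun go W ko s)\<^sup>2 - (kp * pfun (- gp) c)\<^sup>2) - e"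
      "exp (- 2 * pi * gp) * (vfun go W ko s')\<^sup>2 \<le> (vfun (- go) W ko t')\<^sup>2"
      "(exp (- 2 * pi * gp) - exp (- 2 * gp * c)) * ((vfun go W ko s')\<^sup>2 - (vfun go W ko s)\<^sup>2) < e"
  shows "\<exists>\<Gamma> v. limit_cycle G \<Gamma> \<and> 0 \<le> v \<and> bo * w < v \<and> (\<forall>v'\<ge>0. pt 0 v' \<in> \<Gamma> \<longleftrightarrow> v' = v)"
proof -
  let ?l = "long_left_graph go W ko" and ?r = "right_graph gp kp" and ?T = "top_domain go W ko"
  let ?v = "vfun go W ko" and ?u = "vfun (- go) W ko" and ?\<beta> = "bottom_angle go W ko"
  define A where "A = tangency_value gp kp"
  have W: "0 < W"
    using par by (simp add: W_def)
  note Wk = W less_imp_le[OF par(7)]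
  have pos: "0 < 1 + go\<^sup>2" "0 < 1 + gp\<^sup>2"
    by (simp_all add: add_pos_nonneg)
  have T: "\<theta> \<in> ?T" if "s' \<le> \<theta>" "\<theta> \<le> s" for \<theta>
  proof -
    have "qfun go W ko s \<le> qfun go W ko \<theta>"
      using qfun_strict_antimono[OF Wk, of \<theta> s go] that s by (cases "\<theta> = s") auto
    then show ?thesis
      using s that by (auto simp: top_domain_def)
  qed
  have AC: "A < (kp * pfun (- gp) c)\<^sup>2"
    using right_square_antimono[OF par(2,8) c order_refl] by (simp add: A_def tangency_value_def)
  have vs: "0 < ?v s" "0 < ?v s'" "?v s < ?v s'"
    using s vfun_pos[OF Wk, of s go] vfun_pos[OF Wk, of s' go] vfun_strict_antimono[OF Wk s(1-4)] by auto
  have onto: "\<exists>\<theta>. s' \<le> \<theta> \<and> \<theta> \<le> s \<and> r = (?v \<theta>)\<^sup>2" if r: "(?v s)\<^sup>2 \<le> r" "r \<le> (?v s')\<^sup>2" for r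
  proof -
    have "sin \<theta> \<noteq> 0" if "\<theta> \<in> {s'..s}" for \<theta>
      using sin_gt_zero[of \<theta>] that s by auto
    then have "continuous_on {s'..s} (\<lambda>\<theta>. (?v \<theta>)\<^sup>2)"
      unfolding vfun_def[abs_def] by (intro continuous_intros continuous_on_pfun) auto
    then show ?thesis
      using IVT2'[of "\<lambda>\<theta>. (?v \<theta>)\<^sup>2" s r s'] r s by auto
  qed
  note ang = top_angle_eq[OF Wk T]
  have "\<exists>V. (?v s)\<^sup>2 < V \<and> V < (?v s')\<^sup>2 \<and> ?l V - ?r V = 0 \<and>
    (\<forall>V'. (?v s)\<^sup>2 < V' \<and> V' < (?v s')\<^sup>2 \<and> ?l V' - ?r V' = 0 \<longrightarrow> V' = V)"
  proof (rule unique_zero_almost_convex[where e = e and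
        i = "\<lambda>V. exp (2 * go * (top_angle go W ko V + ?\<beta> (top_angle go W ko V)))" and
        j = "\<lambda>V. exp (- 2 * gp * right_angle gp kp V)" and
        ?j0.0 = "exp (- 2 * gp * c)" and ?j1.0 = "exp (- 2 * pi * gp)"])
    show "(?v s)\<^sup>2 < (?v s')\<^sup>2"
      using vs by (intro power_strict_mono) auto
    fix r assume r: "(?v s)\<^sup>2 \<le> r" "r \<le> (?v s')\<^sup>2"
    then obtain \<theta> where \<theta>: "s' \<le> \<theta>" "\<theta> \<le> s" "r = (?v \<theta>)\<^sup>2"
      using onto by blast
    have Ar: "A < r"
      using AC V(1) r by linarith
    have "(?l has_real_derivative exp (2 * go * (top_angle go W ko r + ?\<beta> (top_angle go W ko r)))) (at r)"
      unfolding \<theta>(3) ang[OF \<theta>(1,2)] using long_left_graph_deriv[OF Wk T[OF \<theta>(1,2)]] .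
    moreover have "(?r has_real_derivative exp (- 2 * gp * right_angle gp kp r)) (at r)"
      using right_graph(4)[OF par(2,8)] Ar by (simp add: A_def)
    ultimately show "((\<lambda>V. ?l V - ?r V) has_real_derivative
       exp (2 * go * (top_angle go W ko r + ?\<beta> (top_angle go W ko r))) -
       exp (- 2 * gp * right_angle gp kp r)) (at r)"
      by (rule DERIV_diff)
    have "pi < right_angle gp kp r"
      using right_graph(1)[OF par(2,8)] Ar by (simp add: A_def)
    moreover have "right_angle gp kp r < c"
      using right_angle_antimono[OF par(2,8), of "(kp * pfun (- gp) c)\<^sup>2" r] right_angle_eq[OF par(2,8) c]
        AC V(1) r by (simp add: A_def)
    ultimately show "exp (- 2 * gp * c) \<le> exp (- 2 * gp * right_angle gp kp r) \<and>
        exp (- 2 * gp * right_angle gp kp r) \<le> exp (- 2 * pi * gp)"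
      using par(2) by (simp add: mult.commute[of pi])
  next
    fix r r' assume r: "(?v s)\<^sup>2 \<le> r" "r < r'" "r' \<le> (?v s')\<^sup>2"
    obtain \<theta> where \<theta>: "s' \<le> \<theta>" "\<theta> \<le> s" "r = (?v \<theta>)\<^sup>2"
      using onto[of r] r by auto
    obtain \<theta>' where \<theta>': "s' \<le> \<theta>'" "\<theta>' \<le> s" "r' = (?v \<theta>')\<^sup>2"
      using onto[of r'] r by auto
    have "\<theta>' < \<theta>"
    proof (rule ccontr)
      assume "\<not> ?thesis"
      then have "(?v \<theta>')\<^sup>2 \<le> (?v \<theta>)\<^sup>2"
        using top_square_antimono[OF Wk T[OF \<theta>(1,2)] T[OF \<theta>'(1,2)]] by (cases "\<theta> = \<theta>'") auto
      then show False
        using r \<theta> \<theta>' by simp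
    qed
    then have "\<theta>' + ?\<beta> \<theta>' \<le> \<theta> + ?\<beta> \<theta>"
      using bottom_angle_mono[OF Wk T[OF \<theta>'(1,2)] T[OF \<theta>(1,2)]] by simp
    then have "go * (\<theta> + ?\<beta> \<theta>) \<le> go * (\<theta>' + ?\<beta> \<theta>')"
      using par(1) by (intro mult_left_mono_neg) auto
    then show "exp (2 * go * (top_angle go W ko r + ?\<beta> (top_angle go W ko r))) \<le>
      exp (2 * go * (top_angle go W ko r' + ?\<beta> (top_angle go W ko r')))"
      unfolding \<theta>(3) \<theta>'(3) ang[OF \<theta>(1,2)] ang[OF \<theta>'(1,2)] by simp
  next
    have sT: "s \<in> ?T"
      using T[of s] s by simp
    note \<beta> = bottom_angle[OF Wk sT]
    have "t \<le> ?\<beta> s"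
    proof (rule ccontr)
      assume "\<not> ?thesis"
      then have "qfun (- go) W ko t < qfun (- go) W ko (?\<beta> s)"
        using \<beta> t by (intro qfun_strict_antimono[OF Wk]) auto
      then show False
        using \<beta> t by simp
    qed
    then have "?u (?\<beta> s) \<le> ?u t"
      using vfun_strict_antimono[OF Wk t(1), of "?\<beta> s" "- go"] \<beta> s(4) by (cases "t = ?\<beta> s") auto
    then have "?l ((?v s)\<^sup>2) \<le> (?u t)\<^sup>2"
      using vfun_pos[OF Wk \<beta>(1,2), of "- go"] top_angle_eq[OF Wk sT]
      by (auto simp: long_left_graph_def intro!: power_mono)
    moreover have "exp (- 2 * gp * c) * ((?v s)\<^sup>2 - (kp * pfun (- gp) c)\<^sup>2) \<le> ?r ((?v s)\<^sup>2)"
      using right_graph_lower[OF par(2,8) c V(1)] .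
    ultimately show "?l ((?v s)\<^sup>2) - ?r ((?v s)\<^sup>2) \<le> - e"
      using V(3) by linarith
  next
    have sT: "s' \<in> ?T"
      using T[of s'] s by simp
    note \<beta> = bottom_angle[OF Wk sT]
    have "?\<beta> s' \<le> t'"
    proof (rule ccontr)
      assume "\<not> ?thesis"
      then have "qfun (- go) W ko (?\<beta> s') < qfun (- go) W ko t'"
        using \<beta> t' by (intro qfun_strict_antimono[OF Wk]) auto
      then show False
        using \<beta> t' by simp
    qed
    then have "?u t' \<le> ?u (?\<beta> s')"
      using vfun_strict_antimono[OF Wk \<beta>(1), of t' "- go"] t' by (cases "?\<beta> s' = t'") auto
    then have "(?u t')\<^sup>2 \<le> ?l ((?v s')\<^sup>2)"
      using vfun_pos[OF Wk t'(1,2), of "- go"] top_angle_eq[OF Wk sT]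
      by (auto simp: long_left_graph_def intro!: power_mono)
    moreover have "A < (?v s')\<^sup>2"
      using AC V(1) power_strict_mono[OF vs(3), of 2] vs by simp
    then have "?r ((?v s')\<^sup>2) < exp (- 2 * pi * gp) * (?v s')\<^sup>2"
      by (intro right_graph_upper par) (simp add: A_def)
    ultimately show "0 < ?l ((?v s')\<^sup>2) - ?r ((?v s')\<^sup>2)"
      using V(4) by linarith
  qed (use V in auto)
  then obtain r where r: "(?v s)\<^sup>2 < r" "r < (?v s')\<^sup>2" "?l r = ?r r"
    "\<And>r'. (?v s)\<^sup>2 < r' \<Longrightarrow> r' < (?v s')\<^sup>2 \<Longrightarrow> ?l r' = ?r r' \<Longrightarrow> r' = r"
    by (metis (no_types, lifting) right_minus_eq)
  have cyc: "\<exists>\<Gamma>. limit_cycle G \<Gamma> \<and> (\<forall>v\<ge>0. pt 0 v \<in> \<Gamma> \<longleftrightarrow> v = sqrt r)"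
    unfolding G_def a(2)
  proof (rule limit_cycle_from_crossing[where lo = "?v s" and hi = "?v s'" and lam = ?l and V = r])
    show "tangency_value gp kp \<le> (?v s)\<^sup>2"
      using AC V(1) by (simp add: A_def)
    fix v assume v: "?v s < v" "v < ?v s'"
    have "(?v s)\<^sup>2 \<le> v\<^sup>2" "v\<^sup>2 \<le> (?v s')\<^sup>2"
      using v vs by (auto intro!: power_mono)
    then obtain \<theta> where \<theta>: "s' \<le> \<theta>" "\<theta> \<le> s" "v\<^sup>2 = (?v \<theta>)\<^sup>2"
      using onto by blast
    have \<theta>0: "0 < \<theta>" "\<theta> < pi"
      using \<theta> s by auto
    have v\<theta>: "v = ?v \<theta>"
      using \<theta>(3) v vs vfun_pos[OF Wk \<theta>0, of go] by (simp add: power2_eq_iff)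
    note \<beta> = bottom_angle[OF Wk T[OF \<theta>(1,2)]]
    have u: "0 < ?u (?\<beta> \<theta>)"
      using vfun_pos[OF Wk \<beta>(1,2)] .
    have l: "?l (v\<^sup>2) = (?u (?\<beta> \<theta>))\<^sup>2"
      unfolding \<theta>(3) by (simp add: long_left_graph_def ang[OF \<theta>(1,2)])
    have q: "0 < qfun go W ko \<theta>"
      using T[OF \<theta>(1,2)] by (simp add: top_domain_def)
    have sq: "sqrt (?l (v\<^sup>2)) = ?u (?\<beta> \<theta>)"
      using u by (simp add: l)
    show "0 < ?l (v\<^sup>2) \<and> orbit_arc (lienard_field (2 * go * bo) (2 * gp * bp) Dm (bo\<^sup>2 * (1 + go\<^sup>2))
         (bp\<^sup>2 * (1 + gp\<^sup>2)) w (bp * (1 + gp\<^sup>2) * kp)) {z. z $ 1 < 0} (pt 0 v) (pt 0 (- sqrt (?l (v\<^sup>2))))"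
      unfolding sq a(2)[symmetric] a(1)
      using long_left_arc[OF par(3,5,6) Wk(2) \<theta>0 q[unfolded W_def], of "?\<beta> \<theta>" "2 * gp * bp"] \<beta> u v\<theta> l
      by (simp add: W_def)
  next
    fix v v' assume v: "?v s < v" "v < v'" "v' < ?v s'"
    have sq: "(?v s)\<^sup>2 \<le> v\<^sup>2" "v\<^sup>2 < v'\<^sup>2" "v'\<^sup>2 \<le> (?v s')\<^sup>2"
      using v vs by (auto intro!: power_mono power_strict_mono)
    obtain \<theta> where \<theta>: "s' \<le> \<theta>" "\<theta> \<le> s" "v\<^sup>2 = (?v \<theta>)\<^sup>2"
      using onto[of "v\<^sup>2"] sq by auto
    obtain \<theta>' where \<theta>': "s' \<le> \<theta>'" "\<theta>' \<le> s" "v'\<^sup>2 = (?v \<theta>')\<^sup>2"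
      using onto[of "v'\<^sup>2"] sq by auto
    have "\<theta>' < \<theta>"
    proof (rule ccontr)
      assume "\<not> ?thesis"
      then have "(?v \<theta>')\<^sup>2 \<le> (?v \<theta>)\<^sup>2"
        using top_square_antimono[OF Wk T[OF \<theta>(1,2)] T[OF \<theta>'(1,2)]] by (cases "\<theta> = \<theta>'") auto
      then show False
        using sq \<theta> \<theta>' by simp
    qed
    then have lt: "?\<beta> \<theta>' < ?\<beta> \<theta>"
      using bottom_angle_mono[OF Wk T[OF \<theta>'(1,2)] T[OF \<theta>(1,2)]] by simp
    note \<beta> = bottom_angle[OF Wk T[OF \<theta>(1,2)]] and \<beta>' = bottom_angle[OF Wk T[OF \<theta>'(1,2)]]
    have "0 < qfun (- go) W ko (?\<beta> \<theta>)"
      using T[OF \<theta>(1,2)] \<beta> by (simp add: top_domain_def)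
    then have "?u (?\<beta> \<theta>) < ?u (?\<beta> \<theta>')"
      using vfun_strict_antimono[OF Wk \<beta>'(1) lt \<beta>(2)] by simp
    then show "?l (v\<^sup>2) \<le> ?l (v'\<^sup>2)"
      unfolding \<theta>(3) \<theta>'(3) using vfun_pos[OF Wk \<beta>(1,2), of "- go"]
      by (auto simp: long_left_graph_def ang[OF \<theta>(1,2)] ang[OF \<theta>'(1,2)] intro!: power_mono)
  next
    show "r' = r" if "(?v s)\<^sup>2 < r'" "r' < (?v s')\<^sup>2" "?l r' = ?r r'" for r'
      using r(4)[OF that] .
  qed (use par vs pos r(1-3) in simp_all)
  have w1: "bo * w < sqrt r"
  proof -
    have sp: "0 < sin s" "sin s \<le> 1"
      using s by (auto intro!: sin_gt_zero)
    have "W * sin s \<le> W * 1"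
      using sp W by (intro mult_left_mono) auto
    also have "\<dots> < W * exp (- go * s)"
      using W par s by (simp add: mult_neg_pos)
    finally have "W < W * exp (- go * s) / sin s"
      using sp by (simp add: field_simps)
    also have "\<dots> < ?v s"
      using par pfun_pos[of s go] s by (simp add: vfun_def)
    also have "\<dots> < sqrt r"
      using r(1) by (rule real_less_rsqrt)
    finally show ?thesis
      by (simp add: W_def)
  qed
  have w2: "0 \<le> sqrt r"
    using order.strict_trans1[OF zero_le_power2 r(1)] by simp
  show ?thesis
    using cyc w1 w2 by blast
qed

section \<open>Two limit cycles for a small displacement of the focus\<close>

lemma vfun_tendsto:
  assumes "(k \<longlongrightarrow> 0) F"
  shows "((\<lambda>a. vfun g W (k a) \<theta>) \<longlongrightarrow> vfun g W 0 \<theta>) F"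
proof -
  have "((\<lambda>a. W * exp (- g * \<theta>) / sin \<theta> + k a * pfun g \<theta>) \<longlongrightarrow> W * exp (- g * \<theta>) / sin \<theta> + 0 * pfun g \<theta>) F"
    by (intro tendsto_add tendsto_mult tendsto_const assms)
  then show ?thesis
    by (simp add: vfun_def)
qed

lemma qfun_tendsto:
  assumes "(k \<longlongrightarrow> 0) F"
  shows "((\<lambda>a. qfun g W (k a) \<theta>) \<longlongrightarrow> qfun g W 0 \<theta>) F"
proof -
  have "((\<lambda>a. W * (g + cos \<theta> / sin \<theta>) - k a * pfun (- g) \<theta>) \<longlongrightarrow>
      W * (g + cos \<theta> / sin \<theta>) - 0 * pfun (- g) \<theta>) F"
    by (intro tendsto_diff tendsto_mult tendsto_const assms)
  then show ?thesis
    by (simp add: qfun_def)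
qed

lemma eventually_less_of_tendsto:
  fixes f h :: "'a \<Rightarrow> real"
  assumes "(f \<longlongrightarrow> l) F" "(h \<longlongrightarrow> m) F" "l < m"
  shows "\<forall>\<^sub>F x in F. f x < h x"
proof -
  have "((\<lambda>x. h x - f x) \<longlongrightarrow> m - l) F"
    using assms by (intro tendsto_diff)
  then have "\<forall>\<^sub>F x in F. 0 < h x - f x"
    by (rule order_tendstoD) (use assms(3) in simp)
  then show ?thesis
    by (rule eventually_mono) simp
qed

text \<open>For \<open>k = 0\<close> the orbit that touches \<open>x = - w\<close> makes half a turn about the focus in \<open>R\<^sub>o\<close>, which contracts
  more than half a turn in \<open>R\<^sub>+\<close> expands. The angles are slightly smaller than those of this
  orbit.\<close>

lemma angles_below:
  assumes g: "go < 0" "0 < gp" "gp + go < 0" "0 < W"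
  shows "\<exists>s t. 0 < s \<and> s < pi \<and> 0 < qfun go W 0 s \<and> 0 < t \<and> t < pi \<and> qfun go W 0 s < qfun (- go) W 0 t \<and>
    (vfun (- go) W 0 t)\<^sup>2 < exp (- 2 * pi * gp) * (vfun go W 0 s)\<^sup>2"
proof -
  obtain s0 where s0: "0 < s0" "s0 < pi" "cos s0 / sin s0 = - go"
    using cot_surj by blast
  define t0 where "t0 = pi - s0"
  have t0: "0 < t0" "t0 < pi" "cos t0 / sin t0 = go" "sin t0 = sin s0"
    using s0 by (auto simp: t0_def)
  have sp: "0 < sin s0"
    using s0 by (intro sin_gt_zero)
  have q0: "qfun go W 0 s0 = 0" "qfun (- go) W 0 t0 = 0"
    using s0 t0 by (simp_all add: qfun_def)
  have v0: "0 < vfun go W 0 s0"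
    using vfun_pos[of W 0 s0 go] s0 g by simp
  have "vfun (- go) W 0 t0 = exp (go * pi) * vfun go W 0 s0"
    using t0 by (simp add: vfun_def t0_def right_diff_distrib exp_diff exp_minus field_simps)
  also have "\<dots> < exp (- gp * pi) * vfun go W 0 s0"
  proof -
    have "go * pi < - gp * pi"
      using g by (intro mult_strict_right_mono) auto
    then show ?thesis
      using v0 by (intro mult_strict_right_mono) auto
  qed
  finally have less: "vfun (- go) W 0 t0 < exp (- gp * pi) * vfun go W 0 s0" .
  have "isCont (vfun (- go) W 0) t0"
    using vfun_deriv[of t0 "- go" W 0] sp t0 by (auto intro: DERIV_isCont)
  then have "(vfun (- go) W 0 \<longlongrightarrow> vfun (- go) W 0 t0) (at_left t0)"
    by (simp add: isCont_def filterlim_at_split)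
  then have "\<forall>\<^sub>F t in at_left t0. vfun (- go) W 0 t < exp (- gp * pi) * vfun go W 0 s0"
    using less by (rule order_tendstoD)
  moreover have "\<forall>\<^sub>F t in at_left t0. t \<in> {0<..<t0}"
    by (rule eventually_at_left_real[OF t0(1)])
  ultimately have "\<forall>\<^sub>F t in at_left t0. vfun (- go) W 0 t < exp (- gp * pi) * vfun go W 0 s0 \<and> t \<in> {0<..<t0}"
    by eventually_elim auto
  then obtain t where t: "vfun (- go) W 0 t < exp (- gp * pi) * vfun go W 0 s0" "0 < t" "t < t0"
    using eventually_happens'[of "at_left t0"] by force
  have qt: "0 < qfun (- go) W 0 t"
    using qfun_strict_antimono[of W 0 t t0 "- go"] g t t0 q0 by simp
  have "isCont (vfun go W 0) s0" "isCont (qfun go W 0) s0"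
    using vfun_deriv[of s0 go W 0] qfun_deriv[of s0 go W 0] sp by (auto intro: DERIV_isCont)
  then have lim: "(vfun go W 0 \<longlongrightarrow> vfun go W 0 s0) (at_left s0)" "(qfun go W 0 \<longlongrightarrow> 0) (at_left s0)"
    using q0 by (simp_all add: isCont_def filterlim_at_split)
  have "\<forall>\<^sub>F s in at_left s0. vfun (- go) W 0 t < exp (- gp * pi) * vfun go W 0 s"
    by (rule order_tendstoD(1)[OF tendsto_mult[OF tendsto_const lim(1)] t(1)])
  moreover have "\<forall>\<^sub>F s in at_left s0. qfun go W 0 s < qfun (- go) W 0 t"
    by (rule order_tendstoD(2)[OF lim(2) qt])
  moreover have "\<forall>\<^sub>F s in at_left s0. s \<in> {0<..<s0}"
    by (rule eventually_at_left_real[OF s0(1)])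
  ultimately have "\<forall>\<^sub>F s in at_left s0. vfun (- go) W 0 t < exp (- gp * pi) * vfun go W 0 s \<and>
     qfun go W 0 s < qfun (- go) W 0 t \<and> s \<in> {0<..<s0}"
    by eventually_elim auto
  then obtain s where s: "vfun (- go) W 0 t < exp (- gp * pi) * vfun go W 0 s"
    "qfun go W 0 s < qfun (- go) W 0 t" "0 < s" "s < s0"
    using eventually_happens'[of "at_left s0"] by force
  have "0 < qfun go W 0 s"
    using qfun_strict_antimono[of W 0 s s0 go] g s s0 q0 by simp
  moreover have "(vfun (- go) W 0 t)\<^sup>2 < (exp (- gp * pi) * vfun go W 0 s)\<^sup>2"
    using s(1) vfun_pos[of W 0 t "- go"] g t t0 by (intro power_strict_mono) auto
  moreover have "(exp (- gp * pi) * vfun go W 0 s)\<^sup>2 = exp (- 2 * pi * gp) * (vfun go W 0 s)\<^sup>2"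
    by (simp add: power_mult_distrib mult_ac flip: exp_double)
  ultimately show ?thesis
    using s t s0 t0 by (intro exI[of _ s] exI[of _ t]) auto
qed

text \<open>For large orbits the angles in the middle zone tend to zero, so that this zone hardly
  contracts, while the expansion in \<open>R\<^sub>+\<close> stays the same.\<close>

lemma angles_above:
  assumes g: "go < 0" "0 < gp" "0 < W" "0 < s"
  shows "\<exists>s' t'. 0 < s' \<and> s' < s \<and> 0 < t' \<and> t' < pi \<and> 0 < qfun (- go) W 0 t' \<and>
    qfun (- go) W 0 t' < qfun go W 0 s' \<and>
    exp (- 2 * pi * gp) * (vfun go W 0 s')\<^sup>2 < (vfun (- go) W 0 t')\<^sup>2"
proof -
  \<comment> \<open>The angles are \<open>t' = arctan x\<close>, \<open>s' = arctan (y x)\<close> for small \<open>x\<close>; \<open>cot s' = cot t' + m\<close>, which puts the first \<open>qfun\<close> above the second.\<close>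
  define m where "m = 1 - 2 * go"
  define y where "y = (\<lambda>x. x / (1 + m * x))"
  define f where "f = (\<lambda>x. exp (- go * arctan (y x)) * sqrt (1 + (y x)\<^sup>2) * (1 + m * x))"
  define h where "h = (\<lambda>x. exp (go * arctan x) * sqrt (1 + x\<^sup>2))"
  have m: "0 < m"
    using g by (simp add: m_def)
  have id: "((\<lambda>x. x) \<longlongrightarrow> (0::real)) (at_right 0)"
    by (rule tendsto_ident_at)
  have den: "((\<lambda>x. 1 + m * x) \<longlongrightarrow> 1) (at_right 0)"
    by (rule tendsto_eq_intros id | simp)+
  have y: "(y \<longlongrightarrow> 0) (at_right 0)"
    unfolding y_def using tendsto_divide[OF id den] by simp
  have ay: "((\<lambda>x. arctan (y x)) \<longlongrightarrow> 0) (at_right 0)"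
    using tendsto_arctan[OF y] by simp
  have sy: "((\<lambda>x. sqrt (1 + (y x)\<^sup>2)) \<longlongrightarrow> 1) (at_right 0)"
    using tendsto_real_sqrt[OF tendsto_add[OF tendsto_const[of 1] tendsto_power[OF y, of 2]]] by simp
  have f: "((\<lambda>x. exp (- pi * gp) * f x) \<longlongrightarrow> exp (- pi * gp) * 1) (at_right 0)"
  proof (rule tendsto_mult[OF tendsto_const])
    have "((\<lambda>x. exp (- go * arctan (y x))) \<longlongrightarrow> exp (- go * 0)) (at_right 0)"
      by (intro tendsto_exp tendsto_mult tendsto_const ay)
    from tendsto_mult[OF tendsto_mult[OF this sy] den] show "(f \<longlongrightarrow> 1) (at_right 0)"
      by (simp add: f_def)
  qed
  have h: "(h \<longlongrightarrow> 1) (at_right 0)"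
  proof -
    have "(h \<longlongrightarrow> exp (go * arctan 0) * sqrt (1 + 0\<^sup>2)) (at_right 0)"
      unfolding h_def by (intro tendsto_intros id)
    then show ?thesis
      by simp
  qed
  have "\<forall>\<^sub>F x in at_right 0. exp (- pi * gp) * f x < h x"
    by (rule eventually_less_of_tendsto[OF f h]) (use g in simp)
  moreover have "\<forall>\<^sub>F x in at_right 0. arctan (y x) < s"
    by (rule order_tendstoD(2)[OF ay g(4)])
  moreover have "\<forall>\<^sub>F x in at_right 0. x \<in> {0<..<1::real}"
    by (rule eventually_at_right_real) simp
  ultimately have "\<forall>\<^sub>F x in at_right 0. exp (- pi * gp) * f x < h x \<and> arctan (y x) < s \<and> x \<in> {0<..<1}"
    by eventually_elim auto
  then obtain x where x: "exp (- pi * gp) * f x < h x" "arctan (y x) < s" "0 < x"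
    using eventually_happens'[of "at_right (0::real)"] by force
  have yx: "0 < y x" "1 / y x = 1 / x + m"
    using x m by (auto simp: y_def field_simps add_pos_pos)
  define s' t' where "s' = arctan (y x)" and "t' = arctan x"
  have st: "0 < s'" "s' < s" "0 < t'" "t' < pi"
    using x yx arctan_bounded[of x] by (auto simp: s'_def t'_def)
  have cot: "cos (arctan z) / sin (arctan z) = 1 / z" if "0 < z" for z
  proof -
    have "0 < 1 + z\<^sup>2"
      by (simp add: add_pos_nonneg)
    then show ?thesis
      using that by (simp add: cos_arctan sin_arctan)
  qed
  have q: "qfun (- go) W 0 t' = W * (1 / x - go)" "qfun go W 0 s' = W * (1 / x - go + 1)"
    using cot[OF x(3)] cot[OF yx(1)] yx(2) by (simp_all add: qfun_def s'_def t'_def m_def)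
  have v: "vfun go W 0 s' = W / x * f x" "vfun (- go) W 0 t' = W / x * h x"
    using x(3) yx(1) m by (simp_all add: vfun_def s'_def t'_def f_def h_def sin_arctan y_def field_simps)
  have f0: "0 < f x"
    using x(3) m by (simp add: f_def add_pos_nonneg add_pos_pos)
  have "(exp (- pi * gp) * f x)\<^sup>2 < (h x)\<^sup>2"
    using x(1) f0 by (intro power_strict_mono) auto
  then have "(W / x)\<^sup>2 * (exp (- pi * gp) * f x)\<^sup>2 < (W / x)\<^sup>2 * (h x)\<^sup>2"
    using g x by (intro mult_strict_left_mono) auto
  then have "exp (- 2 * pi * gp) * (vfun go W 0 s')\<^sup>2 < (vfun (- go) W 0 t')\<^sup>2"
    unfolding v by (simp add: power_mult_distrib power_divide mult_ac flip: exp_double)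
  moreover have "0 < 1 / x - go"
    using g less_trans[OF g(1), of "1 / x"] x(3) by simp
  ultimately show ?thesis
    using st g by (intro exI[of _ s'] exI[of _ t']) (simp add: q)
qed

lemma eventually_small_limit_cycle:
  assumes g: "go < 0" "0 < gp" "gp + go < 0" and par: "0 < bo" "0 < bp" "0 < w" "0 < Dm"
  shows "\<forall>\<^sub>F a in at_right 0. \<exists>\<Gamma> v.
    limit_cycle (lienard_field (2 * go * bo) (2 * gp * bp) Dm (bo\<^sup>2 * (1 + go\<^sup>2)) (bp\<^sup>2 * (1 + gp\<^sup>2)) w a) \<Gamma> \<and>
    0 \<le> v \<and> v < bo * w \<and> (\<forall>v'\<ge>0. pt 0 v' \<in> \<Gamma> \<longleftrightarrow> v' = v)"
proof -
  note ta = tangency_angle[OF g(2)]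
  have pos: "0 < 1 + go\<^sup>2" "0 < 1 + gp\<^sup>2"
    by (simp_all add: add_pos_nonneg)
  \<comment> \<open>Small enough that \<open>c\<close> and \<open>d\<close> are admissible and \<open>gp c + go d\<close> stays negative.\<close>
  define e where "e = Min {(tangency_angle gp - pi) / 2, pi / 2, - (gp + go) * pi / (2 * (gp - go))}"
  have "0 < e"
    using ta g by (auto simp: e_def intro!: divide_pos_pos mult_neg_pos)
  moreover have "e \<le> (tangency_angle gp - pi) / 2" "e \<le> pi / 2" "e \<le> - (gp + go) * pi / (2 * (gp - go))"
    unfolding e_def by (rule Min_le, simp, simp)+
  ultimately have e: "0 < e" "e \<le> (tangency_angle gp - pi) / 2" "e \<le> pi / 2"
    "e \<le> - (gp + go) * pi / (2 * (gp - go))"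
    by blast+
  define c d where "c = pi + e" and "d = pi - e"
  have cd: "pi < c" "c < tangency_angle gp" "0 < d" "d < pi"
    using e ta pi_gt_zero by (auto simp: c_def d_def)
  have "e * (2 * (gp - go)) \<le> - (gp + go) * pi"
    using e(4) g by (simp add: pos_le_divide_eq)
  then have "gp * c + go * d \<le> (gp + go) * pi / 2"
    by (simp add: c_def d_def algebra_simps)
  also have "\<dots> < 0"
    using g by (simp add: mult_neg_pos)
  finally have gcd: "2 * go * d < - 2 * gp * c"
    by (simp add: algebra_simps)
  define ko kp where "ko = (\<lambda>a. a / (bo * (1 + go\<^sup>2)))" and "kp = (\<lambda>a. a / (bp * (1 + gp\<^sup>2)))"
  have lim: "(ko \<longlongrightarrow> 0) (at_right 0)" "(kp \<longlongrightarrow> 0) (at_right 0)"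
    unfolding ko_def kp_def by (rule tendsto_eq_intros tendsto_ident_at refl | use par pos in simp)+
  \<comment> \<open>Any fixed value below \<open>(bo w)\<^sup>2\<close> will do.\<close>
  define V1 where "V1 = (bo * w)\<^sup>2 / 4"
  have V1: "0 < V1" "V1 < (bo * w)\<^sup>2"
    using par by (simp_all add: V1_def)
  have z: "((\<lambda>a. (k a * r)\<^sup>2) \<longlongrightarrow> 0) (at_right 0)" if "(k \<longlongrightarrow> 0) (at_right 0)" for k :: "real \<Rightarrow> real" and r
    using tendsto_power[OF tendsto_mult[OF that tendsto_const[of r]], of 2] by simp
  have "\<forall>\<^sub>F a in at_right 0. (kp a * pfun (- gp) c)\<^sup>2 < V1"
    by (rule order_tendstoD(2)[OF z[OF lim(2)] V1(1)])
  moreover have "\<forall>\<^sub>F a in at_right 0. (ko a * pfun go d)\<^sup>2 < V1"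
    by (rule order_tendstoD(2)[OF z[OF lim(1)] V1(1)])
  moreover have "\<forall>\<^sub>F a in at_right 0. (ko a * pfun (- go) d)\<^sup>2 + exp (2 * go * d) * V1 <
      exp (- 2 * gp * c) * (V1 - (kp a * pfun (- gp) c)\<^sup>2)"
  proof (rule eventually_less_of_tendsto)
    show "((\<lambda>a. (ko a * pfun (- go) d)\<^sup>2 + exp (2 * go * d) * V1) \<longlongrightarrow> 0 + exp (2 * go * d) * V1) (at_right 0)"
      by (intro tendsto_add z lim tendsto_const)
    show "((\<lambda>a. exp (- 2 * gp * c) * (V1 - (kp a * pfun (- gp) c)\<^sup>2)) \<longlongrightarrow>
        exp (- 2 * gp * c) * (V1 - 0)) (at_right 0)"
      by (intro tendsto_mult tendsto_diff z lim tendsto_const)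
    show "0 + exp (2 * go * d) * V1 < exp (- 2 * gp * c) * (V1 - 0)"
      using gcd V1 by simp
  qed
  moreover have "\<forall>\<^sub>F a in at_right 0. (0::real) < a"
    by (simp add: eventually_at_right_less)
  ultimately show ?thesis
  proof eventually_elim
    case (elim a)
    show ?case
      by (rule small_limit_cycle[OF g(1,2) par, of "ko a" "kp a" a c d V1])
        (use elim par pos cd V1 in \<open>auto simp: ko_def kp_def\<close>)
  qed
qed

lemma eventually_big_limit_cycle:
  assumes g: "go < 0" "0 < gp" "gp + go < 0" and par: "0 < bo" "0 < bp" "0 < w" "0 < Dm"
  shows "\<forall>\<^sub>F a in at_right 0. \<exists>\<Gamma> v.
    limit_cycle (lienard_field (2 * go * bo) (2 * gp * bp) Dm (bo\<^sup>2 * (1 + go\<^sup>2)) (bp\<^sup>2 * (1 + gp\<^sup>2)) w a) \<Gamma> \<and>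
    0 \<le> v \<and> bo * w < v \<and> (\<forall>v'\<ge>0. pt 0 v' \<in> \<Gamma> \<longleftrightarrow> v' = v)"
proof -
  note ta = tangency_angle[OF g(2)]
  define W where "W = bo * w"
  have W: "0 < W"
    using par by (simp add: W_def)
  have pos: "0 < 1 + go\<^sup>2" "0 < 1 + gp\<^sup>2"
    by (simp_all add: add_pos_nonneg)
  obtain s t where st: "0 < s" "s < pi" "0 < qfun go W 0 s" "0 < t" "t < pi"
    "qfun go W 0 s < qfun (- go) W 0 t" "(vfun (- go) W 0 t)\<^sup>2 < exp (- 2 * pi * gp) * (vfun go W 0 s)\<^sup>2"
    using angles_below[OF g W] by blast
  obtain s' t' where st': "0 < s'" "s' < s" "0 < t'" "t' < pi" "0 < qfun (- go) W 0 t'"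
    "qfun (- go) W 0 t' < qfun go W 0 s'"
    "exp (- 2 * pi * gp) * (vfun go W 0 s')\<^sup>2 < (vfun (- go) W 0 t')\<^sup>2"
    using angles_above[OF g(1,2) W st(1)] by blast
  let ?v = "vfun go W" and ?u = "vfun (- go) W"
  \<comment> \<open>Half of the gap at the lower end in the limit \<open>a = 0\<close>; the other half absorbs the errors for \<open>c > \<pi>\<close> and \<open>a > 0\<close>.\<close>
  define e where "e = (exp (- 2 * pi * gp) * (?v 0 s)\<^sup>2 - (?u 0 t)\<^sup>2) / 2"
  have e: "0 < e"
    using st(7) by (simp add: e_def)
  have ex: "((\<lambda>c. exp (- 2 * gp * c)) \<longlongrightarrow> exp (- 2 * pi * gp)) (at_right pi)"
  proof -
    have "((\<lambda>c. exp (- 2 * gp * c)) \<longlongrightarrow> exp (- 2 * gp * pi)) (at_right pi)"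
      by (intro tendsto_intros)
    then show ?thesis
      by (simp add: mult_ac)
  qed
  have "\<forall>\<^sub>F c in at_right pi. (?u 0 t)\<^sup>2 < exp (- 2 * gp * c) * (?v 0 s)\<^sup>2 - e"
  proof (rule eventually_less_of_tendsto[OF tendsto_const])
    show "((\<lambda>c. exp (- 2 * gp * c) * (?v 0 s)\<^sup>2 - e) \<longlongrightarrow> exp (- 2 * pi * gp) * (?v 0 s)\<^sup>2 - e) (at_right pi)"
      by (intro tendsto_diff tendsto_mult ex tendsto_const)
    show "(?u 0 t)\<^sup>2 < exp (- 2 * pi * gp) * (?v 0 s)\<^sup>2 - e"
      using st(7) by (simp add: e_def field_simps)
  qed
  moreover have "\<forall>\<^sub>F c in at_right pi. (exp (- 2 * pi * gp) - exp (- 2 * gp * c)) * ((?v 0 s')\<^sup>2 - (?v 0 s)\<^sup>2) < e"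
  proof (rule eventually_less_of_tendsto[OF _ tendsto_const])
    show "((\<lambda>c. (exp (- 2 * pi * gp) - exp (- 2 * gp * c)) * ((?v 0 s')\<^sup>2 - (?v 0 s)\<^sup>2)) \<longlongrightarrow>
       (exp (- 2 * pi * gp) - exp (- 2 * pi * gp)) * ((?v 0 s')\<^sup>2 - (?v 0 s)\<^sup>2)) (at_right pi)"
      by (intro tendsto_diff tendsto_mult ex tendsto_const)
  qed (use e in simp)
  moreover have "\<forall>\<^sub>F c in at_right pi. c \<in> {pi<..<tangency_angle gp}"
    by (rule eventually_at_right_real[OF ta(1)])
  ultimately have "\<forall>\<^sub>F c in at_right pi. (?u 0 t)\<^sup>2 < exp (- 2 * gp * c) * (?v 0 s)\<^sup>2 - e \<and>
     (exp (- 2 * pi * gp) - exp (- 2 * gp * c)) * ((?v 0 s')\<^sup>2 - (?v 0 s)\<^sup>2) < e \<and>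
     c \<in> {pi<..<tangency_angle gp}"
    by eventually_elim auto
  then obtain c where c: "(?u 0 t)\<^sup>2 < exp (- 2 * gp * c) * (?v 0 s)\<^sup>2 - e"
    "(exp (- 2 * pi * gp) - exp (- 2 * gp * c)) * ((?v 0 s')\<^sup>2 - (?v 0 s)\<^sup>2) < e"
    "pi < c" "c < tangency_angle gp"
    using eventually_happens'[of "at_right pi"] by force
  define ko kp where "ko = (\<lambda>a. a / (bo * (1 + go\<^sup>2)))" and "kp = (\<lambda>a. a / (bp * (1 + gp\<^sup>2)))"
  have lim: "(ko \<longlongrightarrow> 0) (at_right 0)" "(kp \<longlongrightarrow> 0) (at_right 0)"
    unfolding ko_def kp_def by (rule tendsto_eq_intros tendsto_ident_at refl | use par pos in simp)+
  note V = vfun_tendsto[OF lim(1)] and Q = qfun_tendsto[OF lim(1)]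
  have z: "((\<lambda>a. (kp a * r)\<^sup>2) \<longlongrightarrow> 0) (at_right 0)" for r
    using tendsto_power[OF tendsto_mult[OF lim(2) tendsto_const[of r]], of 2] by simp
  have vs: "0 < ?v 0 s"
    using vfun_pos[OF W, of 0 s go] st by simp
  have "\<forall>\<^sub>F a in at_right 0. 0 < qfun go W (ko a) s"
    by (rule order_tendstoD(1)[OF Q st(3)])
  moreover have "\<forall>\<^sub>F a in at_right 0. qfun go W (ko a) s < qfun (- go) W (ko a) t"
    by (rule eventually_less_of_tendsto[OF Q Q st(6)])
  moreover have "\<forall>\<^sub>F a in at_right 0. 0 < qfun (- go) W (ko a) t'"
    by (rule order_tendstoD(1)[OF Q st'(5)])
  moreover have "\<forall>\<^sub>F a in at_right 0. qfun (- go) W (ko a) t' < qfun go W (ko a) s'"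
    by (rule eventually_less_of_tendsto[OF Q Q st'(6)])
  moreover have "\<forall>\<^sub>F a in at_right 0. (kp a * pfun (- gp) c)\<^sup>2 < (?v (ko a) s)\<^sup>2"
    by (rule eventually_less_of_tendsto[OF z tendsto_power[OF V]]) (use vs in simp)
  moreover have "\<forall>\<^sub>F a in at_right 0. (?u (ko a) t)\<^sup>2 <
      exp (- 2 * gp * c) * ((?v (ko a) s)\<^sup>2 - (kp a * pfun (- gp) c)\<^sup>2) - e"
  proof (rule eventually_less_of_tendsto[OF tendsto_power[OF V]])
    show "((\<lambda>a. exp (- 2 * gp * c) * ((?v (ko a) s)\<^sup>2 - (kp a * pfun (- gp) c)\<^sup>2) - e) \<longlongrightarrow>
      exp (- 2 * gp * c) * ((?v 0 s)\<^sup>2 - 0) - e) (at_right 0)"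
      by (intro tendsto_diff tendsto_mult tendsto_power V z tendsto_const)
  qed (use c(1) in simp)
  moreover have "\<forall>\<^sub>F a in at_right 0. exp (- 2 * pi * gp) * (?v (ko a) s')\<^sup>2 < (?u (ko a) t')\<^sup>2"
    by (rule eventually_less_of_tendsto[OF tendsto_mult[OF tendsto_const tendsto_power[OF V]]
          tendsto_power[OF V] st'(7)])
  moreover have "\<forall>\<^sub>F a in at_right 0. (exp (- 2 * pi * gp) - exp (- 2 * gp * c)) *
      ((?v (ko a) s')\<^sup>2 - (?v (ko a) s)\<^sup>2) < e"
    by (rule eventually_less_of_tendsto[OF tendsto_mult[OF tendsto_const
          tendsto_diff[OF tendsto_power[OF V] tendsto_power[OF V]]] tendsto_const c(2)])
  moreover have "\<forall>\<^sub>F a in at_right 0. (0::real) < a"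
    by (simp add: eventually_at_right_less)
  ultimately show ?thesis
  proof eventually_elim
    case (elim a)
    show ?case
      by (rule big_limit_cycle[OF g(1,2) par, of "ko a" "kp a" a c s' s t t' e])
        (use elim par pos c(3,4) st(1-5) st'(1-4) e in \<open>auto simp: ko_def kp_def W_def\<close>)
  qed
qed

lemma eventually_two_limit_cycles:
  assumes g: "go < 0" "0 < gp" "gp + go < 0" and par: "0 < bo" "0 < bp" "0 < w" "0 < Dm"
  defines "G \<equiv> lienard_field (2 * go * bo) (2 * gp * bp) Dm (bo\<^sup>2 * (1 + go\<^sup>2)) (bp\<^sup>2 * (1 + gp\<^sup>2)) w"
  shows "\<forall>\<^sub>F a in at_right 0. \<exists>\<Gamma>1 \<Gamma>2. \<Gamma>1 \<noteq> \<Gamma>2 \<and> limit_cycle (G a) \<Gamma>1 \<and> limit_cycle (G a) \<Gamma>2"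
  using eventually_small_limit_cycle[OF g par] eventually_big_limit_cycle[OF g par]
  unfolding G_def[symmetric]
proof eventually_elim
  case (elim a)
  obtain \<Gamma>1 v where 1: "limit_cycle (G a) \<Gamma>1" "0 \<le> v" "v < bo * w" "\<forall>v'\<ge>0. pt 0 v' \<in> \<Gamma>1 \<longleftrightarrow> v' = v"
    using elim(1) by blast
  obtain \<Gamma>2 v' where 2: "limit_cycle (G a) \<Gamma>2" "0 \<le> v'" "bo * w < v'" "\<forall>v''\<ge>0. pt 0 v'' \<in> \<Gamma>2 \<longleftrightarrow> v'' = v'"
    using elim(2) by blast
  have "pt 0 v \<in> \<Gamma>1"
    using 1(2,4) by blast
  moreover have "pt 0 v \<notin> \<Gamma>2"
    using 2(4) 1(2,3) 2(3) by auto
  ultimately have "\<Gamma>1 \<noteq> \<Gamma>2"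
    by blast
  then show ?case
    using 1(1) 2(1) by blast
qed

section \<open>The condition for a center\<close>

text \<open>Along a periodic orbit near the focus every turn multiplies the height on \<open>x = 0\<close> by
  \<open>k = exp ((g\<^sub>+ + g\<^sub>o) \<pi>)\<close>. Unless \<open>k = 1\<close>, infinitely many turns, forwards or backwards in time, lead to the
  focus, which would lie on the closed orbit.\<close>

lemma half_turns_cancel:
  fixes go gp bo bp w Dm :: real
  assumes g: "go < 0" and par: "0 < bo" "0 < bp" "0 < w"
  defines "G \<equiv> lienard_field (2 * go * bo) (2 * gp * bp) Dm (bo\<^sup>2 * (1 + go\<^sup>2)) (bp\<^sup>2 * (1 + gp\<^sup>2)) w 0"
  assumes po: "periodic_orbit G \<Gamma>" "pt 0 v \<in> \<Gamma>" "0 < v" "v \<le> bo * w" "pt 0 0 \<notin> \<Gamma>"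
  shows "gp + go = 0"
proof (rule ccontr)
  assume ne: "gp + go \<noteq> 0"
  obtain L where L: "L-lipschitz_on UNIV G"
    using lienard_field_lipschitz unfolding G_def by blast
  define k where "k = exp ((gp + go) * pi)"
  have step: "pt 0 v \<in> \<Gamma> \<longleftrightarrow> pt 0 (v * k) \<in> \<Gamma>" if "0 < v" "v \<le> bo * w" for v
  proof -
    have 1: "orbit_arc G {z. z $ 1 < 0} (pt 0 v) (pt 0 (- (v * exp (go * pi))))"
      unfolding G_def by (rule half_turn_left[OF par(1,3) g that])
    have eq: "v * exp (go * pi) * exp (gp * pi) = v * k"
      by (simp add: k_def algebra_simps flip: exp_add)
    have "0 < v * exp (go * pi)"
      using that by simp
    from half_turn_right[OF par(2,3) this, of "2 * go * bo" gp Dm "bo\<^sup>2 * (1 + go\<^sup>2)"]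
    have 2: "orbit_arc G {z. z $ 1 > 0} (pt 0 (- (v * exp (go * pi)))) (pt 0 (v * k))"
      unfolding G_def eq .
    show ?thesis
      using periodic_orbit_contains_arc_end[OF L po(1)] periodic_orbit_contains_arc_start[OF L po(1)] 1 2
      by blast
  qed
  \<comment> \<open>For \<open>k > 1\<close> the turns are followed backwards.\<close>
  define r where "r = min k (1 / k)"
  have k: "0 < k" "k \<noteq> 1"
    using ne by (simp_all add: k_def)
  then have r: "0 < r" "r < 1"
    unfolding r_def min_less_iff_disj by (auto simp: neq_iff)
  have step': "pt 0 (v * r) \<in> \<Gamma>" if "pt 0 v \<in> \<Gamma>" "0 < v" "v \<le> bo * w" for v
  proof (cases "r = k")
    case True
    then show ?thesis
      using step[OF that(2,3)] that(1) by simp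
  next
    case False
    then have r': "r = 1 / k"
      by (auto simp: r_def min_def)
    have "v * r \<le> v * 1"
      using r that by (intro mult_left_mono) auto
    then have "v * r \<le> bo * w"
      using that(3) by linarith
    moreover have eq: "v * r * k = v"
      using k r' by simp
    ultimately show ?thesis
      using step[of "v * r"] that r unfolding eq by simp
  qed
  have inG: "pt 0 (v * r ^ n) \<in> \<Gamma> \<and> v * r ^ n \<le> bo * w" for n
  proof (induction n)
    case (Suc n)
    have "v * r ^ n * r \<le> v * r ^ n * 1"
      using r po(3) by (intro mult_left_mono) auto
    then have "v * r ^ n * r \<le> bo * w"
      using Suc by linarith
    then show ?case
      using Suc step'[of "v * r ^ n"] po(3) r by (simp add: mult_ac)
  qed (use po in simp)
  have lim: "(\<lambda>n. pt 0 (v * r ^ n)) \<longlonglongrightarrow> pt 0 (v * 0)"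
  proof -
    have "(\<lambda>n. r ^ n) \<longlonglongrightarrow> 0"
      using r by (intro LIMSEQ_realpow_zero) auto
    then have "(\<lambda>n. (v * r ^ n) *\<^sub>R pt 0 1) \<longlonglongrightarrow> (v * 0) *\<^sub>R pt 0 1"
      by (intro tendsto_scaleR tendsto_mult tendsto_const)
    then show ?thesis
      by (simp add: pt_linear)
  qed
  have "pt 0 (v * 0) \<in> \<Gamma>"
    by (rule closed_sequentially[OF compact_imp_closed[OF periodic_orbit_compact[OF po(1)]] _ lim])
      (simp add: inG)
  then show False
    using po(5) by simp
qed

section \<open>Reduction to Lienard form\<close>

definition lienard_map :: "real^2 \<Rightarrow> real^2^2 \<Rightarrow> real^2 \<Rightarrow> real^2" where
  "lienard_map n A z = pt (n \<bullet> z) (trace A * (n \<bullet> z) - n \<bullet> (A *v z))"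

lemma trace_2: "trace (A :: real^2^2) = A $ 1 $ 1 + A $ 2 $ 2"
  by (simp add: trace_def sum_2)

lemma inner_2: "(x :: real^2) \<bullet> y = x $ 1 * y $ 1 + x $ 2 * y $ 2"
  by (simp add: inner_vec_def sum_2)

lemma matrix_vector_mult_2:
  "((A :: real^2^2) *v x) $ 1 = A $ 1 $ 1 * x $ 1 + A $ 1 $ 2 * x $ 2"
  "((A :: real^2^2) *v x) $ 2 = A $ 2 $ 1 * x $ 1 + A $ 2 $ 2 * x $ 2"
  by (simp_all add: matrix_vector_mult_def sum_2)

lemma lienard_map_linear: "linear (lienard_map n A)"
  unfolding lienard_map_def
  by (intro linearI)
    (simp_all add: inner_add_right matrix_vector_right_distrib matrix_vector_mult_scaleR
      pt_linear algebra_simps)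

text \<open>A kernel vector \<open>z\<close> and its image \<open>A z\<close> would both be orthogonal to \<open>n\<close>, hence parallel: \<open>z\<close> would be a
  real eigenvector.\<close>

lemma lienard_map_inj:
  assumes n: "n \<noteq> 0" and disc: "(trace A)\<^sup>2 < 4 * det A"
  shows "inj (lienard_map n A)"
  unfolding linear_injective_0[OF lienard_map_linear]
proof (intro allI impI, rule ccontr)
  fix z assume 0: "lienard_map n A z = 0" and z: "z \<noteq> 0"
  have 1: "n $ 1 * z $ 1 + n $ 2 * z $ 2 = 0"
    using 0 by (simp add: lienard_map_def pt_linear inner_2)
  have 2: "n $ 1 * (A $ 1 $ 1 * z $ 1 + A $ 1 $ 2 * z $ 2) + n $ 2 * (A $ 2 $ 1 * z $ 1 + A $ 2 $ 2 * z $ 2) = 0"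
    using 0 1 by (simp add: lienard_map_def pt_linear inner_2 matrix_vector_mult_2)
  have disc': "(A $ 1 $ 1 - A $ 2 $ 2)\<^sup>2 + 4 * A $ 1 $ 2 * A $ 2 $ 1 < 0"
    using disc by (simp add: trace_2 det_2 power2_eq_square algebra_simps)
  have q: "A $ 1 $ 2 * (n $ 1)\<^sup>2 + (A $ 2 $ 2 - A $ 1 $ 1) * n $ 1 * n $ 2 - A $ 2 $ 1 * (n $ 2)\<^sup>2 = 0"
  proof -
    have a: "z $ 1 * (A $ 1 $ 2 * (n $ 1)\<^sup>2 + (A $ 2 $ 2 - A $ 1 $ 1) * n $ 1 * n $ 2 - A $ 2 $ 1 * (n $ 2)\<^sup>2) = 0"
      using 1 2 by algebra
    have b: "z $ 2 * (A $ 1 $ 2 * (n $ 1)\<^sup>2 + (A $ 2 $ 2 - A $ 1 $ 1) * n $ 1 * n $ 2 - A $ 2 $ 1 * (n $ 2)\<^sup>2) = 0"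
      using 1 2 by algebra
    have "z $ 1 \<noteq> 0 \<or> z $ 2 \<noteq> 0"
      using z by (simp add: vec_eq_iff forall_2)
    then show ?thesis
      using a b by auto
  qed
  have sq: "(2 * A $ 1 $ 2 * n $ 1 + (A $ 2 $ 2 - A $ 1 $ 1) * n $ 2)\<^sup>2 =
      ((A $ 1 $ 1 - A $ 2 $ 2)\<^sup>2 + 4 * A $ 1 $ 2 * A $ 2 $ 1) * (n $ 2)\<^sup>2"
    using q by algebra
  have n2: "n $ 2 = 0"
  proof (rule ccontr)
    assume "n $ 2 \<noteq> 0"
    then have "((A $ 1 $ 1 - A $ 2 $ 2)\<^sup>2 + 4 * A $ 1 $ 2 * A $ 2 $ 1) * (n $ 2)\<^sup>2 < 0"
      using disc' by (intro mult_neg_pos) auto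
    then show False
      using sq by (metis not_less zero_le_power2)
  qed
  then have "A $ 1 $ 2 * n $ 1 = 0"
    using sq by simp
  moreover have "A $ 1 $ 2 \<noteq> 0"
    using disc' by (auto simp: not_less)
  ultimately show False
    using n n2 by (simp add: vec_eq_iff forall_2)
qed

text \<open>Cayley-Hamilton: in the coordinates \<open>lienard_map n A\<close> the matrix \<open>A\<close> becomes a companion
  matrix.\<close>

lemma lienard_map_matrix:
  "lienard_map n A (A *v z) = pt (trace A * lienard_map n A z $ 1 - lienard_map n A z $ 2)
     (det A * lienard_map n A z $ 1)"
  unfolding lienard_map_def
  by (simp add: inner_2 matrix_vector_mult_2 trace_2 det_2 algebra_simps)

text \<open>The change of trace and determinant under a rank-one update is linear in the update vector, and it is
  given by the coordinates used here. This is why one coordinate system serves all three zones.\<close>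

lemma lienard_map_rank_one:
  assumes "\<And>z. A' *v z = A *v z + (n \<bullet> z) *\<^sub>R u"
  shows "lienard_map n A u = pt (trace A' - trace A) (det A' - det A)"
proof -
  have "(A' *v axis j 1) $ i = (A *v axis j 1) $ i + n $ j * u $ i" for i j
    unfolding assms by (simp add: inner_axis)
  then have e: "A' $ i $ j = A $ i $ j + n $ j * u $ i" for i j
    by (simp add: matrix_vector_mult_basis column_def)
  show ?thesis
    by (simp add: lienard_map_def trace_2 det_2 e inner_2 matrix_vector_mult_2 algebra_simps)
qed

text \<open>The difference of the two fields is affine and vanishes on the line, so it depends only on \<open>n \<bullet> z\<close>.\<close>

lemma continuous_along_line:
  assumes "n \<noteq> 0" and eq: "\<And>z. n \<bullet> z = r \<Longrightarrow> lin_vf X z = lin_vf Y z"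
  shows "\<exists>u. (\<forall>z. lin_vf X z = lin_vf Y z + (n \<bullet> z - r) *\<^sub>R u) \<and> (\<forall>z. fst X *v z = fst Y *v z + (n \<bullet> z) *\<^sub>R u)"
proof -
  define u where "u = (1 / (n \<bullet> n)) *\<^sub>R ((fst X - fst Y) *v n)"
  have nn: "n \<bullet> n \<noteq> 0"
    using assms by simp
  have lin: "lin_vf X z = lin_vf Y z + (n \<bullet> z - r) *\<^sub>R u" for z
  proof -
    define s where "s = (n \<bullet> z - r) / (n \<bullet> n)"
    define z0 where "z0 = z - s *\<^sub>R n"
    have "n \<bullet> z0 = r"
      using nn by (simp add: z0_def s_def inner_diff_right)
    then have "lin_vf X z0 = lin_vf Y z0"
      by (rule eq)
    moreover have "lin_vf X z = lin_vf X z0 + s *\<^sub>R (fst X *v n)"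
      "lin_vf Y z = lin_vf Y z0 + s *\<^sub>R (fst Y *v n)"
      by (simp_all add: lin_vf_def z0_def matrix_vector_mult_diff_distrib matrix_vector_mult_scaleR)
    moreover have "(n \<bullet> z - r) *\<^sub>R u = s *\<^sub>R (fst X *v n) - s *\<^sub>R (fst Y *v n)"
      by (simp add: u_def s_def matrix_vector_mult_diff_rdistrib scaleR_diff_right)
    ultimately show ?thesis
      by simp
  qed
  moreover have "fst X *v z = fst Y *v z + (n \<bullet> z) *\<^sub>R u" for z
  proof -
    have b: "snd X = snd Y - r *\<^sub>R u"
      using lin[of 0] by (simp add: lin_vf_def)
    show ?thesis
      using lin[of z] unfolding lin_vf_def b by (simp add: algebra_simps)
  qed
  ultimately show ?thesis
    by blast
qed

lemma pwl_vf_lienard_form: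
  fixes n p :: "real^2" and A :: "real^2^2" and Xm Xo Xp :: lin_field
  assumes c: "0 < c" and p: "n \<bullet> p = c"
    and Xo: "\<And>z. lin_vf Xo z = A *v (z - p) + b" and b: "lienard_map n A b = pt 0 (- a)"
    and Xp: "\<And>z. lin_vf Xp z = lin_vf Xo z + (n \<bullet> z - c) *\<^sub>R up"
    and up: "lienard_map n A up = pt (Tp - trace A) (Dp - det A)"
    and Xm: "\<And>z. lin_vf Xm z = lin_vf Xo z + (n \<bullet> z + c) *\<^sub>R um"
    and um: "lienard_map n A um = pt (- trace A) (Dm - det A)"
  shows "pwl_continuous n c (Xm, Xo, Xp)"
    and "lienard_map n A (pwl_vf n c (Xm, Xo, Xp) z) =
      lienard_field (trace A) Tp Dm (det A) Dp (2 * c) a (lienard_map n A z + (- lienard_map n A p))"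
proof -
  interpret M: linear "lienard_map n A"
    by (rule lienard_map_linear)
  show "pwl_continuous n c (Xm, Xo, Xp)"
    by (simp add: pwl_continuous_def L_minus_def L_plus_def Xp Xm)
  define x y where "x = lienard_map n A (z - p) $ 1" and "y = lienard_map n A (z - p) $ 2"
  have x: "x = n \<bullet> z - c"
    by (simp add: x_def lienard_map_def inner_diff_right p)
  have nz: "n \<bullet> z = x + c"
    using x by simp
  have xy: "lienard_map n A z + (- lienard_map n A p) = pt x y"
    by (simp add: x_def y_def eq_pt_iff M.diff)
  have o: "lienard_map n A (lin_vf Xo z) = pt (trace A * x - y) (det A * x - a)"
    by (simp add: Xo M.add lienard_map_matrix b pt_linear flip: x_def y_def)
  have mo: "lienard_map n A (lin_vf Xm z) = pt (- trace A * (2 * c) - y) (Dm * (x + 2 * c) - det A * (2 * c) - a)"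
    by (simp add: Xm M.add M.scale o um pt_linear nz algebra_simps)
  have po: "lienard_map n A (lin_vf Xp z) = pt (Tp * x - y) (Dp * x - a)"
    by (simp add: Xp M.add M.scale o up pt_linear nz algebra_simps)
  consider "x \<le> - (2 * c)" | "- (2 * c) < x" "x \<le> 0" | "0 < x"
    by linarith
  then show "lienard_map n A (pwl_vf n c (Xm, Xo, Xp) z) =
      lienard_field (trace A) Tp Dm (det A) Dp (2 * c) a (lienard_map n A z + (- lienard_map n A p))"
    unfolding xy
  proof cases
    case 1
    then have "pwl_vf n c (Xm, Xo, Xp) z = lin_vf Xm z"
      using x by (simp add: pwl_vf_def R_minus_def)
    then show "lienard_map n A (pwl_vf n c (Xm, Xo, Xp) z) =
       lienard_field (trace A) Tp Dm (det A) Dp (2 * c) a (pt x y)"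
      using 1 c by (simp add: mo lienard_field_left)
  next
    case 2
    then have "pwl_vf n c (Xm, Xo, Xp) z = lin_vf Xo z"
      using x by (simp add: pwl_vf_def R_minus_def R_zero_def)
    then show "lienard_map n A (pwl_vf n c (Xm, Xo, Xp) z) =
       lienard_field (trace A) Tp Dm (det A) Dp (2 * c) a (pt x y)"
      using 2 c by (simp add: o lienard_field_middle)
  next
    case 3
    then have "pwl_vf n c (Xm, Xo, Xp) z = lin_vf Xp z"
      using x c by (simp add: pwl_vf_def R_minus_def R_zero_def)
    then show "lienard_map n A (pwl_vf n c (Xm, Xo, Xp) z) =
       lienard_field (trace A) Tp Dm (det A) Dp (2 * c) a (pt x y)"
      using 3 c by (simp add: po lienard_field_right)
  qed
qed

lemma focus_parameters:
  fixes T D :: real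
  assumes "T\<^sup>2 < 4 * D"
  shows "\<exists>b>0. T = 2 * (T / 2 / b) * b \<and> D = b\<^sup>2 * (1 + (T / 2 / b)\<^sup>2) \<and> b = sqrt (D - T\<^sup>2 / 4)"
proof -
  define b where "b = sqrt (D - T\<^sup>2 / 4)"
  have "0 < b" "b\<^sup>2 = D - T\<^sup>2 / 4"
    using assms by (auto simp: b_def)
  then have "T = 2 * (T / 2 / b) * b" "D = b\<^sup>2 * (1 + (T / 2 / b)\<^sup>2)"
    by (simp_all add: field_simps power2_eq_square)
  then show ?thesis
    using \<open>0 < b\<close> b_def by blast
qed

section \<open>Perturbation of the system\<close>

text \<open>The perturbations are chosen in the Lienard coordinates \<open>M\<close>. As \<open>X\<^sub>+ z = X\<^sub>o z + (n \<bullet> z - c) u\<close>, adding a multiple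
  of \<open>M\<^sup>-\<^sup>1 (- 1, 0)\<close> to \<open>u\<close> lowers the trace of \<open>X\<^sub>+\<close> and keeps its determinant. Adding a multiple of
  \<open>M\<^sup>-\<^sup>1 (0, - 1)\<close> to all three fields moves the equilibrium. Both keep the system continuous.\<close>

lemma two_limit_cycles_normalized:
  fixes n p :: "real^2" and Xm Xo Xp :: lin_field
  assumes n: "n \<noteq> 0" and c: "0 < c" and cont: "pwl_continuous n c (Xm, Xo, Xp)"
    and p: "n \<bullet> p = c" "lin_vf Xo p = 0"
    and o: "trace (fst Xo) < 0" "(trace (fst Xo))\<^sup>2 < 4 * det (fst Xo)"
    and r: "0 < trace (fst Xp)" "(trace (fst Xp))\<^sup>2 < 4 * det (fst Xp)"
    and l: "trace (fst Xm) = 0" "0 < det (fst Xm)"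
    and center: "system_center (pwl_vf n c (Xm, Xo, Xp)) p" and eps: "0 < (\<epsilon> :: real)"
  shows "\<exists>S :: pwl_params. dist S (Xm, Xo, Xp) < \<epsilon> \<and> pwl_continuous n c S \<and>
    (\<exists>\<Gamma>1 \<Gamma>2. \<Gamma>1 \<noteq> \<Gamma>2 \<and> limit_cycle (pwl_vf n c S) \<Gamma>1 \<and> limit_cycle (pwl_vf n c S) \<Gamma>2)"
proof -
  define A where "A = fst Xo"
  define M where "M = lienard_map n A"
  let ?To = "trace A" and ?Do = "det A" and ?Tp = "trace (fst Xp)" and ?Dp = "det (fst Xp)"
    and ?Dm = "det (fst Xm)"
  have M: "linear M"
    unfolding M_def by (rule lienard_map_linear)
  interpret M: linear M
    by (rule M)
  have injM: "inj M"
    unfolding M_def by (rule lienard_map_inj[OF n]) (use o in \<open>simp add: A_def\<close>)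
  obtain N where N: "linear N" "\<And>z. N (M z) = z" "\<And>z. M (N z) = z"
    using linear_injective_isomorphism[OF M injM] by blast
  interpret N: linear N
    by (rule N)
  obtain up where up: "\<And>z. lin_vf Xp z = lin_vf Xo z + (n \<bullet> z - c) *\<^sub>R up"
     "\<And>z. fst Xp *v z = A *v z + (n \<bullet> z) *\<^sub>R up"
    using continuous_along_line[OF n, of c Xp Xo] cont
    by (auto simp: pwl_continuous_def L_plus_def A_def)
  obtain um where um: "\<And>z. lin_vf Xm z = lin_vf Xo z + (n \<bullet> z + c) *\<^sub>R um"
     "\<And>z. fst Xm *v z = A *v z + (n \<bullet> z) *\<^sub>R um"
    using continuous_along_line[OF n, of "- c" Xm Xo] cont
    by (auto simp: pwl_continuous_def L_minus_def A_def)
  have Mup: "M up = pt (?Tp - ?To) (?Dp - ?Do)"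
    unfolding M_def using up(2) by (rule lienard_map_rank_one)
  have Mum: "M um = pt (- ?To) (?Dm - ?Do)"
    unfolding M_def using lienard_map_rank_one[OF um(2)] l(1) by simp
  have Xo: "lin_vf Xo z = A *v (z - p)" for z
    using p(2) by (simp add: lin_vf_def A_def matrix_vector_mult_diff_distrib add_eq_0_iff)
  obtain bo where bo: "0 < bo" "?To = 2 * (?To / 2 / bo) * bo" "?Do = bo\<^sup>2 * (1 + (?To / 2 / bo)\<^sup>2)"
    using focus_parameters o(2) unfolding A_def by blast
  obtain bp where bp: "0 < bp" "?Tp = 2 * (?Tp / 2 / bp) * bp" "?Dp = bp\<^sup>2 * (1 + (?Tp / 2 / bp)\<^sup>2)"
      "bp = sqrt (?Dp - ?Tp\<^sup>2 / 4)"
    using focus_parameters r(2) by blast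
  define go gp where "go = ?To / 2 / bo" and "gp = ?Tp / 2 / bp"
  have go: "go < 0"
    using o(1) bo(1) by (simp add: go_def A_def divide_neg_pos)
  note Po = bo(2,3)[folded go_def] and Pp = bp(2,3)[folded gp_def]
  have w: "0 < 2 * c"
    using c by simp

  \<comment> \<open>A point of the half-line close to the focus lies on a periodic orbit that avoids the focus.\<close>
  have bal: "gp + go = 0"
  proof -
    let ?F = "pwl_vf n c (Xm, Xo, Xp)" and ?G = "lienard_field ?To ?Tp ?Dm ?Do ?Dp (2 * c) 0"
    have conj: "M (?F z) = ?G (M z + (- M p))" for z
      unfolding M_def
      by (rule pwl_vf_lienard_form(2)[OF c p(1), where b = 0 and up = up and um = um])
        (use Xo up(1) um(1) Mup Mum M.zero in \<open>simp_all add: M_def pt_linear\<close>)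
    obtain U where U: "p \<in> interior U" "U - {p} = \<Union>{\<Gamma>. periodic_orbit ?F \<Gamma> \<and> \<Gamma> \<subseteq> U - {p}}"
      using center by (auto simp: system_center_def)
    have "((\<lambda>v. p + N (v *\<^sub>R pt 0 1)) \<longlongrightarrow> p + N (0 *\<^sub>R pt 0 1)) (at_right 0)"
      by (intro tendsto_add tendsto_const bounded_linear.tendsto[OF linear_conv_bounded_linear[THEN iffD1, OF N(1)]]
          tendsto_scaleR tendsto_ident_at)
    then have "((\<lambda>v. p + N (v *\<^sub>R pt 0 1)) \<longlongrightarrow> p) (at_right 0)"
      by (simp add: N.zero)
    then have "\<forall>\<^sub>F v in at_right 0. p + N (v *\<^sub>R pt 0 1) \<in> interior U"
      using U(1) by (intro topological_tendstoD) auto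
    moreover have "\<forall>\<^sub>F v in at_right 0. v \<in> {0<..<bo * (2 * c)}"
      by (rule eventually_at_right_real) (use bo(1) c in simp)
    ultimately have "\<forall>\<^sub>F v in at_right 0. p + N (v *\<^sub>R pt 0 1) \<in> interior U \<and> v \<in> {0<..<bo * (2 * c)}"
      by eventually_elim auto
    then obtain v where v: "p + N (v *\<^sub>R pt 0 1) \<in> interior U" "0 < v" "v < bo * (2 * c)"
      using eventually_happens'[of "at_right (0::real)"] by force
    define z where "z = p + N (v *\<^sub>R pt 0 1)"
    have Mz: "M z + (- M p) = pt 0 v"
      by (simp add: z_def M.add N pt_linear)
    have "z \<noteq> p"
      using Mz v(2) by (auto simp: pt_linear)
    then have "z \<in> U - {p}"
      using v(1) interior_subset by (auto simp: z_def)
    then have "\<exists>\<Gamma>. periodic_orbit ?F \<Gamma> \<and> \<Gamma> \<subseteq> U - {p} \<and> z \<in> \<Gamma>"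
      by (subst (asm) U(2)) blast
    then obtain \<Gamma> where \<Gamma>: "periodic_orbit ?F \<Gamma>" "\<Gamma> \<subseteq> U - {p}" "z \<in> \<Gamma>"
      by blast
    have "periodic_orbit ?G ((\<lambda>z. M z + (- M p)) ` \<Gamma>)"
      using periodic_orbit_affine[OF linear_conv_bounded_linear[THEN iffD1, OF M] injM conj \<Gamma>(1)] .
    moreover have "pt 0 v \<in> (\<lambda>z. M z + (- M p)) ` \<Gamma>"
      using \<Gamma>(3) Mz by (metis imageI)
    moreover have "pt 0 0 \<notin> (\<lambda>z. M z + (- M p)) ` \<Gamma>"
    proof
      assume "pt 0 0 \<in> (\<lambda>z. M z + (- M p)) ` \<Gamma>"
      then obtain z where "z \<in> \<Gamma>" "M z = M p"
        by (auto simp flip: pt_linear(5))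
      then show False
        using \<Gamma>(2) injD[OF injM] by blast
    qed
    ultimately show ?thesis
      using v(2,3) half_turns_cancel[OF go bo(1) bp(1) w, where gp = gp and Dm = ?Dm, folded Po Pp]
      by simp
  qed

  define e f where "e = N (pt (- 1) 0)" and "f = N (pt 0 (- 1))"
  define E :: "real^2^2" where "E = (\<chi> i j. e $ i * n $ j)"
  have E: "E *v z = (n \<bullet> z) *\<^sub>R e" for z
    by (simp add: E_def vec_eq_iff forall_2 matrix_vector_mult_2 inner_2 algebra_simps)
  define S :: "real \<Rightarrow> real \<Rightarrow> pwl_params" where
    "S = (\<lambda>d a. ((fst Xm, snd Xm + a *\<^sub>R f), (A, snd Xo + a *\<^sub>R f),
       (fst Xp + d *\<^sub>R E, snd Xp + a *\<^sub>R f - (c * d) *\<^sub>R e)))"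
  have S0: "S 0 0 = (Xm, Xo, Xp)"
    by (simp add: S_def A_def)
  have limd: "((\<lambda>d. S d 0) \<longlongrightarrow> S 0 0) (at_right 0)"
    unfolding S_def by (intro tendsto_intros)
  have lima: "((\<lambda>a. S d a) \<longlongrightarrow> S d 0) (at_right 0)" for d
    unfolding S_def by (intro tendsto_intros)
  have "\<forall>\<^sub>F d in at_right 0. dist (S d 0) (S 0 0) < \<epsilon>"
    using tendstoD[OF limd eps] .
  moreover have "\<forall>\<^sub>F d in at_right 0. d \<in> {0<..<?Tp}"
    by (rule eventually_at_right_real) (use r in simp)
  ultimately have "\<forall>\<^sub>F d in at_right 0. dist (S d 0) (S 0 0) < \<epsilon> \<and> d \<in> {0<..<?Tp}"
    by eventually_elim auto
  then obtain d where d: "dist (S d 0) (S 0 0) < \<epsilon>" "0 < d" "d < ?Tp"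
    using eventually_happens'[of "at_right (0::real)"] by force
  \<comment> \<open>The smaller trace also increases \<open>b\<close>, so \<open>T / (2 b)\<close> decreases.\<close>
  define Tq where "Tq = ?Tp - d"
  have Tq: "0 < Tq" "Tq < ?Tp"
    using d by (simp_all add: Tq_def)
  have sq: "Tq\<^sup>2 < ?Tp\<^sup>2"
    using Tq by (intro power_strict_mono) auto
  obtain bq where bq: "0 < bq" "Tq = 2 * (Tq / 2 / bq) * bq" "?Dp = bq\<^sup>2 * (1 + (Tq / 2 / bq)\<^sup>2)"
      "bq = sqrt (?Dp - Tq\<^sup>2 / 4)"
    using focus_parameters[OF less_trans[OF sq r(2)]] by blast
  define gq where "gq = Tq / 2 / bq"
  note Pq = bq(2,3)[folded gq_def]
  have gq: "0 < gq"
    using Tq(1) bq(1) by (simp add: gq_def)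
  have "bp < bq"
    unfolding bp(4) bq(4) using sq by simp
  then have "Tq / 2 / bq < ?Tp / 2 / bp"
    using Tq bp(1) by (intro frac_less) auto
  then have neg: "gq + go < 0"
    using bal by (simp add: gq_def gp_def)
  have "\<forall>\<^sub>F a in at_right 0. dist (S d a) (S 0 0) < \<epsilon>"
    using order_tendstoD(2)[OF tendsto_dist[OF lima tendsto_const] d(1)] .
  with eventually_two_limit_cycles[OF go gq neg bo(1) bq(1) w l(2), folded Po Pq]
  have "\<forall>\<^sub>F a in at_right 0. dist (S d a) (S 0 0) < \<epsilon> \<and>
    (\<exists>\<Gamma>1 \<Gamma>2. \<Gamma>1 \<noteq> \<Gamma>2 \<and> limit_cycle (lienard_field ?To Tq ?Dm ?Do ?Dp (2 * c) a) \<Gamma>1 \<and>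
       limit_cycle (lienard_field ?To Tq ?Dm ?Do ?Dp (2 * c) a) \<Gamma>2)"
    by eventually_elim simp
  from eventually_happens'[OF trivial_limit_at_right_real this]
  obtain a \<Gamma>1 \<Gamma>2 where a: "dist (S d a) (S 0 0) < \<epsilon>" "\<Gamma>1 \<noteq> \<Gamma>2"
    "limit_cycle (lienard_field ?To Tq ?Dm ?Do ?Dp (2 * c) a) \<Gamma>1"
    "limit_cycle (lienard_field ?To Tq ?Dm ?Do ?Dp (2 * c) a) \<Gamma>2"
    by blast
  have Xo': "lin_vf (A, snd Xo + a *\<^sub>R f) z = A *v (z - p) + a *\<^sub>R f" for z
    using Xo[of z] by (simp add: lin_vf_def A_def)
  have Xp': "lin_vf (fst Xp + d *\<^sub>R E, snd Xp + a *\<^sub>R f - (c * d) *\<^sub>R e) z =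
      lin_vf (A, snd Xo + a *\<^sub>R f) z + (n \<bullet> z - c) *\<^sub>R (up + d *\<^sub>R e)" for z
    using up(1)[of z]
    by (simp add: lin_vf_def A_def matrix_vector_mult_add_rdistrib scaleR_matrix_vector_assoc[symmetric]
        E algebra_simps)
  have Xm': "lin_vf (fst Xm, snd Xm + a *\<^sub>R f) z =
      lin_vf (A, snd Xo + a *\<^sub>R f) z + (n \<bullet> z + c) *\<^sub>R um" for z
    using um(1)[of z] by (simp add: lin_vf_def A_def algebra_simps)
  have Mf: "M (a *\<^sub>R f) = pt 0 (- a)"
    by (simp add: M.scale f_def N pt_linear)
  have Mup': "M (up + d *\<^sub>R e) = pt (Tq - ?To) (?Dp - ?Do)"
    by (simp add: M.add M.scale e_def N Mup pt_linear Tq_def)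
  note form = pwl_vf_lienard_form[OF c p(1) Xo' Mf[unfolded M_def] Xp' Mup'[unfolded M_def] Xm' Mum[unfolded M_def],
      folded M_def]
  have S: "S d a = ((fst Xm, snd Xm + a *\<^sub>R f), (A, snd Xo + a *\<^sub>R f),
       (fst Xp + d *\<^sub>R E, snd Xp + a *\<^sub>R f - (c * d) *\<^sub>R e))"
    by (simp add: S_def)
  note lc = limit_cycle_affine[where M = M and N = N and d = "- M p" and F = "pwl_vf n c (S d a)" and
      G = "lienard_field ?To Tq ?Dm ?Do ?Dp (2 * c) a", OF linear_conv_bounded_linear[THEN iffD1, OF M]
      linear_conv_bounded_linear[THEN iffD1, OF N(1)] N(3,2) form(2)[folded S]]
  have "inj (\<lambda>z. N z - N (- M p))"
  proof (rule injI)
    fix z z' assume "N z - N (- M p) = N z' - N (- M p)"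
    then have "M (N z) = M (N z')"
      by simp
    then show "z = z'"
      by (simp only: N(3))
  qed
  then have "(\<lambda>z. N z - N (- M p)) ` \<Gamma>1 \<noteq> (\<lambda>z. N z - N (- M p)) ` \<Gamma>2"
    using a(2) by (simp add: inj_image_eq_iff)
  then show ?thesis
    using lc[OF a(3)] lc[OF a(4)] form(1)[folded S] a(1)[unfolded S0]
    by (intro exI[of _ "S d a"] conjI exI)
qed

section \<open>Time reversal and reflection\<close>

lemma limit_cycle_uminus: "limit_cycle (\<lambda>x. - F x) = limit_cycle F"
  unfolding limit_cycle_def[abs_def] periodic_orbit_uminus_iff ..

lemma lin_vf_uminus: "lin_vf (- X) x = - lin_vf X x"
  by (simp add: lin_vf_def vec_eq_iff forall_2 matrix_vector_mult_2)

lemma pwl_vf_uminus: "pwl_vf n c (- S) = (\<lambda>x. - pwl_vf n c S x)"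
proof (cases S rule: prod_cases3)
  case (fields Xm Xo Xp)
  then have "- S = (- Xm, - Xo, - Xp)"
    by simp
  then show ?thesis
    by (simp add: fields pwl_vf_def fun_eq_iff lin_vf_uminus)
qed

lemma pwl_continuous_uminus: "pwl_continuous n c (- S) = pwl_continuous n c S"
proof (cases S rule: prod_cases3)
  case (fields Xm Xo Xp)
  then have "- S = (- Xm, - Xo, - Xp)"
    by simp
  then show ?thesis
    by (simp add: fields pwl_continuous_def lin_vf_uminus)
qed

lemma pwl_continuous_swap: "pwl_continuous (- n) c (Xp, Xo, Xm) = pwl_continuous n c (Xm, Xo, Xp)"
  by (auto simp: pwl_continuous_def L_minus_def L_plus_def)

lemma pwl_vf_swap:
  assumes "0 < c" "pwl_continuous n c (Xm, Xo, Xp)"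
  shows "pwl_vf (- n) c (Xp, Xo, Xm) = pwl_vf n c (Xm, Xo, Xp)"
proof
  fix x
  show "pwl_vf (- n) c (Xp, Xo, Xm) x = pwl_vf n c (Xm, Xo, Xp) x"
    using assms by (auto simp: pwl_vf_def pwl_continuous_def R_minus_def R_zero_def L_minus_def L_plus_def)
qed

lemma dist_swap: "dist (x, y, z) (x', y', z') = dist (z, y, x) (z', y', x')"
  by (simp add: dist_Pair_Pair add_ac)

lemma two_limit_cycles_plus:
  fixes n p :: "real^2" and Xm Xo Xp :: lin_field
  assumes n: "n \<noteq> 0" and c: "0 < c" and cont: "pwl_continuous n c (Xm, Xo, Xp)"
    and p: "n \<bullet> p = c" "lin_vf Xo p = 0"
    and disc: "(trace (fst Xo))\<^sup>2 < 4 * det (fst Xo)" "(trace (fst Xp))\<^sup>2 < 4 * det (fst Xp)"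
    and sign: "trace (fst Xo) * trace (fst Xp) < 0"
    and l: "trace (fst Xm) = 0" "0 < det (fst Xm)"
    and center: "system_center (pwl_vf n c (Xm, Xo, Xp)) p" and eps: "0 < (\<epsilon> :: real)"
  shows "\<exists>S :: pwl_params. dist S (Xm, Xo, Xp) < \<epsilon> \<and> pwl_continuous n c S \<and>
    (\<exists>\<Gamma>1 \<Gamma>2. \<Gamma>1 \<noteq> \<Gamma>2 \<and> limit_cycle (pwl_vf n c S) \<Gamma>1 \<and> limit_cycle (pwl_vf n c S) \<Gamma>2)"
proof (cases "trace (fst Xo) < 0")
  case True
  then have "0 < trace (fst Xp)"
    using sign by (simp add: mult_less_0_iff)
  then show ?thesis
    using two_limit_cycles_normalized[OF n c cont p True disc(1) _ disc(2) l center eps] by simp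
next
  case False
  then have s: "0 < trace (fst Xo)" "trace (fst Xp) < 0"
    using sign by (auto simp: mult_less_0_iff)
  have tr: "trace (- B) = - trace B" "det (- B) = det B" for B :: "real^2^2"
    by (simp_all add: trace_2 det_2)
  have mp: "(- Xm, - Xo, - Xp) = - (Xm, Xo, Xp)"
    by simp
  have lv: "lin_vf (- Xo) p = 0"
    using p(2) by (simp add: lin_vf_uminus)
  have "\<exists>S :: pwl_params. dist S (- Xm, - Xo, - Xp) < \<epsilon> \<and> pwl_continuous n c S \<and>
    (\<exists>\<Gamma>1 \<Gamma>2. \<Gamma>1 \<noteq> \<Gamma>2 \<and> limit_cycle (pwl_vf n c S) \<Gamma>1 \<and> limit_cycle (pwl_vf n c S) \<Gamma>2)"
  proof (rule two_limit_cycles_normalized[OF n c _ p(1) lv _ _ _ _ _ _ _ eps])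
    show "pwl_continuous n c (- Xm, - Xo, - Xp)"
      unfolding mp pwl_continuous_uminus by (rule cont)
    show "system_center (pwl_vf n c (- Xm, - Xo, - Xp)) p"
      using center unfolding mp pwl_vf_uminus system_center_def periodic_orbit_uminus_iff by simp
  qed (use s disc l in \<open>simp_all add: tr\<close>)
  then obtain S :: pwl_params and \<Gamma>1 \<Gamma>2 where S: "dist S (- (Xm, Xo, Xp)) < \<epsilon>" "pwl_continuous n c S"
    "\<Gamma>1 \<noteq> \<Gamma>2" "limit_cycle (pwl_vf n c S) \<Gamma>1" "limit_cycle (pwl_vf n c S) \<Gamma>2"
    unfolding mp by blast
  have "dist (- S) (Xm, Xo, Xp) = dist S (- (Xm, Xo, Xp))"
    using dist_minus[of S "- (Xm, Xo, Xp)"] by simp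
  then show ?thesis
    using S by (intro exI[of _ "- S"]) (auto simp: pwl_continuous_uminus pwl_vf_uminus limit_cycle_uminus)
qed

section \<open>Traces and determinants of foci and centers\<close>

text \<open>For a \<open>2 \<times> 2\<close> matrix an eigenvector can be read off from a nonzero row of \<open>A - l I\<close>; if there
  is none, every vector is an eigenvector.\<close>

lemma complex_eigenvalueI:
  fixes A :: "real^2^2"
  assumes root: "l\<^sup>2 - complex_of_real (trace A) * l + complex_of_real (det A) = 0"
  shows "l \<in> complex_eigenvalues A"
proof -
  define B where "B = map_matrix complex_of_real A"
  have B: "(B *v v) $ 1 = of_real (A $ 1 $ 1) * v $ 1 + of_real (A $ 1 $ 2) * v $ 2"
    "(B *v v) $ 2 = of_real (A $ 2 $ 1) * v $ 1 + of_real (A $ 2 $ 2) * v $ 2" for v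
    by (simp_all add: B_def map_matrix_def matrix_vector_mult_def sum_2)
  have r: "(l - of_real (A $ 1 $ 1)) * (l - of_real (A $ 2 $ 2)) = of_real (A $ 1 $ 2) * of_real (A $ 2 $ 1)"
    using root by (simp add: trace_2 det_2 power2_eq_square algebra_simps)
  consider "A $ 1 $ 2 \<noteq> 0 \<or> l \<noteq> of_real (A $ 1 $ 1)" | "A $ 2 $ 1 \<noteq> 0 \<or> l \<noteq> of_real (A $ 2 $ 2)"
    | "A $ 1 $ 2 = 0" "A $ 2 $ 1 = 0" "l = of_real (A $ 1 $ 1)" "l = of_real (A $ 2 $ 2)"
    by blast
  then have "\<exists>v. v \<noteq> 0 \<and> B *v v = l *s v"
  proof cases
    case 1
    let ?v = "vector [of_real (A $ 1 $ 2), l - of_real (A $ 1 $ 1)] :: complex^2"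
    have "B *v ?v = l *s ?v"
      using r by (simp add: vec_eq_iff forall_2 B algebra_simps)
    moreover have "?v \<noteq> 0"
      using 1 by (auto simp: vec_eq_iff forall_2)
    ultimately show ?thesis by blast
  next
    case 2
    let ?v = "vector [l - of_real (A $ 2 $ 2), of_real (A $ 2 $ 1)] :: complex^2"
    have "B *v ?v = l *s ?v"
      using r by (simp add: vec_eq_iff forall_2 B algebra_simps)
    moreover have "?v \<noteq> 0"
      using 2 by (auto simp: vec_eq_iff forall_2)
    ultimately show ?thesis by blast
  next
    case 3
    let ?v = "vector [1, 0] :: complex^2"
    have "B *v ?v = l *s ?v"
      using 3 by (simp add: vec_eq_iff forall_2 B)
    moreover have "?v \<noteq> 0"
      by (simp add: vec_eq_iff forall_2)
    ultimately show ?thesis by blast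
  qed
  then show ?thesis
    by (simp add: complex_eigenvalues_def B_def)
qed

text \<open>A nonnegative discriminant would give a real root of the characteristic polynomial; if it is negative, the
  roots have real part \<open>trace A / 2\<close>.\<close>

lemma nonreal_eigenvalues:
  fixes A :: "real^2^2"
  assumes "\<forall>l\<in>complex_eigenvalues A. Im l \<noteq> 0"
  shows "(trace A)\<^sup>2 < 4 * det A" "\<exists>l\<in>complex_eigenvalues A. Re l = trace A / 2"
proof -
  show disc: "(trace A)\<^sup>2 < 4 * det A"
  proof (rule ccontr)
    assume neg: "\<not> ?thesis"
    define r where "r = (trace A + sqrt ((trace A)\<^sup>2 - 4 * det A)) / 2"
    have "(sqrt ((trace A)\<^sup>2 - 4 * det A))\<^sup>2 = (trace A)\<^sup>2 - 4 * det A"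
      using neg by simp
    then have "r\<^sup>2 - trace A * r + det A = 0"
      by (simp add: r_def power2_eq_square field_simps)
    then have "complex_of_real (r\<^sup>2 - trace A * r + det A) = 0"
      by simp
    then have "complex_of_real r \<in> complex_eigenvalues A"
      by (intro complex_eigenvalueI) simp
    then show False
      using assms by force
  qed
  define s where "s = sqrt (det A - (trace A)\<^sup>2 / 4)"
  have "s * s = det A - (trace A)\<^sup>2 / 4"
    using disc by (simp add: s_def)
  then have "Complex (trace A / 2) s \<in> complex_eigenvalues A"
    by (intro complex_eigenvalueI) (simp add: complex_eq_iff power2_eq_square field_simps)
  then show "\<exists>l\<in>complex_eigenvalues A. Re l = trace A / 2"
    by force
qed

lemma lin_focus_disc: "lin_focus X p \<Longrightarrow> (trace (fst X))\<^sup>2 < 4 * det (fst X)"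
  by (rule nonreal_eigenvalues) (simp add: lin_focus_def)

lemma lin_center_trace_det:
  assumes "lin_center X p"
  shows "trace (fst X) = 0" "0 < det (fst X)"
proof -
  have im: "\<forall>l\<in>complex_eigenvalues (fst X). Im l \<noteq> 0"
    using assms by (simp add: lin_center_def)
  show tr: "trace (fst X) = 0"
    using nonreal_eigenvalues(2)[OF im] assms by (auto simp: lin_center_def)
  show "0 < det (fst X)"
    using nonreal_eigenvalues(1)[OF im] tr by simp
qed

lemma lin_focus_trace: "lin_focus X p \<Longrightarrow> trace (fst X) \<noteq> 0"
  using nonreal_eigenvalues(2)[of "fst X"] by (auto simp: lin_focus_def)

lemma attracting_focus_trace: "attracting_focus X p \<Longrightarrow> trace (fst X) < 0"
  using nonreal_eigenvalues(2)[of "fst X"] by (auto simp: attracting_focus_def lin_focus_def)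

lemma repelling_focus_trace: "repelling_focus X p \<Longrightarrow> 0 < trace (fst X)"
  using nonreal_eigenvalues(2)[of "fst X"] by (auto simp: repelling_focus_def lin_focus_def)

lemma foci_different_stability_trace:
  "foci_different_stability X p Y q \<Longrightarrow> trace (fst X) * trace (fst Y) < 0"
  by (auto simp: foci_different_stability_def mult_less_0_iff
      dest: attracting_focus_trace repelling_focus_trace)

section \<open>Two limit cycles near the center\<close>

theorem theorem2:
  fixes n :: "real^2" and c :: real
    and Xm Xo Xp :: lin_field and p :: "real^2"
  assumes "n \<noteq> 0" and "c > 0"
    and "pwl_continuous n c (Xm, Xo, Xp)"
    and "lin_focus Xo p"
    and "(\<exists>q r. lin_center Xm q \<and> foci_different_stability Xo p Xp r) \<or>
         (\<exists>q r. lin_center Xp q \<and> foci_different_stability Xo p Xm r)"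
    and "p \<in> R_zero n c" and "p \<in> frontier (R_zero n c)"
    and "p \<in> L_plus n c \<and> lin_focus Xp p \<or> p \<in> L_minus n c \<and> lin_focus Xm p"
    and "system_center (pwl_vf n c (Xm, Xo, Xp)) p"
  shows "\<forall>\<epsilon>>0. \<exists>S :: pwl_params. dist S (Xm, Xo, Xp) < \<epsilon> \<and> pwl_continuous n c S \<and>
           (\<exists>\<Gamma>1 \<Gamma>2. \<Gamma>1 \<noteq> \<Gamma>2 \<and> limit_cycle (pwl_vf n c S) \<Gamma>1 \<and> limit_cycle (pwl_vf n c S) \<Gamma>2)"
proof (intro allI impI)
  fix \<epsilon> :: real assume eps: "\<epsilon> > 0"
  have Xo: "lin_vf Xo p = 0" "(trace (fst Xo))\<^sup>2 < 4 * det (fst Xo)"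
    using assms(4) lin_focus_disc[OF assms(4)] by (simp_all add: lin_focus_def)
  from assms(8) show "\<exists>S :: pwl_params. dist S (Xm, Xo, Xp) < \<epsilon> \<and> pwl_continuous n c S \<and>
           (\<exists>\<Gamma>1 \<Gamma>2. \<Gamma>1 \<noteq> \<Gamma>2 \<and> limit_cycle (pwl_vf n c S) \<Gamma>1 \<and> limit_cycle (pwl_vf n c S) \<Gamma>2)"
  proof
    assume p: "p \<in> L_plus n c \<and> lin_focus Xp p"
    then have "\<nexists>q. lin_center Xp q"
      using lin_focus_trace lin_center_trace_det(1) by blast
    then obtain q r where q: "lin_center Xm q" "foci_different_stability Xo p Xp r"
      using assms(5) by blast
    show ?thesis
      using two_limit_cycles_plus[OF assms(1-3) _ Xo _ foci_different_stability_trace[OF q(2)]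
          lin_center_trace_det[OF q(1)] assms(9) eps] p lin_focus_disc[of Xp p]
      by (simp add: L_plus_def)
  next
    assume p: "p \<in> L_minus n c \<and> lin_focus Xm p"
    then have "\<nexists>q. lin_center Xm q"
      using lin_focus_trace lin_center_trace_det(1) by blast
    then obtain q r where q: "lin_center Xp q" "foci_different_stability Xo p Xm r"
      using assms(5) by blast
    have cont: "pwl_continuous (- n) c (Xp, Xo, Xm)"
      using assms(3) by (simp only: pwl_continuous_swap)
    have "- n \<noteq> 0" "(- n) \<bullet> p = c"
      using assms(1) p by (simp_all add: L_minus_def)
    moreover have "system_center (pwl_vf (- n) c (Xp, Xo, Xm)) p"
      using assms(9) pwl_vf_swap[OF assms(2,3)] by simp
    ultimately obtain S :: pwl_params and \<Gamma>1 \<Gamma>2 where S: "dist S (Xp, Xo, Xm) < \<epsilon>"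
      "pwl_continuous (- n) c S" "\<Gamma>1 \<noteq> \<Gamma>2" "limit_cycle (pwl_vf (- n) c S) \<Gamma>1"
      "limit_cycle (pwl_vf (- n) c S) \<Gamma>2"
      using two_limit_cycles_plus[OF _ assms(2) cont _ Xo lin_focus_disc[of Xm p]
          foci_different_stability_trace[OF q(2)] lin_center_trace_det[OF q(1)] _ eps] p
      by blast
    obtain Yp Yo Ym where Y: "S = (Yp, Yo, Ym)"
      by (cases S) auto
    have contY: "pwl_continuous n c (Ym, Yo, Yp)"
      using S(2) by (simp only: Y pwl_continuous_swap)
    have "dist (Ym, Yo, Yp) (Xm, Xo, Xp) < \<epsilon>"
      using S(1) by (simp only: Y dist_swap[of Ym])
    then show ?thesis
      using contY S(3-5) pwl_vf_swap[OF assms(2) contY]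
      by (intro exI[of _ "(Ym, Yo, Yp)"] conjI exI[of _ \<Gamma>1] exI[of _ \<Gamma>2]) (simp_all add: Y)
  qed
qed

end
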